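(* Let $(\mathsf{A},\Delta)$ be a compact quantum group whose Haar state $h$ is faithful on $\mathsf{A}$, with dense Hopf $*$-algebra $\mathcal{A}$. Let $L$ be a GNS-symmetric operator on $\mathcal{A}\subset L^2(\mathsf{A},h)$, i.e. a linear map $L:\mathcal{A}\to\mathcal{A}$ with $h(a^*L(b))=h(L(a)^*b)$ for all $a,b\in\mathcal{A}$. Then the following conditions are equivalent: (1) there exists a functional $\phi\in\mathcal{A}'$ such that $L=L_\phi$, where $L_\phi=(\mathrm{id}\otimes\phi)\circ\Delta$; (2) $L$ is translation invariant on $\mathcal{A}$, i.e. $\Delta\circ L=(\mathrm{id}\otimes L)\circ\Delta$; (3) the semigroup $(T_t)_{t\ge0}$ on $\mathcal{A}$ (or on $\mathsf{A}_r$, or on $\mathsf{A}_u$) associated to $L$ by the formula $T_t|_{\mathcal{A}}=\exp(tL)$ is translation invariant, i.e. $\Delta\circ T_t=(\mathrm{id}\otimes T_t)\circ\Delta$ for all $t\ge0$; (4) the sesquilinear form $\mathcal{Q}$ on $\mathcal{A}$ defined by $\mathcal{Q}(a,b)=-h(a^*L(b))$ satisfies $$\mathcal{Q}(a,b)\mathbf{1}=(m_*\otimes\mathcal{Q})(\Delta(a),\Delta(b)),\qquad a,b\in\mathcal{A},$$ where $m_*$ is the sesquilinear map obtained from the multiplication, $m_*(a,b)=a^*b$; in Sweedler notation, $\mathcal{Q}(a,b)\mathbf{1}=a_{(1)}^*b_{(1)}\,\mathcal{Q}(a_{(2)},b_{(2)})$.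
   Context: $\mathcal{A}\subseteq\mathsf{A}$ is the dense Hopf $*$-algebra spanned by the coefficients of finite-dimensional unitary corepresentations; $\mathcal{A}'$ is the space of all linear functionals on $\mathcal{A}$; $h$ is the Haar state, the unique state with $(h\otimes\mathrm{id})\Delta(a)=h(a)\mathbf{1}=(\mathrm{id}\otimes h)\Delta(a)$; $L^2(\mathsf{A},h)$ is the GNS Hilbert space of $(\mathsf{A},h)$, in which $\mathcal{A}$ is embedded by $a\mapsto a\xi_h$, with $\xi_h$ the cyclic vector. $\mathsf{A}_r$ is the reduced C$^*$-algebra generated by $\mathcal{A}$ (the norm closure of $\mathcal{A}$ in its GNS representation with respect to $h$) and $\mathsf{A}_u$ is the universal C$^*$-algebra generated by $\mathcal{A}$; on both, $\Delta$ denotes the unique unital $*$-homomorphism extending the coproduct of $\mathcal{A}$. Sweedler notation: $\Delta(a)=a_{(1)}\otimes a_{(2)}$ and $\Delta(b)=b_{(1)}\otimes b_{(2)}$, with independent sums. Sesquilinear forms are linear in the right entry. *)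

theory Defs
  imports "HOL-Analysis.Analysis"
begin

section \<open>Unital C*-algebras\<close>

text \<open>Compatibility of the norm with complex scalars, isometry of the involution and
  conjugate-linearity in the remaining cases follow from the axioms listed here.
  The zero algebra is excluded (it carries no state).\<close>

class cstar_algebra = banach + real_normed_algebra_1 +
  fixes scaleC :: "complex \<Rightarrow> 'a \<Rightarrow> 'a" (infixr "*\<^sub>C" 75)
    and star :: "'a \<Rightarrow> 'a" ("(_\<^sup>\<star>)" [1000] 999)
  assumes scaleC_add_right: "c *\<^sub>C (x + y) = c *\<^sub>C x + c *\<^sub>C y"
    and scaleC_add_left: "(c + d) *\<^sub>C x = c *\<^sub>C x + d *\<^sub>C x"
    and scaleC_scaleC: "c *\<^sub>C d *\<^sub>C x = (c * d) *\<^sub>C x"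
    and scaleC_of_real: "complex_of_real r *\<^sub>C x = r *\<^sub>R x"
    and mult_scaleC_left: "(c *\<^sub>C x) * y = c *\<^sub>C (x * y)"
    and mult_scaleC_right: "x * (c *\<^sub>C y) = c *\<^sub>C (x * y)"
    and star_star: "(x\<^sup>\<star>)\<^sup>\<star> = x"
    and star_add: "(x + y)\<^sup>\<star> = x\<^sup>\<star> + y\<^sup>\<star>"
    and star_scaleC: "(c *\<^sub>C x)\<^sup>\<star> = cnj c *\<^sub>C x\<^sup>\<star>"
    and star_mult: "(x * y)\<^sup>\<star> = y\<^sup>\<star> * x\<^sup>\<star>"
    and cstar_identity: "norm (x\<^sup>\<star> * x) = (norm x)\<^sup>2"

lemma scaleC_one: "1 *\<^sub>C (x::'a::cstar_algebra) = x"
  using scaleC_of_real[of 1 x] by simp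

global_interpretation cplx: vector_space "scaleC :: complex \<Rightarrow> 'a \<Rightarrow> 'a::cstar_algebra"
  by unfold_locales (simp_all add: scaleC_add_right scaleC_add_left scaleC_scaleC scaleC_one)

abbreviation cspan :: "'a::cstar_algebra set \<Rightarrow> 'a set"
  where "cspan \<equiv> module.span scaleC"

definition clinear_on :: "'a::cstar_algebra set \<Rightarrow> ('a \<Rightarrow> 'b::cstar_algebra) \<Rightarrow> bool"
  where "clinear_on S f \<longleftrightarrow>
    (\<forall>x\<in>S. \<forall>y\<in>S. f (x + y) = f x + f y) \<and> (\<forall>c. \<forall>x\<in>S. f (c *\<^sub>C x) = c *\<^sub>C f x)"

definition functional_on :: "'a::cstar_algebra set \<Rightarrow> ('a \<Rightarrow> complex) \<Rightarrow> bool"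
  where "functional_on S \<phi> \<longleftrightarrow>
    (\<forall>x\<in>S. \<forall>y\<in>S. \<phi> (x + y) = \<phi> x + \<phi> y) \<and> (\<forall>c. \<forall>x\<in>S. \<phi> (c *\<^sub>C x) = c * \<phi> x)"

definition bounded_clinear :: "('a::cstar_algebra \<Rightarrow> 'b::cstar_algebra) \<Rightarrow> bool"
  where "bounded_clinear f \<longleftrightarrow> clinear_on UNIV f \<and> (\<exists>K. \<forall>x. norm (f x) \<le> K * norm x)"

definition star_hom_on :: "'a::cstar_algebra set \<Rightarrow> ('a \<Rightarrow> 'b::cstar_algebra) \<Rightarrow> bool"
  where "star_hom_on S f \<longleftrightarrow> clinear_on S f \<and> f 1 = 1 \<and>
    (\<forall>x\<in>S. \<forall>y\<in>S. f (x * y) = f x * f y) \<and> (\<forall>x\<in>S. f (x\<^sup>\<star>) = (f x)\<^sup>\<star>)"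

text \<open>Positive linear functional of norm one; on a unital algebra the norm is attained at the unit.\<close>

definition state :: "('a::cstar_algebra \<Rightarrow> complex) \<Rightarrow> bool"
  where "state \<phi> \<longleftrightarrow> functional_on UNIV \<phi> \<and> (\<forall>x. \<phi> (x\<^sup>\<star> * x) \<in> \<real>\<^sub>\<ge>\<^sub>0) \<and>
    (\<forall>x. cmod (\<phi> x) \<le> norm x) \<and> \<phi> 1 = 1"

definition faithful :: "('a::cstar_algebra \<Rightarrow> complex) \<Rightarrow> bool"
  where "faithful \<phi> \<longleftrightarrow> (\<forall>x. \<phi> (x\<^sup>\<star> * x) = 0 \<longrightarrow> x = 0)"


section \<open>Minimal tensor products\<close>

text \<open>A list \<open>[(x\<^sub>1, y\<^sub>1), \<dots>, (x\<^sub>n, y\<^sub>n)]\<close> stands for the element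
  \<open>x\<^sub>1 \<otimes> y\<^sub>1 + \<dots> + x\<^sub>n \<otimes> y\<^sub>n\<close> of the algebraic tensor product.\<close>

type_synonym ('a, 'b) formal_tensor = "('a \<times> 'b) list"

definition ft_mult ::
    "('a::cstar_algebra, 'b::cstar_algebra) formal_tensor \<Rightarrow> ('a, 'b) formal_tensor \<Rightarrow>
     ('a, 'b) formal_tensor"
  where "ft_mult zs ws = concat (map (\<lambda>(a, b). map (\<lambda>(c, d). (a * c, b * d)) ws) zs)"

text \<open>\<open>(\<phi> \<otimes> \<psi>)(z\<^sup>\<star> z)\<close>, the squared norm of the vector of \<open>z\<close> in the tensor product of
  the GNS spaces of \<open>\<phi>\<close> and \<open>\<psi>\<close>.\<close>

definition ft_sqnorm ::
    "('a::cstar_algebra \<Rightarrow> complex) \<Rightarrow> ('b::cstar_algebra \<Rightarrow> complex) \<Rightarrow>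
     ('a, 'b) formal_tensor \<Rightarrow> real"
  where "ft_sqnorm \<phi> \<psi> zs =
    Re (\<Sum>(a, b)\<leftarrow>zs. \<Sum>(c, d)\<leftarrow>zs. \<phi> (a\<^sup>\<star> * c) * \<psi> (b\<^sup>\<star> * d))"

text \<open>\<open>K\<close> bounds the operator norm of \<open>(\<pi>\<^sub>\<phi> \<otimes> \<pi>\<^sub>\<psi>)(z)\<close> for all states \<open>\<phi>\<close>, \<open>\<psi>\<close>,
  where \<open>\<pi>\<^sub>\<phi>\<close>, \<open>\<pi>\<^sub>\<psi>\<close> are the GNS representations. The least such \<open>K\<close> is the spatial
  (minimal) C*-norm of \<open>z\<close>.\<close>

definition spatial_bound ::
    "('a::cstar_algebra, 'b::cstar_algebra) formal_tensor \<Rightarrow> real \<Rightarrow> bool"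
  where "spatial_bound zs K \<longleftrightarrow> 0 \<le> K \<and>
    (\<forall>\<phi> \<psi> ws. state \<phi> \<longrightarrow> state \<psi> \<longrightarrow>
      ft_sqnorm \<phi> \<psi> (ft_mult zs ws) \<le> K\<^sup>2 * ft_sqnorm \<phi> \<psi> ws)"

text \<open>The C*-algebra \<open>'t\<close>, with the elementary tensors \<open>tn a b\<close>, is a minimal tensor
  product of \<open>'a\<close> and \<open>'b\<close>. These conditions determine it up to unique isomorphism; in
  particular the algebraic tensor product embeds injectively, since its spatial norm is a norm.\<close>

definition min_tensor ::
    "('a::cstar_algebra \<Rightarrow> 'b::cstar_algebra \<Rightarrow> 't::cstar_algebra) \<Rightarrow> bool"
  where "min_tensor tn \<longleftrightarrow>
    (\<forall>a. clinear_on UNIV (tn a)) \<and> (\<forall>b. clinear_on UNIV (\<lambda>a. tn a b)) \<and>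
    tn 1 1 = 1 \<and>
    (\<forall>a b c d. tn a b * tn c d = tn (a * c) (b * d)) \<and>
    (\<forall>a b. (tn a b)\<^sup>\<star> = tn (a\<^sup>\<star>) (b\<^sup>\<star>)) \<and>
    closure (cspan {tn a b |a b. True}) = UNIV \<and>
    (\<forall>zs K. norm (\<Sum>(a, b)\<leftarrow>zs. tn a b) \<le> K \<longleftrightarrow> spatial_bound zs K)"

text \<open>\<open>F\<close> is the continuous linear extension of \<open>f \<otimes> g\<close> (unique by density).\<close>

definition tensor_map ::
    "('a::cstar_algebra \<Rightarrow> 'b::cstar_algebra \<Rightarrow> 't::cstar_algebra) \<Rightarrow>
     ('c::cstar_algebra \<Rightarrow> 'd::cstar_algebra \<Rightarrow> 's::cstar_algebra) \<Rightarrow>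
     ('a \<Rightarrow> 'c) \<Rightarrow> ('b \<Rightarrow> 'd) \<Rightarrow> ('t \<Rightarrow> 's) \<Rightarrow> bool"
  where "tensor_map tn tn' f g F \<longleftrightarrow>
    bounded_clinear F \<and> (\<forall>a b. F (tn a b) = tn' (f a) (g b))"

text \<open>For \<open>t = x\<^sub>1 \<otimes> y\<^sub>1 + \<dots> + x\<^sub>n \<otimes> y\<^sub>n\<close> with \<open>x\<^sub>i, y\<^sub>i \<in> S\<close> (\<open>S\<close> a subspace) this is
  \<open>B x\<^sub>1 y\<^sub>1 + \<dots> + B x\<^sub>n y\<^sub>n\<close>, the linearisation of \<open>B\<close> on the algebraic tensor product
  \<open>S \<odot> S\<close>. It is independent of the decomposition if \<open>B\<close> is bilinear or
  conjugate-bilinear on \<open>S\<close>.\<close>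

definition alg_lift ::
    "'a::cstar_algebra set \<Rightarrow> ('a \<Rightarrow> 'a \<Rightarrow> 't::cstar_algebra) \<Rightarrow>
     ('a \<Rightarrow> 'a \<Rightarrow> 'v::cstar_algebra) \<Rightarrow> 't \<Rightarrow> 'v"
  where "alg_lift S tn B t = (THE z. \<exists>zs. set zs \<subseteq> S \<times> S \<and>
    t = (\<Sum>(x, y)\<leftarrow>zs. tn x y) \<and> z = (\<Sum>(x, y)\<leftarrow>zs. B x y))"


section \<open>Compact quantum groups\<close>

text \<open>\<open>tn a b\<close> is \<open>a \<otimes> b \<in> A \<otimes> A\<close>; the triple tensor product \<open>'s\<close> is realised both as
  \<open>(A \<otimes> A) \<otimes> A\<close> (via \<open>tnL\<close>) and as \<open>A \<otimes> (A \<otimes> A)\<close> (via \<open>tnR\<close>), identified by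
  associativity. The last two conditions are the quantum cancellation properties.\<close>

definition compact_quantum_group ::
    "('a::cstar_algebra \<Rightarrow> 'a \<Rightarrow> 't::cstar_algebra) \<Rightarrow> ('t \<Rightarrow> 'a \<Rightarrow> 's::cstar_algebra) \<Rightarrow>
     ('a \<Rightarrow> 't \<Rightarrow> 's) \<Rightarrow> ('a \<Rightarrow> 't) \<Rightarrow> bool"
  where "compact_quantum_group tn tnL tnR \<Delta> \<longleftrightarrow>
    min_tensor tn \<and> min_tensor tnL \<and> min_tensor tnR \<and>
    (\<forall>a b c. tnL (tn a b) c = tnR a (tn b c)) \<and>
    star_hom_on UNIV \<Delta> \<and>
    (\<exists>F G. tensor_map tn tnL \<Delta> id F \<and> tensor_map tn tnR id \<Delta> G \<and> F \<circ> \<Delta> = G \<circ> \<Delta>) \<and>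
    closure (cspan {tn a 1 * \<Delta> b |a b. True}) = UNIV \<and>
    closure (cspan {tn 1 a * \<Delta> b |a b. True}) = UNIV"

definition haar_state ::
    "('a::cstar_algebra \<Rightarrow> 'a \<Rightarrow> 't::cstar_algebra) \<Rightarrow> ('a \<Rightarrow> 't) \<Rightarrow> ('a \<Rightarrow> complex) \<Rightarrow> bool"
  where "haar_state tn \<Delta> h \<longleftrightarrow> state h \<and>
    (\<exists>F G. bounded_clinear F \<and> (\<forall>a b. F (tn a b) = h a *\<^sub>C b) \<and>
           bounded_clinear G \<and> (\<forall>a b. G (tn a b) = h b *\<^sub>C a) \<and>
           (\<forall>a. F (\<Delta> a) = h a *\<^sub>C 1 \<and> G (\<Delta> a) = h a *\<^sub>C 1))"

definition unitary_corep ::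
    "('a::cstar_algebra \<Rightarrow> 'a \<Rightarrow> 't::cstar_algebra) \<Rightarrow> ('a \<Rightarrow> 't) \<Rightarrow> nat \<Rightarrow>
     (nat \<Rightarrow> nat \<Rightarrow> 'a) \<Rightarrow> bool"
  where "unitary_corep tn \<Delta> n u \<longleftrightarrow>
    (\<forall>i<n. \<forall>j<n. \<Delta> (u i j) = (\<Sum>k<n. tn (u i k) (u k j)) \<and>
      (\<Sum>k<n. (u k i)\<^sup>\<star> * u k j) = (if i = j then 1 else 0) \<and>
      (\<Sum>k<n. u i k * (u j k)\<^sup>\<star>) = (if i = j then 1 else 0))"

definition hopf_alg ::
    "('a::cstar_algebra \<Rightarrow> 'a \<Rightarrow> 't::cstar_algebra) \<Rightarrow> ('a \<Rightarrow> 't) \<Rightarrow> 'a set"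
  where "hopf_alg tn \<Delta> = cspan {u i j |n u i j. unitary_corep tn \<Delta> n u \<and> i < n \<and> j < n}"


section \<open>Completions of the Hopf *-algebra\<close>

text \<open>\<open>\<iota>\<close> realises \<open>'r\<close> as the closure of \<open>S\<close> in its GNS representation for \<open>h\<close>: the norm
  of \<open>\<iota> a\<close> is the operator norm of left multiplication by \<open>a\<close> on \<open>S\<close> with respect to
  \<open>h(b\<^sup>\<star> b)\<close>.\<close>

definition reduced_completion ::
    "'a::cstar_algebra set \<Rightarrow> ('a \<Rightarrow> complex) \<Rightarrow> ('a \<Rightarrow> 'r::cstar_algebra) \<Rightarrow> bool"
  where "reduced_completion S h \<iota> \<longleftrightarrow> star_hom_on S \<iota> \<and> closure (\<iota> ` S) = UNIV \<and>
    (\<forall>a\<in>S. \<forall>K. norm (\<iota> a) \<le> K \<longleftrightarrow>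
      0 \<le> K \<and> (\<forall>b\<in>S. Re (h ((a * b)\<^sup>\<star> * (a * b))) \<le> K\<^sup>2 * Re (h (b\<^sup>\<star> * b))))"

definition cstar_seminorm_on :: "'a::cstar_algebra set \<Rightarrow> ('a \<Rightarrow> real) \<Rightarrow> bool"
  where "cstar_seminorm_on S p \<longleftrightarrow>
    (\<forall>x\<in>S. 0 \<le> p x \<and> p (x\<^sup>\<star> * x) = (p x)\<^sup>2 \<and> (\<forall>c. p (c *\<^sub>C x) = cmod c * p x)) \<and>
    (\<forall>x\<in>S. \<forall>y\<in>S. p (x + y) \<le> p x + p y \<and> p (x * y) \<le> p x * p y)"

text \<open>\<open>\<iota>\<close> realises \<open>'u\<close> as the completion of \<open>S\<close> in the largest C*-seminorm; \<open>norm \<circ> \<iota>\<close>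
  is itself a C*-seminorm on \<open>S\<close>.\<close>

definition universal_completion ::
    "'a::cstar_algebra set \<Rightarrow> ('a \<Rightarrow> 'u::cstar_algebra) \<Rightarrow> bool"
  where "universal_completion S \<iota> \<longleftrightarrow> star_hom_on S \<iota> \<and> closure (\<iota> ` S) = UNIV \<and>
    (\<forall>p. cstar_seminorm_on S p \<longrightarrow> (\<forall>a\<in>S. p a \<le> norm (\<iota> a)))"

definition extends_coproduct ::
    "('a::cstar_algebra \<Rightarrow> 'a \<Rightarrow> 't::cstar_algebra) \<Rightarrow> ('a \<Rightarrow> 't) \<Rightarrow> ('a \<Rightarrow> 'b::cstar_algebra) \<Rightarrow>
     ('b \<Rightarrow> 'b \<Rightarrow> 'c::cstar_algebra) \<Rightarrow> ('b \<Rightarrow> 'c) \<Rightarrow> bool"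
  where "extends_coproduct tn \<Delta> \<iota> tn' \<Delta>' \<longleftrightarrow> star_hom_on UNIV \<Delta>' \<and>
    (\<forall>a\<in>hopf_alg tn \<Delta>. \<Delta>' (\<iota> a) = alg_lift (hopf_alg tn \<Delta>) tn (\<lambda>x y. tn' (\<iota> x) (\<iota> y)) (\<Delta> a))"


section \<open>Operators, forms and semigroups\<close>

definition gns_symmetric ::
    "'a::cstar_algebra set \<Rightarrow> ('a \<Rightarrow> complex) \<Rightarrow> ('a \<Rightarrow> 'a) \<Rightarrow> bool"
  where "gns_symmetric S h L \<longleftrightarrow> L ` S \<subseteq> S \<and> clinear_on S L \<and>
    (\<forall>a\<in>S. \<forall>b\<in>S. h (a\<^sup>\<star> * L b) = h ((L a)\<^sup>\<star> * b))"

text \<open>\<open>L\<^sub>\<phi> = (id \<otimes> \<phi>) \<circ> \<Delta>\<close>.\<close>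

definition conv_op ::
    "('a::cstar_algebra \<Rightarrow> 'a \<Rightarrow> 't::cstar_algebra) \<Rightarrow> ('a \<Rightarrow> 't) \<Rightarrow> ('a \<Rightarrow> complex) \<Rightarrow> 'a \<Rightarrow> 'a"
  where "conv_op tn \<Delta> \<phi> a = alg_lift (hopf_alg tn \<Delta>) tn (\<lambda>x y. \<phi> y *\<^sub>C x) (\<Delta> a)"

text \<open>\<open>\<Delta> \<circ> L = (id \<otimes> L) \<circ> \<Delta>\<close> on the Hopf *-algebra.\<close>

definition translation_invariant ::
    "('a::cstar_algebra \<Rightarrow> 'a \<Rightarrow> 't::cstar_algebra) \<Rightarrow> ('a \<Rightarrow> 't) \<Rightarrow> ('a \<Rightarrow> 'a) \<Rightarrow> bool"
  where "translation_invariant tn \<Delta> L \<longleftrightarrow>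
    (\<forall>a\<in>hopf_alg tn \<Delta>. \<Delta> (L a) = alg_lift (hopf_alg tn \<Delta>) tn (\<lambda>x y. tn x (L y)) (\<Delta> a))"

text \<open>\<open>\<Delta> \<circ> T = (id \<otimes> T) \<circ> \<Delta>\<close> on a C*-algebra, \<open>id \<otimes> T\<close> being the continuous extension
  to the minimal tensor product.\<close>

definition translation_invariant_cstar ::
    "('b::cstar_algebra \<Rightarrow> 'b \<Rightarrow> 'c::cstar_algebra) \<Rightarrow> ('b \<Rightarrow> 'c) \<Rightarrow> ('b \<Rightarrow> 'b) \<Rightarrow> bool"
  where "translation_invariant_cstar tn \<Delta> T \<longleftrightarrow>
    (\<exists>F. tensor_map tn tn id T F \<and> \<Delta> \<circ> T = F \<circ> \<Delta>)"

definition form_of :: "('a::cstar_algebra \<Rightarrow> complex) \<Rightarrow> ('a \<Rightarrow> 'a) \<Rightarrow> 'a \<Rightarrow> 'a \<Rightarrow> complex"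
  where "form_of h L a b = - h (a\<^sup>\<star> * L b)"

text \<open>\<open>(m\<^sub>* \<otimes> Q)(s, t)\<close> for \<open>s, t\<close> in the algebraic tensor product \<open>S \<odot> S\<close>: the sum of
  \<open>x\<^sup>\<star> x' Q(y, y')\<close> over the terms \<open>x \<otimes> y\<close> of \<open>s\<close> and \<open>x' \<otimes> y'\<close> of \<open>t\<close>.\<close>

definition mstar_tensor ::
    "'a::cstar_algebra set \<Rightarrow> ('a \<Rightarrow> 'a \<Rightarrow> 't::cstar_algebra) \<Rightarrow> ('a \<Rightarrow> 'a \<Rightarrow> complex) \<Rightarrow>
     't \<Rightarrow> 't \<Rightarrow> 'a"
  where "mstar_tensor S tn Q s t =
    alg_lift S tn (\<lambda>x y. alg_lift S tn (\<lambda>x' y'. Q y y' *\<^sub>C (x\<^sup>\<star> * x')) t) s"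

definition semigroup_on :: "'a::cstar_algebra set \<Rightarrow> (real \<Rightarrow> 'a \<Rightarrow> 'a) \<Rightarrow> bool"
  where "semigroup_on S T \<longleftrightarrow>
    (\<forall>t\<ge>0. T t ` S \<subseteq> S \<and> clinear_on S (T t)) \<and> (\<forall>x\<in>S. T 0 x = x) \<and>
    (\<forall>s\<ge>0. \<forall>t\<ge>0. \<forall>x\<in>S. T (s + t) x = T s (T t x))"

text \<open>\<open>T\<^sub>t \<circ> \<iota> = \<iota> \<circ> exp(tL)\<close> on \<open>S\<close>, the exponential series being summed in the norm of
  the target algebra.\<close>

definition exp_formula ::
    "'a::cstar_algebra set \<Rightarrow> ('a \<Rightarrow> 'b::cstar_algebra) \<Rightarrow> ('a \<Rightarrow> 'a) \<Rightarrow> (real \<Rightarrow> 'b \<Rightarrow> 'b) \<Rightarrow> bool"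
  where "exp_formula S \<iota> L T \<longleftrightarrow>
    (\<forall>t\<ge>0. \<forall>a\<in>S. (\<lambda>n. (t ^ n / fact n) *\<^sub>R \<iota> ((L ^^ n) a)) sums T t (\<iota> a))"

text \<open>A semigroup of bounded operators \<open>T\<^sub>t\<close> on a C*-completion extending \<open>exp(tL)\<close>, such that
  \<open>id \<otimes> T\<^sub>t\<close> makes sense as a bounded operator on the minimal tensor square. The latter is
  automatic for completely bounded, in particular for completely positive, \<open>T\<^sub>t\<close>.\<close>

definition cstar_semigroup_of ::
    "'a::cstar_algebra set \<Rightarrow> ('a \<Rightarrow> 'b::cstar_algebra) \<Rightarrow>
     ('b \<Rightarrow> 'b \<Rightarrow> 'c::cstar_algebra) \<Rightarrow> ('a \<Rightarrow> 'a) \<Rightarrow> (real \<Rightarrow> 'b \<Rightarrow> 'b) \<Rightarrow> bool"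
  where "cstar_semigroup_of S \<iota> tn L T \<longleftrightarrow>
    semigroup_on UNIV T \<and> exp_formula S \<iota> L T \<and>
    (\<forall>t\<ge>0. bounded_clinear (T t) \<and> (\<exists>F. tensor_map tn tn id (T t) F))"

end

theory Submission
  imports Defs
begin

text \<open>A translation invariant \<open>L\<close> is recovered from \<open>\<phi> = \<epsilon> \<circ> L\<close> by applying \<open>id \<otimes> \<epsilon>\<close> to
  \<open>\<Delta> (L a) = (id \<otimes> L)(\<Delta> a)\<close>. It then acts on the coefficients \<open>u\<^sub>i\<^sub>j\<close> of a corepresentation by the
  matrix \<open>\<phi>(u\<^sub>k\<^sub>j)\<close>, and so do its powers and its exponential; conversely the coefficient of \<open>t\<close> in
  \<open>\<Delta> (T\<^sub>t a) = (id \<otimes> T\<^sub>t)(\<Delta> a)\<close> is translation invariance of \<open>L\<close>. On a completion this is an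
  identity in the completed tensor square, and it descends to the algebraic one because the Haar state
  extends to a state of the completion that is faithful on the Hopf algebra. For the form, invariance of
  \<open>h\<close> turns the identity for \<open>Q\<close> into \<open>(id \<otimes> h)((\<Delta> a)\<^sup>* w) = 0\<close> with
  \<open>w = \<Delta> (L b) - (id \<otimes> L)(\<Delta> b)\<close>; inserting adjoints of coefficients for \<open>a\<close>, unitarity gives
  \<open>(id \<otimes> h)((1 \<otimes> s) w) = 0\<close> for all \<open>s\<close>, hence \<open>w = 0\<close>.\<close>

section \<open>Homomorphisms of C*-algebras\<close>

text \<open>The first obstacle is that everything on the algebraic tensor square is expressed
  through \<open>alg_lift\<close>, a description over all decompositions of an element of the
  completed square. Evaluating it requires that the decomposition be irrelevant, while the norm is
  known only through spatial bounds. A faithful state settles this: after Gram-Schmidt on the left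
  legs, the squared GNS norm becomes a sum of nonnegative terms.

  The second obstacle is that the coefficients of corepresentations span the Hopf algebra but are
  not known to be linearly independent. So no map is defined by prescribing it on coefficients:
  counit, convolution operators and exponentials are defined intrinsically and then merely evaluated
  there. Closure under the involution has to be earned as well, by unitarizing conjugate
  corepresentations; positivity of extended states and the form both rely on it.

  Exponential series are pushed through coproducts and tensor legs by continuity, hence the opening:
  *-homomorphisms are contractive.\<close>

lemma star_zero [simp]: "(0::'a::cstar_algebra)\<^sup>\<star> = 0"
  using star_add[of "0::'a" 0] by simp

lemma star_minus: "(- x)\<^sup>\<star> = - ((x::'a::cstar_algebra)\<^sup>\<star>)"
  using star_add[of x "- x"] by (simp add: eq_neg_iff_add_eq_0 add.commute)

lemma star_diff: "(x - y)\<^sup>\<star> = (x::'a::cstar_algebra)\<^sup>\<star> - y\<^sup>\<star>"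
  using star_add[of x "- y"] by (simp add: star_minus)

lemma star_one [simp]: "(1::'a::cstar_algebra)\<^sup>\<star> = 1"
  by (metis mult.right_neutral star_mult star_star mult.left_neutral)

lemma star_scaleR: "(r *\<^sub>R x)\<^sup>\<star> = r *\<^sub>R ((x::'a::cstar_algebra)\<^sup>\<star>)"
  using star_scaleC[of "of_real r" x] by (simp add: scaleC_of_real)

lemma star_power: "(x ^ n)\<^sup>\<star> = ((x::'a::cstar_algebra)\<^sup>\<star>) ^ n"
  by (induction n) (simp_all add: star_mult power_commutes)

lemma star_sum: "(sum f A)\<^sup>\<star> = (\<Sum>x\<in>A. ((f x)::'a::cstar_algebra)\<^sup>\<star>)"
  by (induction A rule: infinite_finite_induct) (simp_all add: star_add)

lemma norm_le_norm_star: "norm x \<le> norm ((x::'a::cstar_algebra)\<^sup>\<star>)"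
proof (cases "norm x = 0")
  case False
  have "norm x * norm x \<le> norm (x\<^sup>\<star>) * norm x"
    using norm_mult_ineq[of "x\<^sup>\<star>" x] by (simp add: cstar_identity power2_eq_square)
  with False show ?thesis by (simp add: mult_le_cancel_right)
qed simp

lemma norm_star: "norm ((x::'a::cstar_algebra)\<^sup>\<star>) = norm x"
  using norm_le_norm_star[of x] norm_le_norm_star[of "x\<^sup>\<star>"] by (simp add: star_star)

lemma norm_scaleC: "norm (c *\<^sub>C (x::'a::cstar_algebra)) = cmod c * norm x"
proof -
  have "(c *\<^sub>C x)\<^sup>\<star> * (c *\<^sub>C x) = (c * cnj c) *\<^sub>C (x\<^sup>\<star> * x)"
    by (simp add: star_scaleC mult_scaleC_left mult_scaleC_right scaleC_scaleC mult.commute)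
  also have "\<dots> = (cmod c)\<^sup>2 *\<^sub>R (x\<^sup>\<star> * x)"
    by (metis complex_norm_square of_real_power scaleC_of_real)
  finally have "(norm (c *\<^sub>C x))\<^sup>2 = (cmod c * norm x)\<^sup>2"
    by (metis abs_of_nonneg cstar_identity norm_scaleR power_mult_distrib zero_le_power2)
  then show ?thesis by simp
qed

lemma bounded_linear_star: "bounded_linear (star :: 'a::cstar_algebra \<Rightarrow> 'a)"
  by (rule bounded_linear_intro[where K = 1]) (simp_all add: star_add star_scaleR norm_star)

lemma bounded_linear_scaleC: "bounded_linear (scaleC c :: 'a::cstar_algebra \<Rightarrow> 'a)"
proof (rule bounded_linear_intro[where K = "cmod c"])
  show "c *\<^sub>C (r *\<^sub>R x) = r *\<^sub>R (c *\<^sub>C x)" for r and x :: 'a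
    by (metis mult.commute scaleC_of_real scaleC_scaleC)
qed (simp_all add: scaleC_add_right norm_scaleC mult.commute)

text \<open>The square root is the binomial series of exponent 1/2 at \<open>z = - (x * x)\<close>,
  absolutely convergent because \<open>norm z < 1\<close>. By Vandermonde its Cauchy square has
  coefficients \<open>1 gchoose k\<close>, so it stops at \<open>1 + z\<close>. Real coefficients
  and powers of a hermitian \<open>z\<close> commuting with \<open>x\<close> give the other two
  properties.\<close>

lemma hermitian_sqrt_one_minus_square:
  fixes x :: "'a::cstar_algebra"
  assumes "x\<^sup>\<star> = x" "norm x < 1"
  obtains y where "y\<^sup>\<star> = y" "x * y = y * x" "x * x + y * y = 1"
proof -
  define z where "z = - (x * x)"
  define a :: "nat \<Rightarrow> real" where "a n = (1/2) gchoose n" for n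
  have "norm z = (norm x)\<^sup>2"
    using cstar_identity[of x] assms(1) by (simp add: z_def)
  then have nz: "norm z < 1"
    using assms(2) by (simp add: power_less_one_iff)
  then obtain r where r: "norm z < r" "r < 1"
    using dense by blast
  have "summable (\<lambda>n. a n * r ^ n)"
    unfolding a_def
    by (rule sums_summable[OF gen_binomial_real]) (use r norm_ge_zero[of z] in linarith)
  then have "summable (\<lambda>n. norm (a n * norm z ^ n))"
    by (rule powser_insidea) (use r in auto)
  then have sn: "summable (\<lambda>n. norm (a n *\<^sub>R z ^ n))"
    by (rule summable_comparison_test'[where N = 0])
       (simp add: abs_mult mult_left_mono norm_power_ineq)
  then have s: "summable (\<lambda>n. a n *\<^sub>R z ^ n)"
    by (rule summable_norm_cancel)
  define y where "y = (\<Sum>n. a n *\<^sub>R z ^ n)"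
  have zs: "z\<^sup>\<star> = z"
    using assms(1) by (simp add: z_def star_minus star_mult)
  have "y\<^sup>\<star> = (\<Sum>n. (a n *\<^sub>R z ^ n)\<^sup>\<star>)"
    unfolding y_def by (rule bounded_linear.suminf[OF bounded_linear_star s])
  then have 1: "y\<^sup>\<star> = y"
    by (simp add: y_def star_scaleR star_power zs)
  have zx: "x * z ^ n = z ^ n * x" for n
    by (rule power_commuting_commutes[symmetric]) (simp add: z_def mult.assoc)
  have "x * y = (\<Sum>n. x * (a n *\<^sub>R z ^ n))"
    unfolding y_def by (rule suminf_mult[OF s, symmetric])
  also have "\<dots> = (\<Sum>n. (a n *\<^sub>R z ^ n) * x)"
    by (simp add: zx)
  also have "\<dots> = y * x"
    unfolding y_def by (rule suminf_mult2[OF s, symmetric])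
  finally have 2: "x * y = y * x" .
  have "y * y = (\<Sum>k. \<Sum>i\<le>k. (a i *\<^sub>R z ^ i) * (a (k - i) *\<^sub>R z ^ (k - i)))"
    unfolding y_def by (rule Cauchy_product[OF sn sn])
  also have "(\<lambda>k. \<Sum>i\<le>k. (a i *\<^sub>R z ^ i) * (a (k - i) *\<^sub>R z ^ (k - i))) = (\<lambda>k. (1 gchoose k) *\<^sub>R z ^ k)"
  proof
    fix k
    have "(\<Sum>i\<le>k. (a i *\<^sub>R z ^ i) * (a (k - i) *\<^sub>R z ^ (k - i))) = (\<Sum>i\<le>k. (a i * a (k - i)) *\<^sub>R z ^ k)"
      by (rule sum.cong) (simp_all flip: power_add)
    also have "\<dots> = (1 gchoose k) *\<^sub>R z ^ k"
      using gbinomial_Vandermonde[of "1/2::real" "1/2" k]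
      by (simp add: a_def flip: scaleR_left.sum atMost_atLeast0)
    finally show "(\<Sum>i\<le>k. (a i *\<^sub>R z ^ i) * (a (k - i) *\<^sub>R z ^ (k - i))) = (1 gchoose k) *\<^sub>R z ^ k" .
  qed
  also have "(\<Sum>k. (1 gchoose k) *\<^sub>R z ^ k) = (\<Sum>k\<in>{0, 1}. (1 gchoose k) *\<^sub>R z ^ k)"
  proof (rule suminf_finite)
    fix k :: nat assume "k \<notin> {0, 1}"
    then have "(1::nat) choose k = 0" by simp
    then show "((1::real) gchoose k) *\<^sub>R z ^ k = 0"
      using binomial_gbinomial[of 1 k, where 'a = real] by (metis of_nat_0 of_nat_1 scaleR_zero_left)
  qed simp
  also have "\<dots> = 1 + z" by simp
  finally have 3: "x * x + y * y = 1" by (simp add: z_def)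
  show thesis by (rule that[OF 1 2 3])
qed

lemma clinear_on_diff:
  assumes "clinear_on UNIV f" shows "f (x - y) = f x - f y"
proof -
  have "f (x - y) + f y = f x"
    using assms unfolding clinear_on_def by (metis UNIV_I diff_add_cancel)
  then show ?thesis by (simp add: algebra_simps)
qed

text \<open>A hermitian \<open>x\<close> of norm less than one is the mean of the unitaries \<open>x \<plusminus> \<i> \<surd>(1 - x\<^sup>2)\<close>.\<close>

lemma star_hom_norm_le:
  fixes f :: "'a::cstar_algebra \<Rightarrow> 'b::cstar_algebra"
  assumes f: "star_hom_on UNIV f"
  shows "norm (f x) \<le> norm x"
proof -
  have add: "f (x + y) = f x + f y" and sc: "f (c *\<^sub>C x) = c *\<^sub>C f x" and mul: "f (x * y) = f x * f y"
    and st: "f (x\<^sup>\<star>) = (f x)\<^sup>\<star>" and one: "f 1 = 1" for x y c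
    using f by (auto simp: star_hom_on_def clinear_on_def)
  have scR: "f (r *\<^sub>R x) = r *\<^sub>R f x" for r x
    using sc[of "of_real r" x] by (simp add: scaleC_of_real)
  have unit: "norm (f x) \<le> 1" if herm: "x\<^sup>\<star> = x" and nx: "norm x < 1" for x
  proof -
    obtain y where y: "y\<^sup>\<star> = y" "x * y = y * x" "x * x + y * y = 1"
      using hermitian_sqrt_one_minus_square[OF herm nx] by blast
    define w where "w = x + \<i> *\<^sub>C y"
    have ws: "w\<^sup>\<star> = x - \<i> *\<^sub>C y"
      using herm y(1) by (simp add: w_def star_add star_scaleC)
    have "w\<^sup>\<star> * w = x * x + y * y"
      by (subst ws) (simp add: w_def algebra_simps mult_scaleC_left mult_scaleC_right scaleC_scaleC y(2))
    then have "(f w)\<^sup>\<star> * f w = 1"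
      using y(3) by (metis mul one st)
    then have nw: "norm (f w) = 1"
      using cstar_identity[of "f w"] by (simp add: power2_eq_1_iff) (metis norm_ge_zero not_one_le_zero neg_0_le_iff_le)
    have "2 *\<^sub>R x = w + w\<^sup>\<star>"
      by (subst ws) (simp add: w_def scaleR_2)
    then have "2 *\<^sub>R f x = f w + (f w)\<^sup>\<star>"
      by (metis add scR st)
    then have "2 * norm (f x) \<le> norm (f w) + norm ((f w)\<^sup>\<star>)"
      by (metis norm_scaleR norm_triangle_ineq abs_numeral)
    then show ?thesis by (simp add: norm_star nw)
  qed
  have herm: "norm (f x) \<le> norm x" if "x\<^sup>\<star> = x" for x
  proof (rule dense_ge)
    fix r assume r: "norm x < r"
    then have r0: "0 < r" using norm_ge_zero[of x] by linarith
    \<comment> \<open>The unitary argument needs norm strictly below 1, so \<open>x\<close> is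
      scaled by an arbitrary \<open>r\<close> above its norm.\<close>
    have "norm (f (inverse r *\<^sub>R x)) \<le> 1"
      by (rule unit) (use that r r0 in \<open>simp_all add: star_scaleR field_simps\<close>)
    then show "norm (f x) \<le> r" using r0 by (simp add: scR field_simps)
  qed
  \<comment> \<open>The C*-identity reduces a general element to the hermitian
    \<open>x\<^sup>\<star> * x\<close>.\<close>
  have "(norm (f x))\<^sup>2 = norm (f (x\<^sup>\<star> * x))"
    by (simp add: mul st cstar_identity)
  also have "\<dots> \<le> norm (x\<^sup>\<star> * x)"
    by (rule herm) (simp add: star_mult star_star)
  finally show ?thesis by (simp add: cstar_identity power2_le_iff_abs_le)
qed

lemma bounded_clinear_bounded_linear: "bounded_clinear f \<Longrightarrow> bounded_linear f"
  unfolding bounded_clinear_def clinear_on_def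
  by (metis UNIV_I bounded_linear_intro mult.commute scaleC_of_real)

lemma star_hom_bounded_clinear:
  assumes "star_hom_on UNIV f" shows "bounded_clinear f"
  using assms star_hom_norm_le[OF assms] unfolding bounded_clinear_def star_hom_on_def
  by (metis mult_1)

section \<open>Boundedness and density in minimal tensor products\<close>

lemma min_tensor_right_hom:
  assumes "min_tensor tn" shows "star_hom_on UNIV (tn 1)"
  using assms unfolding min_tensor_def star_hom_on_def by (metis mult_1 star_one)

text \<open>\<open>tn x y\<close> factors as \<open>tn x 1 * tn 1 y\<close>, and \<open>tn 1\<close>
  is a unital *-homomorphism, hence contractive.\<close>

lemma min_tensor_bounded_right:
  assumes "min_tensor tn" shows "bounded_linear (tn x)"
proof -
  have "bounded_linear (\<lambda>y. tn x 1 * tn 1 y)"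
    by (intro bounded_linear_const_mult bounded_clinear_bounded_linear star_hom_bounded_clinear
        min_tensor_right_hom assms)
  moreover have "tn x 1 * tn 1 y = tn x y" for y
    using assms by (simp add: min_tensor_def)
  ultimately show ?thesis by simp
qed

lemma min_tensor_ext:
  assumes tn: "min_tensor tn" and f: "bounded_clinear f" and g: "bounded_clinear g"
    and eq: "\<And>a b. f (tn a b) = g (tn a b)"
  shows "f x = g x"
proof -
  let ?E = "{tn a b |a b. True}"
  have fl: "clinear_on UNIV f" "clinear_on UNIV g"
    using f g by (auto simp: bounded_clinear_def)
  have span: "f x = g x" if "x \<in> cspan ?E" for x
    using that
  proof (induction rule: cplx.span_induct_alt)
    case base
    then show ?case using clinear_on_diff[OF fl(1), of 0 0] clinear_on_diff[OF fl(2), of 0 0] by simp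
  next
    case (step c x y)
    then show ?case using fl eq by (auto simp: clinear_on_def)
  qed
  have "continuous_on UNIV f" "continuous_on UNIV g"
    using f g bounded_clinear_bounded_linear linear_continuous_on by blast+
  then have "closed {x. f x = g x}"
    by (rule closed_Collect_eq)
  then have "closure (cspan ?E) \<subseteq> {x. f x = g x}"
    using span by (intro closure_minimal) auto
  then show ?thesis using tn by (auto simp: min_tensor_def)
qed

lemma Re_sum_list: "Re (\<Sum>x\<leftarrow>xs. f x) = (\<Sum>x\<leftarrow>xs. Re (f x))"
  by (induction xs) simp_all

section \<open>Faithful states and tensor products\<close>

locale faithful_state =
  fixes h :: "'a::cstar_algebra \<Rightarrow> complex"
  assumes state: "state h" and faithful: "faithful h"
begin

lemma h_add: "h (x + y) = h x + h y"
  and h_scaleC: "h (c *\<^sub>C x) = c * h x"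
  and h_one [simp]: "h 1 = 1"
  and h_pos: "h (x\<^sup>\<star> * x) \<in> \<real>\<^sub>\<ge>\<^sub>0"
  and h_bound: "cmod (h x) \<le> norm x"
  using state by (auto simp: state_def functional_on_def)

lemma h_zero [simp]: "h 0 = 0"
  using h_add[of 0 0] by simp

lemma h_diff: "h (x - y) = h x - h y"
  using h_add[of "x - y" y] by simp

lemma h_sum: "h (sum f A) = (\<Sum>x\<in>A. h (f x))"
  by (induction A rule: infinite_finite_induct) (simp_all add: h_add)

lemma h_sum_list: "h (sum_list xs) = (\<Sum>x\<leftarrow>xs. h x)"
  by (induction xs) (simp_all add: h_add)

lemma h_faithful: "h (x\<^sup>\<star> * x) = 0 \<longleftrightarrow> x = 0"
  using faithful by (auto simp: faithful_def)

text \<open>Polarization: \<open>h\<close> is real on the squares of \<open>x + 1\<close> and of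
  \<open>x + \<i> *\<^sub>C 1\<close>; the first compares the imaginary parts of
  \<open>h (x\<^sup>\<star>)\<close> and \<open>h x\<close>, the second their real parts.\<close>

lemma h_star: "h (x\<^sup>\<star>) = cnj (h x)"
proof -
  have im: "Im (h (y\<^sup>\<star> * y)) = 0" for y
    using h_pos[of y] by (simp add: complex_nonneg_Reals_iff)
  have "(x + 1)\<^sup>\<star> * (x + 1) = x\<^sup>\<star> * x + x\<^sup>\<star> + x + 1"
    by (simp add: star_add algebra_simps)
  then have 1: "Im (h (x\<^sup>\<star>)) + Im (h x) = 0"
    using im[of "x + 1"] im[of x] by (simp add: h_add)
  have "(x + \<i> *\<^sub>C 1)\<^sup>\<star> * (x + \<i> *\<^sub>C 1) = x\<^sup>\<star> * x + \<i> *\<^sub>C x\<^sup>\<star> - \<i> *\<^sub>C x + 1"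
    by (simp add: star_add star_scaleC algebra_simps mult_scaleC_left mult_scaleC_right scaleC_scaleC scaleC_one)
  then have 2: "Re (h (x\<^sup>\<star>)) = Re (h x)"
    using im[of "x + \<i> *\<^sub>C 1"] im[of x] by (simp add: h_add h_diff h_scaleC)
  from 1 2 show ?thesis by (simp add: complex_eq_iff)
qed

text \<open>Positivity at \<open>x\<close> minus its mean: a variance is nonnegative.\<close>

lemma h_Cauchy_Schwarz_one: "(cmod (h x))\<^sup>2 \<le> Re (h (x\<^sup>\<star> * x))"
proof -
  let ?y = "x - h x *\<^sub>C 1"
  have "?y\<^sup>\<star> * ?y = x\<^sup>\<star> * x - h x *\<^sub>C x\<^sup>\<star> - cnj (h x) *\<^sub>C x + (h x * cnj (h x)) *\<^sub>C 1"
    by (simp add: star_diff star_scaleC algebra_simps mult_scaleC_left mult_scaleC_right scaleC_scaleC)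
  then have "h (?y\<^sup>\<star> * ?y) = h (x\<^sup>\<star> * x) - h x * cnj (h x)"
    by (simp add: h_add h_diff h_scaleC h_star)
  then have "h (?y\<^sup>\<star> * ?y) = h (x\<^sup>\<star> * x) - complex_of_real ((cmod (h x))\<^sup>2)"
    by (simp only: complex_norm_square)
  then show ?thesis
    using h_pos[of ?y] by (simp add: complex_nonneg_Reals_iff)
qed

end

text \<open>The maps \<open>B\<close> that factor through the tensor product over the complex numbers: besides
  bilinear maps these include the maps that are conjugate-linear in both arguments.\<close>

definition balanced :: "'a::cstar_algebra set \<Rightarrow> ('a \<Rightarrow> 'a \<Rightarrow> 'v::ab_group_add) \<Rightarrow> bool"
  where "balanced V B \<longleftrightarrow>
    (\<forall>x\<in>V. \<forall>x'\<in>V. \<forall>y\<in>V. B (x + x') y = B x y + B x' y) \<and>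
    (\<forall>x\<in>V. \<forall>y\<in>V. \<forall>y'\<in>V. B x (y + y') = B x y + B x y') \<and>
    (\<forall>c. \<forall>x\<in>V. \<forall>y\<in>V. B (c *\<^sub>C x) y = B x (c *\<^sub>C y))"

lemma balanced_flip: "balanced V B \<Longrightarrow> balanced V (\<lambda>x y. B y x)"
  unfolding balanced_def by metis

lemma balanced_zero:
  assumes "balanced V B" "0 \<in> V" "x \<in> V"
  shows "B 0 x = 0" "B x 0 = 0"
proof -
  have "B (0 + 0) x = B 0 x + B 0 x" "B x (0 + 0) = B x 0 + B x 0"
    using assms unfolding balanced_def by blast+
  then show "B 0 x = 0" "B x 0 = 0" by simp_all
qed

lemma balanced_sum_list_left:
  assumes B: "balanced V B" and V: "cplx.subspace V" and y: "y \<in> V" and zs: "set zs \<subseteq> V \<times> V"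
  shows "B (\<Sum>(e, z)\<leftarrow>zs. c e *\<^sub>C e) y = (\<Sum>(e, z)\<leftarrow>zs. B e (c e *\<^sub>C y)) \<and> (\<Sum>(e, z)\<leftarrow>zs. c e *\<^sub>C e) \<in> V"
  using zs
proof (induction zs)
  case Nil
  then show ?case using balanced_zero(1)[OF B _ y] V by (simp add: cplx.subspace_0)
next
  case (Cons p zs)
  obtain e z where p: "p = (e, z)" by force
  have e: "e \<in> V" and ce: "c e *\<^sub>C e \<in> V"
    using Cons.prems p V by (auto intro: cplx.subspace_scale)
  then show ?case
    using Cons B y V unfolding balanced_def p by (simp add: cplx.subspace_add)
qed

text \<open>Gram-Schmidt on the left legs for the form \<open>h (x\<^sup>\<star> * y)\<close>: what
  is subtracted from the new left leg is compensated in the right legs of the others, so the tensor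
  is unchanged. Nothing is normalized and zero legs may occur; division by zero then yields the
  coefficient 0.\<close>

primrec orthogonalize ::
    "('a::cstar_algebra \<Rightarrow> complex) \<Rightarrow> ('a \<times> 'a) list \<Rightarrow> ('a \<times> 'a) list"
  where
    "orthogonalize h [] = []"
  | "orthogonalize h (p # zs) =
      (fst p - (\<Sum>(e, z)\<leftarrow>orthogonalize h zs. (h (e\<^sup>\<star> * fst p) / h (e\<^sup>\<star> * e)) *\<^sub>C e), snd p) #
      map (\<lambda>(e, z). (e, z + (h (e\<^sup>\<star> * fst p) / h (e\<^sup>\<star> * e)) *\<^sub>C snd p)) (orthogonalize h zs)"

lemma orthogonalize_subset:
  assumes V: "cplx.subspace V" and zs: "set zs \<subseteq> V \<times> V"
  shows "set (orthogonalize h zs) \<subseteq> V \<times> V"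
  using zs
proof (induction zs)
  case (Cons p zs)
  obtain x y where p: "p = (x, y)" by force
  define ws where "ws = orthogonalize h zs"
  have sub: "set ws \<subseteq> V \<times> V" and xy: "x \<in> V" "y \<in> V"
    using Cons p by (auto simp: ws_def)
  have "balanced V (\<lambda>x y. 0::'a)" by (simp add: balanced_def)
  then have "(\<Sum>(e, z)\<leftarrow>ws. (h (e\<^sup>\<star> * x) / h (e\<^sup>\<star> * e)) *\<^sub>C e) \<in> V"
    using balanced_sum_list_left[OF _ V xy(2) sub, where c = "\<lambda>e. h (e\<^sup>\<star> * x) / h (e\<^sup>\<star> * e)"] by blast
  then show ?case
    using sub xy V unfolding orthogonalize.simps p ws_def[symmetric]
    by (auto intro!: cplx.subspace_diff cplx.subspace_add cplx.subspace_scale)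
qed simp

lemma orthogonalize_sum:
  assumes V: "cplx.subspace V" and B: "balanced V B" and zs: "set zs \<subseteq> V \<times> V"
  shows "(\<Sum>(x, y)\<leftarrow>orthogonalize h zs. B x y) = (\<Sum>(x, y)\<leftarrow>zs. B x y)"
  using zs
proof (induction zs)
  case (Cons p zs)
  obtain x y where p: "p = (x, y)" by force
  define ws where "ws = orthogonalize h zs"
  define c where "c e = h (e\<^sup>\<star> * x) / h (e\<^sup>\<star> * e)" for e
  have sub: "set ws \<subseteq> V \<times> V" and xy: "x \<in> V" "y \<in> V"
    using Cons.prems p orthogonalize_subset[OF V] by (auto simp: ws_def)
  define s where "s = (\<Sum>(e, z)\<leftarrow>ws. c e *\<^sub>C e)"
  have s: "B s y = (\<Sum>(e, z)\<leftarrow>ws. B e (c e *\<^sub>C y))" "s \<in> V"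
    using balanced_sum_list_left[OF B V xy(2) sub] by (auto simp: s_def)
  have d: "x - s \<in> V" using V xy s by (blast intro: cplx.subspace_diff)
  have "B ((x - s) + s) y = B (x - s) y + B s y"
    using B d s(2) xy unfolding balanced_def by blast
  then have 1: "B (x - s) y + B s y = B x y" by simp
  have "(\<Sum>(e, z)\<leftarrow>ws. B e (z + c e *\<^sub>C y)) = (\<Sum>(e, z)\<leftarrow>ws. B e z + B e (c e *\<^sub>C y))"
    by (rule arg_cong[where f = sum_list], rule map_cong)
       (use sub B xy V in \<open>auto simp: balanced_def cplx.subspace_scale\<close>)
  also have "\<dots> = (\<Sum>(e, z)\<leftarrow>ws. B e z) + B s y"
    unfolding s(1) by (simp add: case_prod_unfold sum_list_addf)
  finally show ?case
    using Cons 1 unfolding orthogonalize.simps p ws_def[symmetric] c_def[symmetric] s_def[symmetric] fst_conv snd_conv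
    by (simp add: case_prod_unfold comp_def s_def c_def ws_def add_ac)
qed simp

section \<open>Orthogonalized tensors and separation by a faithful state\<close>

context faithful_state
begin

abbreviation orth :: "'a \<times> 'b \<Rightarrow> 'a \<times> 'b \<Rightarrow> bool"
  where "orth p q \<equiv> h ((fst p)\<^sup>\<star> * fst q) = 0"

lemma orth_sym: "h (x\<^sup>\<star> * y) = 0 \<longleftrightarrow> h (y\<^sup>\<star> * x) = 0"
  using h_star[of "x\<^sup>\<star> * y"] h_star[of "y\<^sup>\<star> * x"] by (auto simp: star_mult star_star)

text \<open>Repeated entries do no harm: an \<open>e\<close> orthogonal to itself has coefficient
  \<open>h (e\<^sup>\<star> * e) = 0\<close>. The summand \<open>g\<close> is any function vanishing
  at coefficient 0, which covers scalars, vectors and products of scalars at once.\<close>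

lemma orth_sum:
  fixes g :: "complex \<Rightarrow> 'a \<Rightarrow> 'b \<Rightarrow> 'v::comm_monoid_add"
  assumes "sorted_wrt orth ws" "(e, z) \<in> set ws" and g: "\<And>e z. g 0 e z = 0"
  shows "(\<Sum>(e', z')\<leftarrow>ws. g (h (e\<^sup>\<star> * e')) e' z') = g (h (e\<^sup>\<star> * e)) e z"
  using assms(1,2)
proof (induction ws)
  case (Cons p ws)
  show ?case
  proof (cases "p = (e, z)")
    case True
    have "(\<Sum>(e', z')\<leftarrow>ws. g (h (e\<^sup>\<star> * e')) e' z') = (\<Sum>(e', z')\<leftarrow>ws. 0)"
      by (rule arg_cong[where f = sum_list], rule map_cong) (use Cons.prems True g in auto)
    then show ?thesis using True by (simp add: case_prod_unfold)
  next
    case False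
    then have "(e, z) \<in> set ws" "h ((fst p)\<^sup>\<star> * e) = 0"
      using Cons.prems by auto
    then show ?thesis
      using Cons g by (simp add: case_prod_unfold orth_sym[of "fst p"])
  qed
qed simp

lemma orthogonalize_orth: "sorted_wrt orth (orthogonalize h zs)"
proof (induction zs)
  case (Cons p zs)
  define ws where "ws = orthogonalize h zs"
  define x where "x = fst p"
  define c where "c e = h (e\<^sup>\<star> * x) / h (e\<^sup>\<star> * e)" for e
  define s where "s = (\<Sum>(e, z)\<leftarrow>ws. c e *\<^sub>C e)"
  have "h ((x - s)\<^sup>\<star> * e) = 0" if ez: "(e, z) \<in> set ws" for e z
  proof -
    have "h (e\<^sup>\<star> * s) = (\<Sum>(e', z')\<leftarrow>ws. c e' * h (e\<^sup>\<star> * e'))"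
      unfolding s_def sum_list_const_mult[symmetric] h_sum_list
      by (simp add: case_prod_unfold comp_def mult_scaleC_right h_scaleC)
    also have "\<dots> = c e * h (e\<^sup>\<star> * e)"
      using orth_sum[OF _ ez, of "\<lambda>r e z. c e * r"] Cons.IH by (simp add: ws_def)
    \<comment> \<open>For \<open>e = 0\<close> the coefficient is a division by zero, but both sides
      vanish; otherwise faithfulness makes the denominator nonzero.\<close>
    also have "\<dots> = h (e\<^sup>\<star> * x)"
      by (cases "e = 0") (simp_all add: c_def h_faithful)
    finally have "h (e\<^sup>\<star> * (x - s)) = 0" by (simp add: right_diff_distrib h_diff)
    then show ?thesis by (simp add: orth_sym)
  qed
  then show ?case
    using Cons.IH unfolding orthogonalize.simps ws_def[symmetric] x_def[symmetric] c_def[symmetric] s_def[symmetric]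
    by (auto simp: sorted_wrt_map case_prod_unfold)
qed simp

text \<open>After orthogonalization the slice at \<open>e\<^sup>\<star>\<close> isolates one term
  \<open>h (e\<^sup>\<star> * e) *\<^sub>C z\<close>, so each term has a zero leg and every balanced
  map kills it. The conclusion is stated for all balanced \<open>B\<close> because the counit needs
  multiplication, and the form needs \<open>tn\<close> with its arguments exchanged.\<close>

lemma slices_separate:
  assumes V: "cplx.subspace V" "\<And>x. x \<in> V \<Longrightarrow> x\<^sup>\<star> \<in> V"
    and zs: "set zs \<subseteq> V \<times> V" and B: "balanced V B"
    and slice: "\<And>s. s \<in> V \<Longrightarrow> (\<Sum>(x, y)\<leftarrow>zs. h (s * x) *\<^sub>C y) = 0"
  shows "(\<Sum>(x, y)\<leftarrow>zs. B x y) = 0"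
proof -
  define ws where "ws = orthogonalize h zs"
  have sub: "set ws \<subseteq> V \<times> V" unfolding ws_def by (rule orthogonalize_subset) fact+
  have "B e z = 0" if ez: "(e, z) \<in> set ws" for e z
  proof -
    have eV: "e\<^sup>\<star> \<in> V" "e \<in> V" "z \<in> V" "0 \<in> V"
      using sub ez V by (auto simp: cplx.subspace_0)
    have bal: "balanced V (\<lambda>x y. h (e\<^sup>\<star> * x) *\<^sub>C y)"
      by (simp add: balanced_def distrib_left h_add scaleC_add_left scaleC_add_right
          mult_scaleC_right h_scaleC scaleC_scaleC mult.commute)
    have "h (e\<^sup>\<star> * e) *\<^sub>C z = (\<Sum>(e', z')\<leftarrow>ws. h (e\<^sup>\<star> * e') *\<^sub>C z')"
      using orth_sum[OF orthogonalize_orth ez[unfolded ws_def], of "\<lambda>r e z. r *\<^sub>C z"]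
      by (simp add: ws_def)
    also have "\<dots> = (\<Sum>(x, y)\<leftarrow>zs. h (e\<^sup>\<star> * x) *\<^sub>C y)"
      unfolding ws_def by (rule orthogonalize_sum[OF V(1) bal zs])
    also have "\<dots> = 0" by (rule slice[OF eV(1)])
    finally have "e = 0 \<or> z = 0" by (simp add: h_faithful)
    then show ?thesis using balanced_zero[OF B] eV by auto
  qed
  then have "(\<Sum>(x, y)\<leftarrow>ws. B x y) = (\<Sum>(x, y)\<leftarrow>ws. 0)"
    by (intro arg_cong[where f = sum_list] map_cong) auto
  then show ?thesis
    using orthogonalize_sum[OF V(1) B zs] by (simp add: ws_def case_prod_unfold)
qed

text \<open>Norm zero means spatial bound 0. Tested on the vector of \<open>1 \<otimes> 1\<close>
  for the state \<open>h'\<close> in both legs, it makes the squared GNS norm of the tensor vanish.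
  With orthogonal left legs this is a sum of nonnegative terms
  \<open>h (e\<^sup>\<star> * e) * h (z\<^sup>\<star> * z)\<close>, so each term has a zero leg.
  Faithfulness is used for \<open>h\<close> on \<open>V\<close>, to which \<open>h'\<close> pulls
  back.\<close>

lemma tensor_injective:
  fixes tn' :: "'b::cstar_algebra \<Rightarrow> 'b \<Rightarrow> 'c::cstar_algebra"
  assumes V: "cplx.subspace V"
    and zs: "set zs \<subseteq> V \<times> V" and B: "balanced V B"
    and tn': "min_tensor tn'" and \<iota>: "clinear_on V \<iota>" and h': "state h'"
    and h'_\<iota>: "\<And>x y. x \<in> V \<Longrightarrow> y \<in> V \<Longrightarrow> h' ((\<iota> x)\<^sup>\<star> * \<iota> y) = h (x\<^sup>\<star> * y)"
    and zero: "(\<Sum>(x, y)\<leftarrow>zs. tn' (\<iota> x) (\<iota> y)) = 0"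
  shows "(\<Sum>(x, y)\<leftarrow>zs. B x y) = 0"
proof -
  define ws where "ws = orthogonalize h zs"
  have sub: "set ws \<subseteq> V \<times> V" unfolding ws_def by (rule orthogonalize_subset) fact+
  have bal: "balanced V (\<lambda>x y. tn' (\<iota> x) (\<iota> y))"
    using tn' \<iota> unfolding balanced_def clinear_on_def min_tensor_def by simp
  define ws' where "ws' = map (\<lambda>(x, y). (\<iota> x, \<iota> y)) ws"
  have "(\<Sum>(x, y)\<leftarrow>ws'. tn' x y) = 0"
    using orthogonalize_sum[OF V bal zs, of h] zero
    by (simp add: ws'_def ws_def case_prod_unfold comp_def)
  then have "norm (\<Sum>(x, y)\<leftarrow>ws'. tn' x y) \<le> 0" by simp
  then have "spatial_bound ws' 0"
    using tn' unfolding min_tensor_def by blast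
  moreover have "ft_mult ws' [(1, 1)] = ws'"
    by (simp add: ft_mult_def case_prod_unfold)
  ultimately have "ft_sqnorm h' h' ws' \<le> 0"
    using h' unfolding spatial_bound_def by (metis mult_zero_left power_zero_numeral)
  moreover have "ft_sqnorm h' h' ws' = Re (\<Sum>(e, z)\<leftarrow>ws. \<Sum>(e', z')\<leftarrow>ws. h (e\<^sup>\<star> * e') * h (z\<^sup>\<star> * z'))"
  proof -
    have "(\<Sum>(a, b)\<leftarrow>ws'. \<Sum>(c, d)\<leftarrow>ws'. h' (a\<^sup>\<star> * c) * h' (b\<^sup>\<star> * d)) =
      (\<Sum>p\<leftarrow>ws. \<Sum>q\<leftarrow>ws. h' ((\<iota> (fst p))\<^sup>\<star> * \<iota> (fst q)) * h' ((\<iota> (snd p))\<^sup>\<star> * \<iota> (snd q)))"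
      by (simp add: ws'_def case_prod_unfold comp_def)
    also have "\<dots> = (\<Sum>p\<leftarrow>ws. \<Sum>q\<leftarrow>ws. h ((fst p)\<^sup>\<star> * fst q) * h ((snd p)\<^sup>\<star> * snd q))"
    proof (intro arg_cong[where f = sum_list] map_cong refl)
      fix p q assume "p \<in> set ws" "q \<in> set ws"
      then have "fst p \<in> V" "snd p \<in> V" "fst q \<in> V" "snd q \<in> V"
        using sub by auto
      then show "h' ((\<iota> (fst p))\<^sup>\<star> * \<iota> (fst q)) * h' ((\<iota> (snd p))\<^sup>\<star> * \<iota> (snd q)) =
          h ((fst p)\<^sup>\<star> * fst q) * h ((snd p)\<^sup>\<star> * snd q)"
        by (simp add: h'_\<iota>)
    qed
    finally show ?thesis by (simp add: ft_sqnorm_def case_prod_unfold)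
  qed
  moreover have "(\<Sum>(e, z)\<leftarrow>ws. \<Sum>(e', z')\<leftarrow>ws. h (e\<^sup>\<star> * e') * h (z\<^sup>\<star> * z'))
      = (\<Sum>(e, z)\<leftarrow>ws. h (e\<^sup>\<star> * e) * h (z\<^sup>\<star> * z))"
  proof -
    have "(\<Sum>(e', z')\<leftarrow>ws. h (e\<^sup>\<star> * e') * h (z\<^sup>\<star> * z')) = h (e\<^sup>\<star> * e) * h (z\<^sup>\<star> * z)"
      if "(e, z) \<in> set ws" for e z
      using orth_sum[OF orthogonalize_orth that[unfolded ws_def], of "\<lambda>r e' z'. r * h (z\<^sup>\<star> * z')"]
      by (simp add: ws_def)
    then show ?thesis
      by (intro arg_cong[where f = sum_list] map_cong) auto
  qed
  ultimately have "Re (\<Sum>(e, z)\<leftarrow>ws. h (e\<^sup>\<star> * e) * h (z\<^sup>\<star> * z)) \<le> 0"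
    by (simp only:)
  then have le: "(\<Sum>(e, z)\<leftarrow>ws. Re (h (e\<^sup>\<star> * e) * h (z\<^sup>\<star> * z))) \<le> 0"
    unfolding Re_sum_list case_prod_unfold .
  have nonneg: "0 \<le> Re (h (e\<^sup>\<star> * e) * h (z\<^sup>\<star> * z))" for e z
    using h_pos[of e] h_pos[of z] by (simp add: complex_nonneg_Reals_iff)
  have "B e z = 0" if ez: "(e, z) \<in> set ws" for e z
  proof -
    have "Re (h (e\<^sup>\<star> * e) * h (z\<^sup>\<star> * z)) \<le> (\<Sum>(e, z)\<leftarrow>ws. Re (h (e\<^sup>\<star> * e) * h (z\<^sup>\<star> * z)))"
      using member_le_sum_list[of "Re (h (e\<^sup>\<star> * e) * h (z\<^sup>\<star> * z))"
          "map (\<lambda>(e, z). Re (h (e\<^sup>\<star> * e) * h (z\<^sup>\<star> * z))) ws"] ez nonneg by force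
    then have "Re (h (e\<^sup>\<star> * e) * h (z\<^sup>\<star> * z)) = 0"
      using le nonneg[of e z] by linarith
    then have "h (e\<^sup>\<star> * e) = 0 \<or> h (z\<^sup>\<star> * z) = 0"
      using h_pos[of e] h_pos[of z] by (auto simp: complex_nonneg_Reals_iff complex_eq_iff)
    then have "e = 0 \<or> z = 0" by (simp add: h_faithful)
    moreover have "e \<in> V" "z \<in> V" "0 \<in> V"
      using sub ez V by (auto simp: cplx.subspace_0)
    ultimately show ?thesis using balanced_zero[OF B] by auto
  qed
  then have "(\<Sum>(x, y)\<leftarrow>ws. B x y) = (\<Sum>(x, y)\<leftarrow>ws. 0)"
    by (intro arg_cong[where f = sum_list] map_cong) auto
  then show ?thesis
    using orthogonalize_sum[OF V B zs] by (simp add: ws_def case_prod_unfold)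
qed

text \<open>With \<open>\<iota> = id\<close> this makes \<open>alg_lift\<close> well defined; with a
  map into a completion it carries identities back to the Hopf algebra.\<close>

lemma tensor_eq_imp_balanced_eq:
  fixes tn' :: "'b::cstar_algebra \<Rightarrow> 'b \<Rightarrow> 'c::cstar_algebra"
  assumes V: "cplx.subspace V" and sub: "set zs \<subseteq> V \<times> V" "set zs' \<subseteq> V \<times> V" and B: "balanced V B"
    and tn': "min_tensor tn'" and \<iota>: "clinear_on V \<iota>" and h': "state h'"
    and h'_\<iota>: "\<And>x y. x \<in> V \<Longrightarrow> y \<in> V \<Longrightarrow> h' ((\<iota> x)\<^sup>\<star> * \<iota> y) = h (x\<^sup>\<star> * y)"
    and eq: "(\<Sum>(x, y)\<leftarrow>zs. tn' (\<iota> x) (\<iota> y)) = (\<Sum>(x, y)\<leftarrow>zs'. tn' (\<iota> x) (\<iota> y))"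
  shows "(\<Sum>(x, y)\<leftarrow>zs. B x y) = (\<Sum>(x, y)\<leftarrow>zs'. B x y)"
proof -
  define ws where "ws = map (\<lambda>(x, y). (- x, y)) zs'"
  \<comment> \<open>The sign comes from additivity; scalars cannot provide it, since for a balanced
    \<open>C\<close> they only move from one leg to the other.\<close>
  have neg: "(\<Sum>(x, y)\<leftarrow>ws. C x y) = - (\<Sum>(x, y)\<leftarrow>zs'. C x y)" if C: "balanced V C" for C :: "'a \<Rightarrow> 'a \<Rightarrow> 'v::ab_group_add"
    using sub(2) unfolding ws_def
  proof (induction zs')
    case (Cons p zs)
    obtain x y where p: "p = (x, y)" by force
    have xy: "x \<in> V" "y \<in> V" "- x \<in> V" "0 \<in> V"
      using Cons.prems V p by (auto simp: cplx.subspace_neg cplx.subspace_0)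
    have "C (x + - x) y = C x y + C (- x) y"
      using C xy unfolding balanced_def by blast
    then have "C (- x) y = - C x y"
      using balanced_zero(1)[OF C xy(4,2)] by (simp add: eq_neg_iff_add_eq_0 add.commute)
    then show ?case using Cons p by simp
  qed simp
  have bal: "balanced V (\<lambda>x y. tn' (\<iota> x) (\<iota> y))"
    using tn' \<iota> unfolding balanced_def clinear_on_def min_tensor_def by simp
  have "(\<Sum>(x, y)\<leftarrow>zs @ ws. B x y) = 0"
  proof (rule tensor_injective[OF V _ B tn' \<iota> h' h'_\<iota>])
    show "set (zs @ ws) \<subseteq> V \<times> V"
      using sub V by (auto simp: ws_def cplx.subspace_neg)
  qed (simp_all add: neg[OF bal] eq)
  then show ?thesis by (simp add: neg[OF B])
qed

end

section \<open>Matrices\<close>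

text \<open>Induction by the Schur complement \<open>Q\<close> of the last diagonal entry, which is
  again positive definite. The two-sided inverse \<open>E\<close> of the factor \<open>C\<close> is
  built along with it.\<close>

lemma positive_definite_Cholesky:
  fixes P :: "nat \<Rightarrow> nat \<Rightarrow> complex"
  assumes "\<And>i j. P j i = cnj (P i j)"
    and "\<And>\<xi>. \<exists>i<n. \<xi> i \<noteq> 0 \<Longrightarrow> 0 < Re (\<Sum>i<n. \<Sum>j<n. cnj (\<xi> i) * \<xi> j * P i j)"
  shows "\<exists>C E. \<forall>i<n. \<forall>j<n. P i j = (\<Sum>k<n. cnj (C k i) * C k j) \<and>
    (\<Sum>k<n. C i k * E k j) = (if i = j then 1 else 0) \<and>
    (\<Sum>k<n. E i k * C k j) = (if i = j then 1 else 0)"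
  using assms
proof (induction n arbitrary: P)
  case 0
  show ?case by simp
next
  case (Suc n)
  note herm = Suc.prems(1)
  define p where "p = Re (P n n)"
  have "(\<Sum>i<Suc n. \<Sum>j<Suc n. cnj (if i = n then 1 else 0) * (if j = n then 1 else 0) * P i j) = P n n"
    by (simp add: if_distrib[of cnj] if_distrib[of "\<lambda>x. x * _"] cong: if_cong)
  then have p0: "0 < p"
    using Suc.prems(2)[of "\<lambda>i. if i = n then 1 else 0"] unfolding p_def by (metis lessI zero_neq_one)
  have Pnn: "P n n = of_real p"
    using herm[of n n] by (simp add: p_def complex_eq_iff)
  define Q where "Q i j = P i j - P i n * P n j / of_real p" for i j
  have "\<exists>C E. \<forall>i<n. \<forall>j<n. Q i j = (\<Sum>k<n. cnj (C k i) * C k j) \<and>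
    (\<Sum>k<n. C i k * E k j) = (if i = j then 1 else 0) \<and>
    (\<Sum>k<n. E i k * C k j) = (if i = j then 1 else 0)"
  proof (rule Suc.IH)
    show "Q j i = cnj (Q i j)" for i j
      unfolding Q_def using herm[of i j] herm[of n j] herm[of i n] by (simp add: mult.commute)
    fix \<xi> :: "nat \<Rightarrow> complex" assume nz: "\<exists>i<n. \<xi> i \<noteq> 0"
    define s where "s = (\<Sum>j<n. P n j * \<xi> j)"
    \<comment> \<open>The last coordinate minimizes the form of \<open>P\<close> with the others
      fixed; completing the square leaves the form of \<open>Q\<close> at
      \<open>\<xi>\<close>.\<close>
    define \<eta> where "\<eta> i = (if i = n then - s / of_real p else \<xi> i)" for i
    have cs: "cnj s = (\<Sum>i<n. cnj (\<xi> i) * P i n)"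
      by (simp add: s_def herm[of _ n] mult.commute)
    have "(\<Sum>i<Suc n. \<Sum>j<Suc n. cnj (\<eta> i) * \<eta> j * P i j) =
        (\<Sum>i<n. \<Sum>j<n. cnj (\<xi> i) * \<xi> j * P i j) + (\<Sum>i<n. cnj (\<xi> i) * P i n) * \<eta> n +
        cnj (\<eta> n) * (\<Sum>j<n. P n j * \<xi> j) + cnj (\<eta> n) * \<eta> n * P n n"
      by (simp add: \<eta>_def sum.distrib sum_distrib_left sum_distrib_right sum_subtractf sum_negf mult_ac)
    also have "\<dots> = (\<Sum>i<n. \<Sum>j<n. cnj (\<xi> i) * \<xi> j * P i j) - cnj s * s / of_real p"
      unfolding cs[symmetric] s_def[symmetric] Pnn using p0 by (simp add: \<eta>_def field_simps)
    also have "\<dots> = (\<Sum>i<n. \<Sum>j<n. cnj (\<xi> i) * \<xi> j * Q i j)"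
      unfolding cs unfolding s_def Q_def sum_product right_diff_distrib sum_subtractf sum_divide_distrib
      by (simp add: mult_ac)
    finally show "0 < Re (\<Sum>i<n. \<Sum>j<n. cnj (\<xi> i) * \<xi> j * Q i j)"
      using Suc.prems(2)[of \<eta>] nz by (metis \<eta>_def less_SucI nat_neq_iff)
  qed
  then obtain C E where Q: "\<And>i j. i < n \<Longrightarrow> j < n \<Longrightarrow> Q i j = (\<Sum>k<n. cnj (C k i) * C k j)"
    and CE: "\<And>i j. i < n \<Longrightarrow> j < n \<Longrightarrow> (\<Sum>k<n. C i k * E k j) = (if i = j then 1 else 0)"
    and EC: "\<And>i j. i < n \<Longrightarrow> j < n \<Longrightarrow> (\<Sum>k<n. E i k * C k j) = (if i = j then 1 else 0)"
    by blast
  define r where "r = complex_of_real (sqrt p)"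
  have r: "r \<noteq> 0" "cnj r = r" "r * r = of_real p"
    using p0 by (simp_all add: r_def flip: of_real_mult)
  \<comment> \<open>Block lower triangular: row \<open>n\<close> of the factor is row
    \<open>n\<close> of \<open>P\<close> divided by \<open>r\<close>, which leaves \<open>r\<close>
    on the diagonal. Solving for the inverse gives \<open>1 / r\<close> in the corner and, in the
    rest of that row, row \<open>n\<close> of \<open>P\<close> times \<open>E\<close>, divided by
    \<open>- p\<close>.\<close>
  define C' where "C' i j = (if i = n then P n j / r else if j = n then 0 else C i j)" for i j
  define E' where "E' i j = (if i = n then if j = n then 1 / r else - (\<Sum>k<n. P n k * E k j) / of_real p
    else if j = n then 0 else E i j)" for i j
  have Cnn: "C' n n = r" using r(1) by (simp add: C'_def Pnn flip: r(3))
  show ?case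
  proof (rule exI[of _ C'], rule exI[of _ E'], intro allI impI conjI)
    fix i j assume ij: "i < Suc n" "j < Suc n"
    have inr: "cnj (P n i / r) * (P n j / r) = P i n * P n j / of_real p" for i j
      using r(1,2) herm[of n i] by (simp flip: r(3))
    show "P i j = (\<Sum>k<Suc n. cnj (C' k i) * C' k j)"
    proof (cases "i < n \<and> j < n")
      case True
      then have "(\<Sum>k<n. cnj (C' k i) * C' k j) = Q i j"
        by (simp add: Q C'_def)
      then show ?thesis using inr[of i j] by (simp only: sum.lessThan_Suc C'_def Q_def simp_thms if_True) simp
    next
      case False
      then have "i = n \<or> j = n" using ij by auto
      then have "(\<Sum>k<n. cnj (C' k i) * C' k j) = 0"
        by (intro sum.neutral) (auto simp: C'_def)
      moreover have "P i n * P n j / of_real p = P i j"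
        using \<open>i = n \<or> j = n\<close> p0 by (auto simp: Pnn)
      ultimately show ?thesis using inr[of i j] by (simp only: sum.lessThan_Suc C'_def simp_thms if_True) simp
    qed
    show "(\<Sum>k<Suc n. C' i k * E' k j) = (if i = j then 1 else 0)"
    proof (cases "i < n")
      case True
      then show ?thesis using ij CE[of i j] by (auto simp: C'_def E'_def less_Suc_eq)
    next
      case False
      then have i: "i = n" using ij by simp
      show ?thesis
      proof (cases "j < n")
        case True
        then have "(\<Sum>k<n. C' n k * E' k j) = (\<Sum>k<n. P n k * E k j) / r"
          by (simp add: C'_def E'_def sum_divide_distrib)
        moreover have "E' n j = - (\<Sum>k<n. P n k * E k j) / (r * r)"
          using True by (simp add: E'_def r(3))
        ultimately show ?thesis using True r(1) by (simp add: i Cnn)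
      next
        case False
        then show ?thesis using ij i r(1) by (simp add: Cnn E'_def)
      qed
    qed
    show "(\<Sum>k<Suc n. E' i k * C' k j) = (if i = j then 1 else 0)"
    proof (cases "i < n")
      case True
      then show ?thesis using ij EC[of i j] by (auto simp: C'_def E'_def less_Suc_eq)
    next
      case False
      then have i: "i = n" using ij by simp
      show ?thesis
      proof (cases "j < n")
        case True
        have "(\<Sum>k<n. E' n k * C' k j) = - (\<Sum>k<n. \<Sum>l<n. P n l * E l k * C k j) / of_real p"
          using True by (simp add: C'_def E'_def sum_divide_distrib sum_distrib_right sum_negf)
        also have "(\<Sum>k<n. \<Sum>l<n. P n l * E l k * C k j) = (\<Sum>l<n. P n l * (\<Sum>k<n. E l k * C k j))"
          by (subst sum.swap) (simp add: sum_distrib_left mult.assoc)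
        also have "\<dots> = P n j"
          by (subst sum.remove[of _ j]) (use True EC in \<open>auto intro!: sum.neutral\<close>)
        finally have *: "(\<Sum>k<n. E' n k * C' k j) = - P n j / (r * r)"
          by (simp add: r(3))
        have "E' n n = 1 / r" "C' n j = P n j / r"
          by (simp_all add: C'_def E'_def)
        then show ?thesis using True * by (simp add: i)
      next
        case False
        then have "(\<Sum>k<n. E' n k * C' k n) = 0" by (simp add: C'_def)
        then show ?thesis using False ij i r(1) by (simp add: Cnn E'_def less_Suc_eq)
      qed
    qed
  qed
qed

text \<open>Matrices of size \<open>n\<close> are functions of two indices; products vanish outside the index range,
  so that matrix identities are equations between functions.\<close>

definition mmul :: "nat \<Rightarrow> (nat \<Rightarrow> nat \<Rightarrow> 'a::semiring_0) \<Rightarrow> (nat \<Rightarrow> nat \<Rightarrow> 'a) \<Rightarrow> nat \<Rightarrow> nat \<Rightarrow> 'a"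
  where "mmul n A B i j = (if i < n \<and> j < n then \<Sum>k<n. A i k * B k j else 0)"

definition mone :: "nat \<Rightarrow> nat \<Rightarrow> nat \<Rightarrow> 'a::zero_neq_one"
  where "mone n i j = (if i < n \<and> i = j then 1 else 0)"

definition adj :: "(nat \<Rightarrow> nat \<Rightarrow> 'a::cstar_algebra) \<Rightarrow> nat \<Rightarrow> nat \<Rightarrow> 'a"
  where "adj A i j = (A j i)\<^sup>\<star>"

definition scalar_matrix :: "(nat \<Rightarrow> nat \<Rightarrow> complex) \<Rightarrow> nat \<Rightarrow> nat \<Rightarrow> 'a::cstar_algebra"
  where "scalar_matrix C i j = C i j *\<^sub>C 1"

lemma mmul_assoc: "mmul n (mmul n A B) D = mmul n A (mmul n B D)"
proof (intro ext)
  fix i j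
  have "(\<Sum>k<n. (\<Sum>l<n. A i l * B l k) * D k j) = (\<Sum>l<n. A i l * (\<Sum>k<n. B l k * D k j))"
    by (simp add: sum_distrib_left sum_distrib_right mult.assoc) (rule sum.swap)
  then show "mmul n (mmul n A B) D i j = mmul n A (mmul n B D) i j"
    by (simp add: mmul_def)
qed

lemma mmul_one_left: "mmul n (mone n) A = (\<lambda>i j. if i < n \<and> j < n then A i j else (0::'a::{semiring_0,zero_neq_one,monoid_mult}))"
proof (intro ext)
  fix i j
  have "(\<Sum>k<n. mone n i k * A k j) = A i j" if "i < n"
    by (subst sum.remove[of _ i]) (use that in \<open>auto simp: mone_def intro!: sum.neutral\<close>)
  then show "mmul n (mone n) A i j = (if i < n \<and> j < n then A i j else 0)"
    by (simp add: mmul_def)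
qed

lemma mmul_one_right: "mmul n A (mone n) = (\<lambda>i j. if i < n \<and> j < n then A i j else (0::'a::{semiring_0,zero_neq_one,monoid_mult}))"
proof (intro ext)
  fix i j
  have "(\<Sum>k<n. A i k * mone n k j) = A i j" if "j < n"
    by (subst sum.remove[of _ j]) (use that in \<open>auto simp: mone_def intro!: sum.neutral\<close>)
  then show "mmul n A (mone n) i j = (if i < n \<and> j < n then A i j else 0)"
    by (simp add: mmul_def)
qed

text \<open>\<open>mone n\<close> truncates to the index range, so it is neutral only next to a
  matrix that already is a product or is about to be multiplied. This is enough to cancel inverses
  inside longer products.\<close>

lemma mmul_one_mmul:
  fixes A :: "nat \<Rightarrow> nat \<Rightarrow> 'a::cstar_algebra"
  shows "mmul n (mone n) (mmul n A B) = mmul n A B" "mmul n (mmul n A B) (mone n) = mmul n A B"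
    and "mmul n A (mmul n (mone n) B) = mmul n A B"
  by (auto simp: mmul_one_left mmul_one_right mmul_def fun_eq_iff)

lemma adj_mmul: "adj (mmul n A B) = mmul n (adj B) (adj A)"
  by (auto simp: adj_def mmul_def fun_eq_iff star_sum star_mult)

lemma adj_mone: "adj (mone n) = mone n"
  by (auto simp: adj_def mone_def fun_eq_iff)

lemma mmul_scalar_matrix:
  "mmul n (scalar_matrix C) (scalar_matrix E) = scalar_matrix (mmul n C E)"
  by (auto simp: mmul_def scalar_matrix_def fun_eq_iff mult_scaleC_left mult_scaleC_right scaleC_scaleC cplx.scale_sum_left mult.commute)

lemma scalar_matrix_mone: "scalar_matrix (mone n) = mone n"
  by (auto simp: mone_def scalar_matrix_def fun_eq_iff scaleC_one)

lemma adj_scalar_matrix: "adj (scalar_matrix C) = scalar_matrix (\<lambda>i j. cnj (C j i))"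
  by (auto simp: adj_def scalar_matrix_def fun_eq_iff star_scaleC)

context faithful_state
begin

text \<open>The matrix to be factored is the Gram matrix of the columns of \<open>v\<close>. The
  relation with \<open>z\<close> makes these columns linearly independent over the complex numbers,
  so faithfulness makes the matrix positive definite. The factors are returned as scalar matrices
  over the algebra, ready to be multiplied with corepresentation matrices.\<close>

lemma gram_Cholesky:
  assumes vz: "\<And>i j. i < n \<Longrightarrow> j < n \<Longrightarrow> (\<Sum>k<n. v k i * z k j) = (if i = j then 1 else 0)"
  obtains C E :: "nat \<Rightarrow> nat \<Rightarrow> 'a" and C' E'
  where "C = scalar_matrix C'" "E = scalar_matrix E'"
    "mmul n (adj C) C = (\<lambda>i j. if i < n \<and> j < n then (\<Sum>k<n. h ((v k i)\<^sup>\<star> * v k j)) *\<^sub>C 1 else 0)"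
    "mmul n C E = mone n" "mmul n E C = mone n"
proof -
  define P where "P i j = (\<Sum>k<n. h ((v k i)\<^sup>\<star> * v k j))" for i j
  have "\<exists>C E. \<forall>i<n. \<forall>j<n. P i j = (\<Sum>k<n. cnj (C k i) * C k j) \<and>
    (\<Sum>k<n. C i k * E k j) = (if i = j then 1 else 0) \<and>
    (\<Sum>k<n. E i k * C k j) = (if i = j then 1 else 0)"
  proof (rule positive_definite_Cholesky)
    show "P j i = cnj (P i j)" for i j
      unfolding P_def cnj_sum h_star[symmetric] by (simp add: star_mult star_star)
    fix \<xi> :: "nat \<Rightarrow> complex" assume nz: "\<exists>i<n. \<xi> i \<noteq> 0"
    define y where "y k = (\<Sum>j<n. \<xi> j *\<^sub>C v k j)" for k
    have "h ((y k)\<^sup>\<star> * y k) = (\<Sum>i<n. \<Sum>j<n. cnj (\<xi> i) * \<xi> j * h ((v k i)\<^sup>\<star> * v k j))" for k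
      by (simp add: y_def star_sum star_scaleC sum_product mult_scaleC_left mult_scaleC_right
          h_sum h_scaleC mult_ac)
    then have "(\<Sum>k<n. h ((y k)\<^sup>\<star> * y k)) = (\<Sum>k<n. \<Sum>i<n. \<Sum>j<n. cnj (\<xi> i) * \<xi> j * h ((v k i)\<^sup>\<star> * v k j))"
      by simp
    also have "\<dots> = (\<Sum>i<n. \<Sum>j<n. \<Sum>k<n. cnj (\<xi> i) * \<xi> j * h ((v k i)\<^sup>\<star> * v k j))"
      by (subst sum.swap, rule sum.cong[OF refl], rule sum.swap)
    finally have eq: "(\<Sum>i<n. \<Sum>j<n. cnj (\<xi> i) * \<xi> j * P i j) = (\<Sum>k<n. h ((y k)\<^sup>\<star> * y k))"
      by (simp add: P_def sum_distrib_left)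
    have nonneg: "0 \<le> Re (h ((y k)\<^sup>\<star> * y k))" for k
      using h_pos by (simp add: complex_nonneg_Reals_iff)
    have "\<exists>k<n. y k \<noteq> 0"
    proof (rule ccontr)
      assume "\<not> ?thesis"
      then have y0: "y k = 0" if "k < n" for k using that by blast
      have "\<xi> i = 0" if i: "i < n" for i
      proof -
        have "(\<Sum>k<n. y k * z k i) = (\<Sum>j<n. \<xi> j *\<^sub>C (\<Sum>k<n. v k j * z k i))"
          by (simp add: y_def sum_distrib_right mult_scaleC_left cplx.scale_sum_right) (rule sum.swap)
        also have "\<dots> = (\<Sum>j<n. if j = i then \<xi> i *\<^sub>C 1 else 0)"
          by (rule sum.cong) (use vz i in auto)
        finally show ?thesis using i y0 by simp
      qed
      with nz show False by blast
    qed
    then obtain k where k: "k < n" "y k \<noteq> 0" by blast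
    have "Re (h ((y k)\<^sup>\<star> * y k)) \<noteq> 0"
      using h_pos[of "y k"] h_faithful[of "y k"] k by (auto simp: complex_nonneg_Reals_iff complex_eq_iff)
    then have "0 < (\<Sum>k<n. Re (h ((y k)\<^sup>\<star> * y k)))"
      using k nonneg by (intro sum_pos2[of _ k]) (auto simp: less_le)
    then show "0 < Re (\<Sum>i<n. \<Sum>j<n. cnj (\<xi> i) * \<xi> j * P i j)"
      by (simp add: eq)
  qed
  then obtain C E where CE: "\<And>i j. i < n \<Longrightarrow> j < n \<Longrightarrow> P i j = (\<Sum>k<n. cnj (C k i) * C k j)"
    "\<And>i j. i < n \<Longrightarrow> j < n \<Longrightarrow> (\<Sum>k<n. C i k * E k j) = (if i = j then 1 else 0)"
    "\<And>i j. i < n \<Longrightarrow> j < n \<Longrightarrow> (\<Sum>k<n. E i k * C k j) = (if i = j then 1 else 0)"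
    by blast
  have 1: "mmul n C E = mone n" "mmul n E C = mone n"
    using CE by (auto simp: mmul_def mone_def fun_eq_iff)
  have 2: "mmul n (adj (scalar_matrix C)) (scalar_matrix C) =
      (\<lambda>i j. if i < n \<and> j < n then (\<Sum>k<n. h ((v k i)\<^sup>\<star> * v k j)) *\<^sub>C 1 else (0::'a))"
    unfolding adj_scalar_matrix mmul_scalar_matrix
    using CE(1) by (auto simp: mmul_def scalar_matrix_def fun_eq_iff P_def)
  have 3: "mmul n (scalar_matrix C) (scalar_matrix E) = (mone n :: nat \<Rightarrow> nat \<Rightarrow> 'a)"
    "mmul n (scalar_matrix E) (scalar_matrix C) = (mone n :: nat \<Rightarrow> nat \<Rightarrow> 'a)"
    by (simp_all add: mmul_scalar_matrix 1 scalar_matrix_mone)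
  show thesis
    by (rule that[OF refl refl 2 3])
qed

end

section \<open>Bounded linear maps composed with multiplications\<close>

lemma sum_list_upt_eq_sum: "(\<Sum>k\<leftarrow>[0..<n]. f k) = (\<Sum>k<n. f k)"
  by (simp add: sum_set_upt_conv_sum_list_nat[symmetric] atLeast0LessThan)

lemma bounded_clinear_mult_right:
  assumes "bounded_clinear f" shows "bounded_clinear (\<lambda>x. f (x * c))"
proof -
  obtain K where K: "\<And>x. norm (f x) \<le> K * norm x"
    using assms unfolding bounded_clinear_def by blast
  have K0: "norm (f x) \<le> \<bar>K\<bar> * norm x" for x
    using K[of x] by (meson abs_ge_self mult_right_mono norm_ge_zero order_trans)
  have "norm (f (x * c)) \<le> (\<bar>K\<bar> * norm c) * norm x" for x
    using K0[of "x * c"] mult_left_mono[OF norm_mult_ineq[of x c] abs_ge_zero[of K]] by (simp add: mult_ac)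
  then show ?thesis
    using assms unfolding bounded_clinear_def clinear_on_def by (auto simp: distrib_right mult_scaleC_left)
qed

lemma bounded_clinear_mult_left:
  assumes "bounded_clinear f" shows "bounded_clinear (\<lambda>x. f (c * x))"
proof -
  obtain K where K: "\<And>x. norm (f x) \<le> K * norm x"
    using assms unfolding bounded_clinear_def by blast
  have K0: "norm (f x) \<le> \<bar>K\<bar> * norm x" for x
    using K[of x] by (meson abs_ge_self mult_right_mono norm_ge_zero order_trans)
  have "norm (f (c * x)) \<le> (\<bar>K\<bar> * norm c) * norm x" for x
    using K0[of "c * x"] mult_left_mono[OF norm_mult_ineq[of c x] abs_ge_zero[of K]] by (simp add: mult_ac)
  then show ?thesis
    using assms unfolding bounded_clinear_def clinear_on_def by (auto simp: distrib_left mult_scaleC_right)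
qed

lemma bounded_clinear_const_mult: "bounded_clinear f \<Longrightarrow> bounded_clinear (\<lambda>x. c * f x)"
  and bounded_clinear_mult_const: "bounded_clinear f \<Longrightarrow> bounded_clinear (\<lambda>x. f x * c)"
proof -
  assume f: "bounded_clinear f"
  obtain K where K: "\<And>x. norm (f x) \<le> K * norm x"
    using f unfolding bounded_clinear_def by blast
  have "norm (c * f x) \<le> (norm c * K) * norm x" "norm (f x * c) \<le> (norm c * K) * norm x" for x
    using norm_mult_ineq[of c "f x"] norm_mult_ineq[of "f x" c]
      mult_left_mono[OF K[of x] norm_ge_zero[of c]] by (simp_all add: mult_ac)
  then show "bounded_clinear (\<lambda>x. c * f x)" "bounded_clinear (\<lambda>x. f x * c)"
    using f unfolding bounded_clinear_def clinear_on_def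
    by (auto simp: distrib_left distrib_right mult_scaleC_left mult_scaleC_right)
qed

lemma clinear_on_sum:
  assumes "clinear_on V f" "cplx.subspace V" "\<And>k. k \<in> A \<Longrightarrow> g k \<in> V"
  shows "f (\<Sum>k\<in>A. g k) = (\<Sum>k\<in>A. f (g k))"
proof -
  have f0: "f 0 = 0"
    using assms(1,2) unfolding clinear_on_def
    by (metis cplx.scale_zero_left cplx.subspace_0)
  show ?thesis
    using assms(3)
  proof (induction A rule: infinite_finite_induct)
    case (insert k A)
    then have "g k \<in> V" "sum g A \<in> V"
      using assms(2) by (auto intro: cplx.subspace_sum)
    then show ?case
      using insert assms(1) by (simp add: clinear_on_def)
  qed (simp_all add: f0)
qed

section \<open>The coproduct on the Hopf *-algebra\<close>

text \<open>\<open>F\<close> and \<open>G\<close> are the slices \<open>h \<otimes> id\<close> and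
  \<open>id \<otimes> h\<close>. They are parameters because \<open>haar_state\<close> provides them
  existentially.\<close>

locale cqg = faithful_state h
  for h :: "'a::cstar_algebra \<Rightarrow> complex" +
  fixes tn :: "'a \<Rightarrow> 'a \<Rightarrow> 't::cstar_algebra" and \<Delta> :: "'a \<Rightarrow> 't"
    and F G :: "'t \<Rightarrow> 'a"
  assumes tn: "min_tensor tn" and \<Delta>: "star_hom_on UNIV \<Delta>"
    and F: "bounded_clinear F" and F_tn: "\<And>a b. F (tn a b) = h a *\<^sub>C b"
    and F_\<Delta>: "\<And>a. F (\<Delta> a) = h a *\<^sub>C 1"
    and G: "bounded_clinear G" and G_tn: "\<And>a b. G (tn a b) = h b *\<^sub>C a"
    and G_\<Delta>: "\<And>a. G (\<Delta> a) = h a *\<^sub>C 1"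
begin

abbreviation H where "H \<equiv> hopf_alg tn \<Delta>"

lemma tn_add_left: "tn (x + y) z = tn x z + tn y z"
  and tn_add_right: "tn x (y + z) = tn x y + tn x z"
  and tn_scaleC_left: "tn (c *\<^sub>C x) z = c *\<^sub>C tn x z"
  and tn_scaleC_right: "tn x (c *\<^sub>C z) = c *\<^sub>C tn x z"
  and tn_mult: "tn a b * tn a' b' = tn (a * a') (b * b')"
  and tn_star: "(tn a b)\<^sup>\<star> = tn (a\<^sup>\<star>) (b\<^sup>\<star>)"
  and tn_one: "tn 1 1 = 1"
  using tn by (auto simp: min_tensor_def clinear_on_def)

lemma tn_zero [simp]: "tn 0 x = 0" "tn x 0 = 0"
  using tn_scaleC_left[of 0 0 x] tn_scaleC_right[of x 0 0] by simp_all

lemma tn_sum_left: "tn (sum f A) y = (\<Sum>x\<in>A. tn (f x) y)"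
  by (induction A rule: infinite_finite_induct) (simp_all add: tn_add_left)

lemma tn_sum_right: "tn y (sum f A) = (\<Sum>x\<in>A. tn y (f x))"
  by (induction A rule: infinite_finite_induct) (simp_all add: tn_add_right)

lemma \<Delta>_add: "\<Delta> (x + y) = \<Delta> x + \<Delta> y"
  and \<Delta>_scaleC: "\<Delta> (c *\<^sub>C x) = c *\<^sub>C \<Delta> x"
  and \<Delta>_mult: "\<Delta> (x * y) = \<Delta> x * \<Delta> y"
  and \<Delta>_star: "\<Delta> (x\<^sup>\<star>) = (\<Delta> x)\<^sup>\<star>"
  and \<Delta>_one: "\<Delta> 1 = 1"
  using \<Delta> by (auto simp: star_hom_on_def clinear_on_def)

lemma \<Delta>_zero [simp]: "\<Delta> 0 = 0"
  using \<Delta>_scaleC[of 0 0] by simp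

lemma \<Delta>_sum: "\<Delta> (sum f A) = (\<Sum>x\<in>A. \<Delta> (f x))"
  by (induction A rule: infinite_finite_induct) (simp_all add: \<Delta>_add)

lemma F_add: "F (x + y) = F x + F y" and F_scaleC: "F (c *\<^sub>C x) = c *\<^sub>C F x"
  and G_add: "G (x + y) = G x + G y" and G_scaleC: "G (c *\<^sub>C x) = c *\<^sub>C G x"
  using F G by (auto simp: bounded_clinear_def clinear_on_def)

lemma F_sum: "F (sum f A) = (\<Sum>x\<in>A. F (f x))" and G_sum: "G (sum f A) = (\<Sum>x\<in>A. G (f x))"
  using clinear_on_sum[of UNIV F A f] clinear_on_sum[of UNIV G A f] F G
  by (simp_all add: bounded_clinear_def)

lemma F_mult: "F (X * tn 1 c) = F X * c"
  by (rule min_tensor_ext[OF tn bounded_clinear_mult_right[OF F] bounded_clinear_mult_const[OF F]])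
     (simp add: tn_mult F_tn mult_scaleC_left)

lemma G_mult: "G (tn c 1 * X) = c * G X"
  by (rule min_tensor_ext[OF tn bounded_clinear_mult_left[OF G] bounded_clinear_const_mult[OF G]])
     (simp add: tn_mult G_tn mult_scaleC_right)

lemma balanced_tn: "balanced V tn"
  by (simp add: balanced_def tn_add_left tn_add_right tn_scaleC_left tn_scaleC_right)

section \<open>The Hopf *-algebra as a span of coefficients\<close>

lemma subspace_H: "cplx.subspace H"
  unfolding hopf_alg_def by (rule cplx.subspace_span)

lemma H_add: "x \<in> H \<Longrightarrow> y \<in> H \<Longrightarrow> x + y \<in> H"
    and H_scaleC: "x \<in> H \<Longrightarrow> c *\<^sub>C x \<in> H"
    and H_diff: "x \<in> H \<Longrightarrow> y \<in> H \<Longrightarrow> x - y \<in> H"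
    and H_zero: "0 \<in> H"
    and H_sum: "(\<And>k. k \<in> A \<Longrightarrow> f k \<in> H) \<Longrightarrow> sum f A \<in> H"
  using subspace_H by (auto intro: cplx.subspace_add cplx.subspace_scale cplx.subspace_diff cplx.subspace_0 cplx.subspace_sum)

lemma coefficient_in_H: "unitary_corep tn \<Delta> n u \<Longrightarrow> i < n \<Longrightarrow> j < n \<Longrightarrow> u i j \<in> H"
  unfolding hopf_alg_def by (rule cplx.span_base) blast

lemma H_induct [consumes 1, case_names zero step]:
  assumes "x \<in> H" "P 0"
    "\<And>c n u i j y. unitary_corep tn \<Delta> n u \<Longrightarrow> i < n \<Longrightarrow> j < n \<Longrightarrow> y \<in> H \<Longrightarrow> P y \<Longrightarrow> P (c *\<^sub>C u i j + y)"
  shows "P x"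
proof -
  have "x \<in> H \<and> P x"
    using assms(1) unfolding hopf_alg_def
  proof (induction rule: cplx.span_induct_alt)
    case base
    then show ?case using assms(2) H_zero unfolding hopf_alg_def by blast
  next
    case (step c x y)
    then obtain n u i j where u: "unitary_corep tn \<Delta> n u" "i < n" "j < n" "x = u i j" by blast
    then show ?case
      using assms(3)[OF u(1,2,3), of y c] coefficient_in_H[OF u(1,2,3)] step H_add H_scaleC
      unfolding hopf_alg_def by blast
  qed
  then show ?thesis ..
qed

lemma corep_coproduct: "unitary_corep tn \<Delta> n u \<Longrightarrow> i < n \<Longrightarrow> j < n \<Longrightarrow> \<Delta> (u i j) = (\<Sum>k<n. tn (u i k) (u k j))"
  and corep_star_mult: "unitary_corep tn \<Delta> n u \<Longrightarrow> i < n \<Longrightarrow> j < n \<Longrightarrow> (\<Sum>k<n. (u k i)\<^sup>\<star> * u k j) = (if i = j then 1 else 0)"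
  and corep_mult_star: "unitary_corep tn \<Delta> n u \<Longrightarrow> i < n \<Longrightarrow> j < n \<Longrightarrow> (\<Sum>k<n. u i k * (u j k)\<^sup>\<star>) = (if i = j then 1 else 0)"
  by (auto simp: unitary_corep_def)

text \<open>This discharges the \<open>THE\<close> in \<open>alg_lift\<close>: two decompositions of
  one element of the completed square agree under every balanced map, by injectivity for
  \<open>\<iota> = id\<close> and the state \<open>h\<close> itself.\<close>

lemma alg_lift_eq:
  assumes "set zs \<subseteq> H \<times> H" "balanced H B"
  shows "alg_lift H tn B (\<Sum>(x, y)\<leftarrow>zs. tn x y) = (\<Sum>(x, y)\<leftarrow>zs. B x y)"
  unfolding alg_lift_def
proof (rule the_equality)
  show "\<exists>ws. set ws \<subseteq> H \<times> H \<and> (\<Sum>(x, y)\<leftarrow>zs. tn x y) = (\<Sum>(x, y)\<leftarrow>ws. tn x y) \<and>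
    (\<Sum>(x, y)\<leftarrow>zs. B x y) = (\<Sum>(x, y)\<leftarrow>ws. B x y)"
    using assms(1) by blast
next
  fix z assume "\<exists>ws. set ws \<subseteq> H \<times> H \<and> (\<Sum>(x, y)\<leftarrow>zs. tn x y) = (\<Sum>(x, y)\<leftarrow>ws. tn x y) \<and>
    z = (\<Sum>(x, y)\<leftarrow>ws. B x y)"
  then obtain ws where ws: "set ws \<subseteq> H \<times> H" "(\<Sum>(x, y)\<leftarrow>zs. tn x y) = (\<Sum>(x, y)\<leftarrow>ws. tn x y)"
    "z = (\<Sum>(x, y)\<leftarrow>ws. B x y)" by blast
  show "z = (\<Sum>(x, y)\<leftarrow>zs. B x y)"
    unfolding ws(3)
    by (rule tensor_eq_imp_balanced_eq[OF subspace_H ws(1) assms tn _ state, where \<iota> = id])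
       (simp_all add: ws(2) clinear_on_def)
qed

lemma alg_lift_sum:
  fixes n :: nat
  assumes "\<And>k. k < n \<Longrightarrow> x k \<in> H" "\<And>k. k < n \<Longrightarrow> y k \<in> H" and B: "balanced H B"
  shows "alg_lift H tn B (\<Sum>k<n. tn (x k) (y k)) = (\<Sum>k<n. B (x k) (y k))"
proof -
  have "alg_lift H tn B (\<Sum>(x, y)\<leftarrow>map (\<lambda>k. (x k, y k)) [0..<n]. tn x y) =
      (\<Sum>(x, y)\<leftarrow>map (\<lambda>k. (x k, y k)) [0..<n]. B x y)"
    by (rule alg_lift_eq[OF _ B]) (use assms in auto)
  then show ?thesis
    by (simp add: comp_def sum_list_upt_eq_sum)
qed

lemma alg_lift_corep:
  assumes u: "unitary_corep tn \<Delta> n u" "i < n" "j < n" and B: "balanced H B"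
  shows "alg_lift H tn B (\<Delta> (u i j)) = (\<Sum>k<n. B (u i k) (u k j))"
  unfolding corep_coproduct[OF u]
  by (rule alg_lift_sum[OF _ _ B]) (use u coefficient_in_H[OF u(1)] in auto)

lemma coproduct_in_tensor_square:
  assumes "x \<in> H"
  obtains zs where "set zs \<subseteq> H \<times> H" "\<Delta> x = (\<Sum>(x, y)\<leftarrow>zs. tn x y)"
proof -
  have "\<exists>zs. set zs \<subseteq> H \<times> H \<and> \<Delta> x = (\<Sum>(x, y)\<leftarrow>zs. tn x y)"
    using assms
  proof (induction rule: H_induct)
    case zero
    show ?case by (rule exI[of _ "[]"]) simp
  next
    case (step c n u i j y)
    then obtain zs where zs: "set zs \<subseteq> H \<times> H" "\<Delta> y = (\<Sum>(x, y)\<leftarrow>zs. tn x y)" by blast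
    let ?ws = "map (\<lambda>k. (c *\<^sub>C u i k, u k j)) [0..<n]"
    have "(\<Sum>(x, y)\<leftarrow>?ws. tn x y) = c *\<^sub>C \<Delta> (u i j)"
      using step by (simp add: corep_coproduct comp_def sum_list_upt_eq_sum tn_scaleC_left cplx.scale_sum_right)
    then have "\<Delta> (c *\<^sub>C u i j + y) = (\<Sum>(x, y)\<leftarrow>?ws @ zs. tn x y)"
      using zs by (simp add: \<Delta>_add \<Delta>_scaleC)
    moreover have "set (?ws @ zs) \<subseteq> H \<times> H"
      using zs step coefficient_in_H[OF step(1)] by (auto intro: H_scaleC)
    ultimately show ?case by blast
  qed
  then show thesis using that by blast
qed

lemma alg_lift_linear:
  assumes B: "balanced H B" "\<And>c x y. x \<in> H \<Longrightarrow> y \<in> H \<Longrightarrow> B (c *\<^sub>C x) y = c *\<^sub>C B x y"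
    and "x \<in> H" "y \<in> H"
  shows "alg_lift H tn B (\<Delta> (c *\<^sub>C x + y)) = c *\<^sub>C alg_lift H tn B (\<Delta> x) + alg_lift H tn B (\<Delta> y)"
proof -
  obtain zs where zs: "set zs \<subseteq> H \<times> H" "\<Delta> x = (\<Sum>(x, y)\<leftarrow>zs. tn x y)"
    using coproduct_in_tensor_square[OF \<open>x \<in> H\<close>] by blast
  obtain ws where ws: "set ws \<subseteq> H \<times> H" "\<Delta> y = (\<Sum>(x, y)\<leftarrow>ws. tn x y)"
    using coproduct_in_tensor_square[OF \<open>y \<in> H\<close>] by blast
  let ?zs = "map (\<lambda>(x, y). (c *\<^sub>C x, y)) zs"
  have sc: "(\<Sum>(x, y)\<leftarrow>?zs. C x y) = c *\<^sub>C (\<Sum>(x, y)\<leftarrow>zs. C x y)"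
    if "\<And>c x y. x \<in> H \<Longrightarrow> y \<in> H \<Longrightarrow> C (c *\<^sub>C x) y = c *\<^sub>C C x y" for C :: "'a \<Rightarrow> 'a \<Rightarrow> 'v::cstar_algebra"
    using zs(1) that by (induction zs) (auto simp: scaleC_add_right)
  have "\<Delta> (c *\<^sub>C x + y) = (\<Sum>(x, y)\<leftarrow>?zs @ ws. tn x y)"
    by (simp only: map_append sum_list_append sc[OF tn_scaleC_left] \<Delta>_add \<Delta>_scaleC zs(2) ws(2))
  moreover have "alg_lift H tn B (\<Sum>(x, y)\<leftarrow>?zs @ ws. tn x y) = (\<Sum>(x, y)\<leftarrow>?zs @ ws. B x y)"
    by (rule alg_lift_eq[OF _ B(1)]) (use zs ws in \<open>auto intro: H_scaleC\<close>)
  moreover have "(\<Sum>(x, y)\<leftarrow>?zs. B x y) = c *\<^sub>C (\<Sum>(x, y)\<leftarrow>zs. B x y)"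
    by (rule sc) (rule B(2))
  ultimately show ?thesis
    using alg_lift_eq[OF zs(1) B(1)] alg_lift_eq[OF ws(1) B(1)] zs(2) ws(2)
    by (simp only: map_append sum_list_append)
qed

lemma balanced_right:
  assumes "clinear_on H M" shows "balanced H (\<lambda>x y. tn x (M y))"
  using assms by (auto simp: balanced_def clinear_on_def tn_add_left tn_add_right tn_scaleC_left tn_scaleC_right)

text \<open>Both sides are linear in the argument and the coefficients span, so the abstract lift
  can be traded for explicit finite sums, the form in which most later arguments use
  invariance.\<close>

lemma translation_invariant_iff:
  assumes M: "clinear_on H M"
  shows "translation_invariant tn \<Delta> M \<longleftrightarrow>
    (\<forall>n u i j. unitary_corep tn \<Delta> n u \<longrightarrow> i < n \<longrightarrow> j < n \<longrightarrow> \<Delta> (M (u i j)) = (\<Sum>k<n. tn (u i k) (M (u k j))))"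
    (is "_ \<longleftrightarrow> ?R")
proof
  assume "translation_invariant tn \<Delta> M"
  then show ?R
    unfolding translation_invariant_def
    using coefficient_in_H alg_lift_corep[OF _ _ _ balanced_right[OF M]] by simp
next
  assume R: ?R
  show "translation_invariant tn \<Delta> M"
    unfolding translation_invariant_def
  proof
    fix a assume "a \<in> H"
    then show "\<Delta> (M a) = alg_lift H tn (\<lambda>x y. tn x (M y)) (\<Delta> a)"
    proof (induction rule: H_induct)
      case zero
      have "M 0 = 0"
        using M H_zero unfolding clinear_on_def by (metis cplx.scale_zero_left)
      then show ?case using alg_lift_eq[OF _ balanced_right[OF M], of "[]"] by simp
    next
      case (step c n u i j y)
      have uH: "u i j \<in> H" by (rule coefficient_in_H[OF step(1,2,3)])
      have "\<Delta> (M (c *\<^sub>C u i j + y)) = c *\<^sub>C \<Delta> (M (u i j)) + \<Delta> (M y)"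
        using M uH step(4) by (simp add: clinear_on_def H_scaleC \<Delta>_add \<Delta>_scaleC)
      also have "\<dots> = alg_lift H tn (\<lambda>x y. tn x (M y)) (\<Delta> (c *\<^sub>C u i j + y))"
        using R step alg_lift_linear[OF balanced_right[OF M] _ uH step(4), of c]
          alg_lift_corep[OF step(1,2,3) balanced_right[OF M]] by (simp add: tn_scaleC_left)
      finally show ?case .
    qed
  qed
qed

section \<open>The counit\<close>

text \<open>Here \<open>zs\<close> stands for \<open>(id \<otimes> S)(\<Delta> x)\<close> with \<open>S\<close> the antipode, and \<open>e\<close> for the value of the
  counit at \<open>x\<close>. By strong invariance of the Haar state the slices of \<open>zs\<close> are determined by \<open>x\<close>,
  hence so is \<open>e\<close>; this gives a counit without knowing that coefficients are linearly independent.\<close>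

definition counit_rel :: "'a \<Rightarrow> complex \<Rightarrow> bool"
  where "counit_rel x e \<longleftrightarrow> (\<exists>zs. (\<forall>b. F (\<Delta> b * tn x 1) = (\<Sum>(q, p)\<leftarrow>zs. h (b * q) *\<^sub>C p)) \<and>
    (\<Sum>(q, p)\<leftarrow>zs. q * p) = e *\<^sub>C 1)"

text \<open>The antipode sends \<open>u k j\<close> to \<open>(u j k)\<^sup>\<star>\<close>, which
  dictates the list. Unitarity writes \<open>tn (u i j) 1\<close> as the sum over \<open>k\<close>
  of \<open>\<Delta> (u i k) * tn 1 ((u j k)\<^sup>\<star>)\<close>, and invariance of
  \<open>h\<close> evaluates \<open>F\<close> on \<open>\<Delta> (b * u i k)\<close>.\<close>

lemma counit_rel_corep:
  assumes u: "unitary_corep tn \<Delta> n u" "i < n" "j < n"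
  shows "counit_rel (u i j) (if i = j then 1 else 0)"
proof -
  let ?zs = "map (\<lambda>k. (u i k, (u j k)\<^sup>\<star>)) [0..<n]"
  have "F (\<Delta> b * tn (u i j) 1) = (\<Sum>(q, p)\<leftarrow>?zs. h (b * q) *\<^sub>C p)" for b
  proof -
    have "(\<Sum>(q, p)\<leftarrow>?zs. h (b * q) *\<^sub>C p) = (\<Sum>k<n. F (\<Delta> (b * u i k)) * (u j k)\<^sup>\<star>)"
      by (simp add: comp_def sum_list_upt_eq_sum F_\<Delta> mult_scaleC_left)
    also have "\<dots> = F (\<Delta> b * (\<Sum>k<n. \<Delta> (u i k) * tn 1 ((u j k)\<^sup>\<star>)))"
      by (simp add: sum_distrib_left F_sum \<Delta>_mult F_mult flip: mult.assoc)
    also have "(\<Sum>k<n. \<Delta> (u i k) * tn 1 ((u j k)\<^sup>\<star>)) = (\<Sum>k<n. \<Sum>l<n. tn (u i l) (u l k * (u j k)\<^sup>\<star>))"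
      using u by (simp add: corep_coproduct sum_distrib_right tn_mult)
    also have "\<dots> = (\<Sum>l<n. tn (u i l) (\<Sum>k<n. u l k * (u j k)\<^sup>\<star>))"
      by (subst sum.swap) (simp add: tn_sum_right)
    also have "\<dots> = (\<Sum>l<n. if l = j then tn (u i j) 1 else 0)"
      using u by (intro sum.cong) (auto simp: corep_mult_star)
    also have "\<dots> = tn (u i j) 1" using u by simp
    finally show ?thesis ..
  qed
  moreover have "(\<Sum>(q, p)\<leftarrow>?zs. q * p) = (if i = j then 1 else 0) *\<^sub>C 1"
    using u by (simp add: comp_def sum_list_upt_eq_sum corep_mult_star scaleC_one)
  ultimately show ?thesis unfolding counit_rel_def by blast
qed

lemma counit_rel_linear:
  assumes "counit_rel x e" "counit_rel y f"
  shows "counit_rel (c *\<^sub>C x + y) (c * e + f)"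
proof -
  obtain zs where zs: "\<And>b. F (\<Delta> b * tn x 1) = (\<Sum>(q, p)\<leftarrow>zs. h (b * q) *\<^sub>C p)"
    "(\<Sum>(q, p)\<leftarrow>zs. q * p) = e *\<^sub>C 1"
    using assms(1) unfolding counit_rel_def by blast
  obtain ws where ws: "\<And>b. F (\<Delta> b * tn y 1) = (\<Sum>(q, p)\<leftarrow>ws. h (b * q) *\<^sub>C p)"
    "(\<Sum>(q, p)\<leftarrow>ws. q * p) = f *\<^sub>C 1"
    using assms(2) unfolding counit_rel_def by blast
  let ?zs = "map (\<lambda>(q, p). (q, c *\<^sub>C p)) zs"
  have sc: "(\<Sum>(q, p)\<leftarrow>?zs. B q p) = c *\<^sub>C (\<Sum>(q, p)\<leftarrow>zs. B q p)"
    if "\<And>q p. B q (c *\<^sub>C p) = c *\<^sub>C B q p" for B :: "'a \<Rightarrow> 'a \<Rightarrow> 'a"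
    using that by (induction zs) (auto simp: scaleC_add_right)
  show ?thesis
    unfolding counit_rel_def
  proof (intro exI[of _ "?zs @ ws"] conjI allI)
    fix b
    have "(\<Sum>(q, p)\<leftarrow>?zs. h (b * q) *\<^sub>C p) = c *\<^sub>C (\<Sum>(q, p)\<leftarrow>zs. h (b * q) *\<^sub>C p)"
      by (rule sc) (simp add: scaleC_scaleC mult.commute)
    then show "F (\<Delta> b * tn (c *\<^sub>C x + y) 1) = (\<Sum>(q, p)\<leftarrow>?zs @ ws. h (b * q) *\<^sub>C p)"
      using zs(1)[of b] ws(1)[of b]
      by (simp add: tn_add_left tn_scaleC_left distrib_left F_add mult_scaleC_right F_scaleC del: map_map)
  next
    have "(\<Sum>(q, p)\<leftarrow>?zs. q * p) = c *\<^sub>C (\<Sum>(q, p)\<leftarrow>zs. q * p)"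
      by (rule sc) (simp add: mult_scaleC_right)
    then show "(\<Sum>(q, p)\<leftarrow>?zs @ ws. q * p) = (c * e + f) *\<^sub>C 1"
      using zs(2) ws(2) by (simp add: scaleC_add_left scaleC_scaleC del: map_map)
  qed
qed

text \<open>For \<open>x = 0\<close> all slices of the list vanish, so every balanced map kills it,
  in particular multiplication, whose value is \<open>e *\<^sub>C 1\<close>.\<close>

lemma counit_rel_zero:
  assumes "counit_rel 0 e" shows "e = 0"
proof -
  obtain zs where zs: "\<And>b. F (\<Delta> b * tn 0 1) = (\<Sum>(q, p)\<leftarrow>zs. h (b * q) *\<^sub>C p)"
    "(\<Sum>(q, p)\<leftarrow>zs. q * p) = e *\<^sub>C 1"
    using assms unfolding counit_rel_def by blast
  have "(\<Sum>(q, p)\<leftarrow>zs. q * p) = 0"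
    by (rule slices_separate[of UNIV])
       (use zs(1) F_scaleC[of 0 0] in \<open>auto simp: balanced_def algebra_simps mult_scaleC_left mult_scaleC_right\<close>)
  then show ?thesis using zs(2) by simp
qed

lemma counit_rel_unique:
  assumes "counit_rel x e" "counit_rel x f" shows "e = f"
proof -
  have "counit_rel ((-1) *\<^sub>C x + x) (-1 * e + f)"
    by (rule counit_rel_linear) fact+
  then have "counit_rel 0 (f - e)" by simp
  then show ?thesis using counit_rel_zero by force
qed

lemma counit_rel_exists: "x \<in> H \<Longrightarrow> \<exists>e. counit_rel x e"
proof (induction rule: H_induct)
  case zero
  show ?case unfolding counit_rel_def
    by (rule exI[of _ 0], rule exI[of _ "[]"]) (use F_scaleC[of 0 0] in simp)
next
  case (step c n u i j y)
  then show ?case using counit_rel_linear counit_rel_corep by blast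
qed

definition counit :: "'a \<Rightarrow> complex"
  where "counit x = (THE e. counit_rel x e)"

lemma counit_eqI: "counit_rel x e \<Longrightarrow> counit x = e"
  unfolding counit_def using counit_rel_unique by blast

lemma counit_rel_counit: "x \<in> H \<Longrightarrow> counit_rel x (counit x)"
  using counit_rel_exists counit_eqI by metis

lemma counit_corep:
  "unitary_corep tn \<Delta> n u \<Longrightarrow> i < n \<Longrightarrow> j < n \<Longrightarrow> counit (u i j) = (if i = j then 1 else 0)"
  by (rule counit_eqI) (rule counit_rel_corep)

lemma counit_linear: "x \<in> H \<Longrightarrow> y \<in> H \<Longrightarrow> counit (c *\<^sub>C x + y) = c * counit x + counit y"
  by (rule counit_eqI) (intro counit_rel_linear counit_rel_counit)

lemma counit_zero: "counit 0 = 0"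
  using counit_linear[of 0 0 1] H_zero by simp

lemma functional_on_counit: "functional_on H counit"
  unfolding functional_on_def
proof (intro conjI ballI allI)
  show "counit (x + y) = counit x + counit y" if "x \<in> H" "y \<in> H" for x y
    using counit_linear[OF that, of 1] by (simp add: scaleC_one)
  show "counit (c *\<^sub>C x) = c * counit x" if "x \<in> H" for c x
    using counit_linear[OF that H_zero, of c] by (simp add: counit_zero)
qed

section \<open>Convolution operators\<close>

lemma functional_balanced:
  assumes "functional_on H \<phi>"
  shows "balanced H (\<lambda>x y. \<phi> y *\<^sub>C x)"
  using assms
  by (auto simp: balanced_def functional_on_def scaleC_add_left scaleC_add_right scaleC_scaleC mult.commute)

lemma conv_op_linear:
  assumes "functional_on H \<phi>" "x \<in> H" "y \<in> H"
  shows "conv_op tn \<Delta> \<phi> (c *\<^sub>C x + y) = c *\<^sub>C conv_op tn \<Delta> \<phi> x + conv_op tn \<Delta> \<phi> y"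
  unfolding conv_op_def
  by (rule alg_lift_linear[OF functional_balanced[OF assms(1)] _ assms(2,3)]) (simp add: scaleC_scaleC mult.commute)

lemma conv_op_corep:
  assumes "functional_on H \<phi>" "unitary_corep tn \<Delta> n u" "i < n" "j < n"
  shows "conv_op tn \<Delta> \<phi> (u i j) = (\<Sum>k<n. \<phi> (u k j) *\<^sub>C u i k)"
  unfolding conv_op_def by (rule alg_lift_corep[OF assms(2-4) functional_balanced[OF assms(1)]])

lemma conv_op_zero: "functional_on H \<phi> \<Longrightarrow> conv_op tn \<Delta> \<phi> 0 = 0"
  using alg_lift_eq[OF _ functional_balanced, of "[]" \<phi>] by (simp add: conv_op_def)

lemma conv_op_counit: "x \<in> H \<Longrightarrow> conv_op tn \<Delta> counit x = x"
proof (induction rule: H_induct)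
  case zero
  show ?case by (rule conv_op_zero) (rule functional_on_counit)
next
  case (step c n u i j y)
  have "conv_op tn \<Delta> counit (u i j) = (\<Sum>k<n. if k = j then u i j else 0)"
    unfolding conv_op_corep[OF functional_on_counit step(1-3)]
    by (rule sum.cong) (use step counit_corep[OF step(1)] in \<open>auto simp: scaleC_one\<close>)
  then have "conv_op tn \<Delta> counit (u i j) = u i j" using step by simp
  then show ?case
    using conv_op_linear[OF functional_on_counit coefficient_in_H[OF step(1-3)] step(4), of c] step
    by simp
qed

subsection \<open>Products and adjoints of coefficients\<close>

lemma H_one: "1 \<in> H"
proof -
  have "unitary_corep tn \<Delta> 1 (\<lambda>i j. 1)"
    by (simp add: unitary_corep_def \<Delta>_one tn_one)
  from coefficient_in_H[OF this, of 0 0] show ?thesis by simp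
qed

text \<open>The pair of indices \<open>a\<close>, \<open>b\<close> is encoded as
  \<open>a * m + b\<close>. As the star reverses products, the \<open>u\<close>-factors meet in the
  middle in the first unitarity relation and the \<open>v\<close>-factors in the second; the middle
  sum collapses first, then the outer one.\<close>

lemma corep_tensor:
  assumes u: "unitary_corep tn \<Delta> n u" and v: "unitary_corep tn \<Delta> m v"
  shows "unitary_corep tn \<Delta> (n * m) (\<lambda>i j. u (i div m) (j div m) * v (i mod m) (j mod m))"
  unfolding unitary_corep_def
proof (intro allI impI conjI)
  fix i j assume ij: "i < n * m" "j < n * m"
  then have m: "0 < m" by (cases m) auto
  have lt: "i div m < n" "j div m < n" "i mod m < m" "j mod m < m"
    using ij m by (auto simp: less_mult_imp_div_less)
  have eq: "i = j \<longleftrightarrow> i div m = j div m \<and> i mod m = j mod m"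
    by (metis div_mult_mod_eq)
  have sum2: "(\<Sum>k<n * m. f (k div m) (k mod m)) = (\<Sum>a<n. \<Sum>b<m. f a b)" for f :: "nat \<Rightarrow> nat \<Rightarrow> 'x::comm_monoid_add"
    unfolding sum_mult_product by simp
  show "\<Delta> (u (i div m) (j div m) * v (i mod m) (j mod m)) =
      (\<Sum>k<n * m. tn (u (i div m) (k div m) * v (i mod m) (k mod m)) (u (k div m) (j div m) * v (k mod m) (j mod m)))"
    using lt by (simp add: \<Delta>_mult corep_coproduct[OF u] corep_coproduct[OF v] sum_product tn_mult
      sum2[of "\<lambda>a b. tn (u (i div m) a * v (i mod m) b) (u a (j div m) * v b (j mod m))"])
  have "(\<Sum>k<n * m. (u (k div m) (i div m) * v (k mod m) (i mod m))\<^sup>\<star> * (u (k div m) (j div m) * v (k mod m) (j mod m)))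
      = (\<Sum>a<n. \<Sum>b<m. (v b (i mod m))\<^sup>\<star> * ((u a (i div m))\<^sup>\<star> * u a (j div m)) * v b (j mod m))"
    using sum2[of "\<lambda>a b. (u a (i div m) * v b (i mod m))\<^sup>\<star> * (u a (j div m) * v b (j mod m))"]
    by (simp add: star_mult mult.assoc)
  also have "\<dots> = (\<Sum>b<m. (v b (i mod m))\<^sup>\<star> * (\<Sum>a<n. (u a (i div m))\<^sup>\<star> * u a (j div m)) * v b (j mod m))"
    by (subst sum.swap) (simp add: sum_distrib_left sum_distrib_right)
  also have "\<dots> = (if i = j then 1 else 0)"
    using lt eq by (simp add: corep_star_mult[OF u] corep_star_mult[OF v])
  finally show "(\<Sum>k<n * m. (u (k div m) (i div m) * v (k mod m) (i mod m))\<^sup>\<star> *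
      (u (k div m) (j div m) * v (k mod m) (j mod m))) = (if i = j then 1 else 0)" .
  have "(\<Sum>k<n * m. u (i div m) (k div m) * v (i mod m) (k mod m) * (u (j div m) (k div m) * v (j mod m) (k mod m))\<^sup>\<star>)
      = (\<Sum>a<n. u (i div m) a * (\<Sum>b<m. v (i mod m) b * (v (j mod m) b)\<^sup>\<star>) * (u (j div m) a)\<^sup>\<star>)"
    using sum2[of "\<lambda>a b. u (i div m) a * v (i mod m) b * (u (j div m) a * v (j mod m) b)\<^sup>\<star>"]
    by (simp add: star_mult mult.assoc sum_distrib_left sum_distrib_right)
  also have "\<dots> = (if i = j then 1 else 0)"
    using lt eq by (simp add: corep_mult_star[OF u] corep_mult_star[OF v])
  finally show "(\<Sum>k<n * m. u (i div m) (k div m) * v (i mod m) (k mod m) *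
      (u (j div m) (k div m) * v (j mod m) (k mod m))\<^sup>\<star>) = (if i = j then 1 else 0)" .
qed

lemma H_mult:
  assumes "x \<in> H" "y \<in> H" shows "x * y \<in> H"
  using assms(1)
proof (induction rule: H_induct)
  case zero
  show ?case by (simp add: H_zero)
next
  case (step c n u i j x)
  have "u i j * y \<in> H"
    using assms(2)
  proof (induction rule: H_induct)
    case zero
    show ?case by (simp add: H_zero)
  next
    case (step d m v k l y)
    have "i * m + k < n * m" "j * m + l < n * m"
      using \<open>i < n\<close> \<open>j < n\<close> \<open>k < m\<close> \<open>l < m\<close>
      by (metis (no_types, lifting) add_less_cancel_left add.commute less_le_trans mult_Suc mult_le_mono1 Suc_leI)+
    from coefficient_in_H[OF corep_tensor[OF \<open>unitary_corep tn \<Delta> n u\<close> step(1)] this]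
    have "u i j * v k l \<in> H" using step by simp
    then show ?case
      using step by (simp add: distrib_left mult_scaleC_right H_add H_scaleC)
  qed
  then show ?case
    using step by (simp add: distrib_right mult_scaleC_left H_add H_scaleC)
qed

end

section \<open>Conjugates of unitary corepresentations\<close>

lemma mmul_scalar_matrix_left:
  "i < n \<Longrightarrow> j < n \<Longrightarrow> mmul n (scalar_matrix C) A i j = (\<Sum>k<n. C i k *\<^sub>C A k j)"
  by (simp add: mmul_def scalar_matrix_def mult_scaleC_left)

lemma mmul_scalar_matrix_right:
  "i < n \<Longrightarrow> j < n \<Longrightarrow> mmul n A (scalar_matrix C) i j = (\<Sum>k<n. C k j *\<^sub>C A i k)"
  by (simp add: mmul_def scalar_matrix_def mult_scaleC_right)

context cqg
begin

text \<open>The conjugate \<open>U\<close> of a unitary corepresentation preserves the Gram matrix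
  \<open>P = (id \<otimes> h)(U\<^sup>* U)\<close>, so that conjugating with a factor \<open>C\<close> of \<open>P = C\<^sup>* C\<close> makes \<open>U\<close> isometric;
  the invariant matrix \<open>(id \<otimes> h)(U U\<^sup>*)\<close> provides a right inverse. Both are invertible as \<open>h\<close> is
  faithful.\<close>

lemma conjugate_corep:
  assumes u: "unitary_corep tn \<Delta> n u"
  obtains w E C where "unitary_corep tn \<Delta> n w"
    "\<forall>i<n. \<forall>j<n. (u i j)\<^sup>\<star> = (\<Sum>a<n. \<Sum>b<n. (E i a * C b j) *\<^sub>C w a b)"
proof -
  define U where "U i j = (u i j)\<^sup>\<star>" for i j
  have U_star: "(U i j)\<^sup>\<star> = u i j" for i j by (simp add: U_def star_star)
  have \<Delta>U: "\<Delta> (U i j) = (\<Sum>k<n. tn (U i k) (U k j))" if "i < n" "j < n" for i j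
    unfolding U_def by (simp add: \<Delta>_star corep_coproduct[OF u that] star_sum tn_star)

  have "(\<Sum>k<n. U k i * u k j) = (if i = j then 1 else 0)" if "i < n" "j < n" for i j
    using corep_star_mult[OF u that] by (simp add: U_def)
  then obtain C E :: "nat \<Rightarrow> nat \<Rightarrow> 'a" and C' E' where CE: "C = scalar_matrix C'" "E = scalar_matrix E'"
    and P: "mmul n (adj C) C = (\<lambda>i j. if i < n \<and> j < n then (\<Sum>k<n. h ((U k i)\<^sup>\<star> * U k j)) *\<^sub>C 1 else 0)"
    and inv: "mmul n C E = mone n" "mmul n E C = mone n"
    by (rule gram_Cholesky[of n U u])
  \<comment> \<open>Applying \<open>(h \<otimes> id) \<circ> \<Delta>\<close> to the entries of
    \<open>U\<^sup>* U\<close> and using invariance of \<open>h\<close> gives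
    \<open>U\<^sup>* P U = P\<close>.\<close>
  have P_inv: "mmul n (adj U) (mmul n (mmul n (adj C) C) U) = mmul n (adj C) C"
  proof (intro ext)
    fix i j
    show "mmul n (adj U) (mmul n (mmul n (adj C) C) U) i j = mmul n (adj C) C i j"
    proof (cases "i < n \<and> j < n")
      case True
      have "(\<Sum>k<n. h (u k i * U k j)) *\<^sub>C 1 = (\<Sum>k<n. F (\<Delta> (u k i * U k j)))"
        by (simp add: F_\<Delta> cplx.scale_sum_left)
      also have "\<dots> = (\<Sum>k<n. \<Sum>a<n. \<Sum>b<n. h (u k a * U k b) *\<^sub>C (u a i * U b j))"
        using True by (simp add: \<Delta>_mult corep_coproduct[OF u] \<Delta>U sum_product tn_mult F_sum F_tn)
      also have "\<dots> = (\<Sum>a<n. \<Sum>k<n. \<Sum>b<n. h (u k a * U k b) *\<^sub>C (u a i * U b j))"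
        by (rule sum.swap)
      also have "\<dots> = (\<Sum>a<n. \<Sum>b<n. \<Sum>k<n. h (u k a * U k b) *\<^sub>C (u a i * U b j))"
        by (rule sum.cong[OF refl], rule sum.swap)
      also have "\<dots> = (\<Sum>a<n. u a i * (\<Sum>b<n. (\<Sum>k<n. h (u k a * U k b)) *\<^sub>C 1 * U b j))"
        by (simp add: sum_distrib_left sum_distrib_right mult_scaleC_left mult_scaleC_right cplx.scale_sum_left)
      finally show ?thesis
        unfolding P using True by (simp add: mmul_def adj_def U_star)
    qed (auto simp: mmul_def)
  qed

  have "(\<Sum>k<n. u i k * U j k) = (if i = j then 1 else 0)" if "i < n" "j < n" for i j
    using corep_mult_star[OF u that] by (simp add: U_def)
  then obtain D K :: "nat \<Rightarrow> nat \<Rightarrow> 'a" and D' K'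
    where R: "mmul n (adj D) D = (\<lambda>i j. if i < n \<and> j < n then (\<Sum>k<n. h ((u i k)\<^sup>\<star> * u j k)) *\<^sub>C 1 else 0)"
    and inv': "mmul n D K = mone n" "mmul n K D = mone n"
    by (rule gram_Cholesky[of n "\<lambda>k i. u i k" "\<lambda>k i. U i k"])
  \<comment> \<open>The other slice, applied to the entries of \<open>U U\<^sup>*\<close>, gives
    \<open>U R U\<^sup>* = R\<close> for \<open>R = D\<^sup>* D\<close>.\<close>
  have R_inv: "mmul n U (mmul n (mmul n (adj D) D) (adj U)) = mmul n (adj D) D"
  proof (intro ext)
    fix i j
    show "mmul n U (mmul n (mmul n (adj D) D) (adj U)) i j = mmul n (adj D) D i j"
    proof (cases "i < n \<and> j < n")
      case True
      have "(\<Sum>k<n. h (U i k * u j k)) *\<^sub>C 1 = (\<Sum>k<n. G (\<Delta> (U i k * u j k)))"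
        by (simp add: G_\<Delta> cplx.scale_sum_left)
      also have "\<dots> = (\<Sum>k<n. \<Sum>a<n. \<Sum>b<n. h (U a k * u b k) *\<^sub>C (U i a * u j b))"
        using True by (simp add: \<Delta>_mult corep_coproduct[OF u] \<Delta>U sum_product tn_mult G_sum G_tn)
      also have "\<dots> = (\<Sum>a<n. \<Sum>k<n. \<Sum>b<n. h (U a k * u b k) *\<^sub>C (U i a * u j b))"
        by (rule sum.swap)
      also have "\<dots> = (\<Sum>a<n. \<Sum>b<n. \<Sum>k<n. h (U a k * u b k) *\<^sub>C (U i a * u j b))"
        by (rule sum.cong[OF refl], rule sum.swap)
      also have "\<dots> = (\<Sum>a<n. U i a * (\<Sum>b<n. (\<Sum>k<n. h (U a k * u b k)) *\<^sub>C 1 * u j b))"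
        by (simp add: sum_distrib_left sum_distrib_right mult_scaleC_left mult_scaleC_right cplx.scale_sum_left)
      finally show ?thesis
        unfolding R using True by (simp add: mmul_def adj_def U_star flip: U_def)
    qed (auto simp: mmul_def)
  qed

  have adj_inv: "mmul n (adj E) (adj C) = mone n" "mmul n (adj D) (adj K) = mone n"
    using inv inv' by (metis adj_mmul adj_mone)+
  note one = mmul_one_mmul
  \<comment> \<open>Over a noncommutative algebra a one-sided inverse of \<open>U\<close> need not
    be two-sided, so both invariant matrices are used. Since \<open>K K\<^sup>*\<close> inverts
    \<open>R\<close>, the relation for \<open>R\<close> makes \<open>X\<close> a right inverse;
    since \<open>E E\<^sup>*\<close> inverts \<open>P\<close>, the relation for \<open>P\<close>
    makes \<open>Y\<close> below a left inverse. Hence they coincide.\<close>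
  define X where "X = mmul n (mmul n (mmul n (adj D) D) (adj U)) (mmul n K (adj K))"
  have "mmul n U X = mmul n (mmul n (adj D) D) (mmul n K (adj K))"
    unfolding X_def mmul_assoc[symmetric] using R_inv by (simp only: mmul_assoc)
  also have "\<dots> = mmul n (adj D) (mmul n (mmul n D K) (adj K))"
    by (simp only: mmul_assoc)
  also have "\<dots> = mone n"
    by (simp only: inv' one adj_inv)
  finally have UX: "mmul n U X = mone n" .
  define Y where "Y = mmul n (mmul n E (adj E)) (mmul n (adj U) (mmul n (adj C) C))"
  have "mmul n Y U = mmul n (mmul n E (adj E)) (mmul n (adj C) C)"
    unfolding Y_def using P_inv by (simp only: mmul_assoc)
  also have "\<dots> = mmul n E (mmul n (mmul n (adj E) (adj C)) C)"
    by (simp only: mmul_assoc)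
  also have "\<dots> = mone n"
    by (simp only: adj_inv one inv)
  finally have YU: "mmul n Y U = mone n" .
  have "mmul n Y (mmul n U X) = mmul n (mmul n Y U) X"
    by (simp only: mmul_assoc)
  then have "Y = X"
    unfolding UX YU unfolding X_def Y_def by (simp only: one)
  with UX have UY: "mmul n U Y = mone n" by simp

  \<comment> \<open>\<open>E\<close> inverts \<open>C\<close>, so this conjugates \<open>U\<close>
    by \<open>C\<close>. Invariance of \<open>P = C\<^sup>* C\<close> makes \<open>w\<close>
    isometric, and the right inverse \<open>Y\<close> of \<open>U\<close> gives the other unitarity
    relation.\<close>
  define w where "w = mmul n C (mmul n U E)"
  have "mmul n (adj w) w = mmul n (adj E) (mmul n (mmul n (adj U) (mmul n (mmul n (adj C) C) U)) E)"
    unfolding w_def adj_mmul by (simp only: mmul_assoc)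
  also have "\<dots> = mmul n (mmul n (adj E) (adj C)) (mmul n C E)"
    unfolding P_inv by (simp only: mmul_assoc)
  also have "\<dots> = mone n"
    by (simp only: adj_inv inv) (auto simp: mmul_one_left mone_def fun_eq_iff)
  finally have ww1: "mmul n (adj w) w = mone n" .
  have "mmul n w (adj w) = mmul n C (mmul n U (mmul n (mmul n E (adj E)) (mmul n (adj U) (mmul n (adj C) (mone n)))))"
    unfolding w_def adj_mmul by (simp only: mmul_assoc) (simp only: one mmul_assoc[symmetric])
  also have "\<dots> = mmul n C (mmul n (mmul n U Y) E)"
    unfolding Y_def inv(1)[symmetric] by (simp only: mmul_assoc)
  also have "\<dots> = mone n"
    by (simp only: UY one inv)
  finally have ww2: "mmul n w (adj w) = mone n" .

  \<comment> \<open>The matrix product with \<open>tn\<close> in place of multiplication. Scalar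
    matrices slide across it, so the inner \<open>E\<close> and \<open>C\<close> cancel and
    \<open>w\<close> inherits the coproduct formula of \<open>U\<close>.\<close>
  define tm where "tm A B i j = (\<Sum>k<n. tn (A i k) (B k j))" for A B :: "nat \<Rightarrow> nat \<Rightarrow> 'a" and i j
  have tm_scalar: "tm (mmul n A (scalar_matrix S)) B i j = tm A (mmul n (scalar_matrix S) B) i j"
    if "i < n" "j < n" for A B i j S
  proof -
    have "tm (mmul n A (scalar_matrix S)) B i j = (\<Sum>k<n. \<Sum>l<n. S l k *\<^sub>C tn (A i l) (B k j))"
      unfolding tm_def using that by (simp add: mmul_scalar_matrix_right tn_sum_left tn_scaleC_left)
    also have "\<dots> = (\<Sum>l<n. \<Sum>k<n. S l k *\<^sub>C tn (A i l) (B k j))"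
      by (rule sum.swap)
    also have "\<dots> = tm A (mmul n (scalar_matrix S) B) i j"
      unfolding tm_def using that by (simp add: mmul_scalar_matrix_left tn_sum_right tn_scaleC_right)
    finally show ?thesis .
  qed
  have \<Delta>w: "\<Delta> (w i j) = (\<Sum>k<n. tn (w i k) (w k j))" if ij: "i < n" "j < n" for i j
  proof -
    have w_expand: "w i j = (\<Sum>a<n. \<Sum>b<n. (C' i a * E' b j) *\<^sub>C U a b)"
      unfolding w_def CE using ij
      by (simp add: mmul_scalar_matrix_left mmul_scalar_matrix_right cplx.scale_sum_right scaleC_scaleC)
    have "(\<Sum>k<n. tn (w i k) (w k j)) = tm (mmul n (mmul n C U) E) (mmul n C (mmul n U E)) i j"
      unfolding tm_def w_def by (simp only: mmul_assoc)
    also have "\<dots> = tm (mmul n C U) (mmul n (mmul n E C) (mmul n U E)) i j"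
      unfolding CE(2) tm_scalar[OF ij] by (simp only: mmul_assoc)
    also have "\<dots> = tm (mmul n C U) (mmul n U E) i j"
      unfolding inv(2) by (simp only: one)
    also have "\<dots> = (\<Sum>c<n. \<Sum>b<n. \<Sum>a<n. (C' i a * E' b j) *\<^sub>C tn (U a c) (U c b))"
      unfolding tm_def CE using ij
      by (simp add: mmul_scalar_matrix_left mmul_scalar_matrix_right tn_sum_left tn_sum_right
          tn_scaleC_left tn_scaleC_right scaleC_scaleC cplx.scale_sum_right mult.commute)
    also have "\<dots> = (\<Sum>c<n. \<Sum>a<n. \<Sum>b<n. (C' i a * E' b j) *\<^sub>C tn (U a c) (U c b))"
      by (rule sum.cong[OF refl], rule sum.swap)
    also have "\<dots> = (\<Sum>a<n. \<Sum>c<n. \<Sum>b<n. (C' i a * E' b j) *\<^sub>C tn (U a c) (U c b))"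
      by (rule sum.swap)
    also have "\<dots> = (\<Sum>a<n. \<Sum>b<n. \<Sum>c<n. (C' i a * E' b j) *\<^sub>C tn (U a c) (U c b))"
      by (rule sum.cong[OF refl], rule sum.swap)
    also have "\<dots> = \<Delta> (w i j)"
      unfolding w_expand by (simp add: \<Delta>_sum \<Delta>_scaleC \<Delta>U cplx.scale_sum_right)
    finally show ?thesis ..
  qed
  have "unitary_corep tn \<Delta> n w"
    unfolding unitary_corep_def
  proof (intro allI impI conjI)
    fix i j assume ij: "i < n" "j < n"
    show "\<Delta> (w i j) = (\<Sum>k<n. tn (w i k) (w k j))" by (rule \<Delta>w[OF ij])
    show "(\<Sum>k<n. (w k i)\<^sup>\<star> * w k j) = (if i = j then 1 else 0)"
      using fun_cong[OF fun_cong[OF ww1, of i], of j] ij by (simp add: mmul_def adj_def mone_def)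
    show "(\<Sum>k<n. w i k * (w j k)\<^sup>\<star>) = (if i = j then 1 else 0)"
      using fun_cong[OF fun_cong[OF ww2, of i], of j] ij by (simp add: mmul_def adj_def mone_def)
  qed
  moreover have "(u i j)\<^sup>\<star> = (\<Sum>a<n. \<Sum>b<n. (E' i a * C' b j) *\<^sub>C w a b)" if ij: "i < n" "j < n" for i j
  proof -
    have "mmul n E (mmul n w C) = mmul n (mmul n E C) (mmul n U (mmul n E C))"
      unfolding w_def by (simp only: mmul_assoc)
    then have "mmul n E (mmul n w C) i j = U i j"
      unfolding inv using ij by (simp add: mmul_one_left mmul_one_right)
    then show ?thesis
      unfolding CE U_def using ij
      by (simp add: mmul_scalar_matrix_left mmul_scalar_matrix_right cplx.scale_sum_right scaleC_scaleC)
  qed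
  ultimately show thesis using that by blast
qed

lemma H_star: "x \<in> H \<Longrightarrow> x\<^sup>\<star> \<in> H"
proof (induction rule: H_induct)
  case zero
  show ?case by (simp add: H_zero)
next
  case (step c n u i j y)
  obtain w E C where w: "unitary_corep tn \<Delta> n w"
    and eq: "\<forall>i<n. \<forall>j<n. (u i j)\<^sup>\<star> = (\<Sum>a<n. \<Sum>b<n. (E i a * C b j) *\<^sub>C w a b)"
    by (rule conjugate_corep[OF step(1)])
  have "(u i j)\<^sup>\<star> \<in> H"
    unfolding eq[rule_format, OF step(2,3)] by (intro H_sum H_scaleC coefficient_in_H[OF w]) auto
  then show ?case
    using step(5) by (simp add: star_add star_scaleC H_add H_scaleC)
qed

end

lemma bounded_linear_scaleC_left: "bounded_linear (\<lambda>c. c *\<^sub>C (x::'a::cstar_algebra))"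
proof (rule bounded_linear_intro[where K = "norm x"])
  show "(r *\<^sub>R c) *\<^sub>C x = r *\<^sub>R (c *\<^sub>C x)" for r c
    by (metis scaleC_of_real scaleC_scaleC scaleR_conv_of_real)
qed (simp_all add: scaleC_add_left norm_scaleC)

lemma scaleC_scaleR: "c *\<^sub>C (r *\<^sub>R x) = r *\<^sub>R (c *\<^sub>C (x::'a::cstar_algebra))"
  by (metis mult.commute scaleC_of_real scaleC_scaleC)

section \<open>Translation invariant operators\<close>

text \<open>Only nonnegative times are available, so the limit is one-sided. Convergence at
  \<open>t = 1\<close> bounds all \<open>b n\<close> by one \<open>K\<close>. After
  \<open>b 0 = 0\<close> and division by \<open>t\<close>, the element \<open>- b 1\<close> is the
  remaining tail, which is of order \<open>t\<close>.\<close>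

lemma exponential_series_zero_coefficient:
  fixes a :: "nat \<Rightarrow> 'b::banach"
  assumes zero: "\<And>t. 0 \<le> t \<Longrightarrow> (\<lambda>n. (t ^ n / fact n) *\<^sub>R a n) sums 0"
  shows "a 1 = 0"
proof -
  define b where "b n = (1 / fact n) *\<^sub>R a n" for n
  have b: "(\<lambda>n. t ^ n *\<^sub>R b n) sums 0" if "0 \<le> t" for t
    using zero[OF that] by (simp add: b_def)
  have "(\<lambda>n. 0 ^ n *\<^sub>R b n) sums (\<Sum>n\<in>{0}. 0 ^ n *\<^sub>R b n)"
    by (rule sums_finite) auto
  then have b0: "b 0 = 0"
    using sums_unique2[OF b[of 0]] by simp
  have "summable (\<lambda>n. b n)"
    using sums_summable[OF b[of 1]] by simp
  then obtain K where K: "\<And>n. norm (b n) \<le> K"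
    using summable_imp_Bseq unfolding Bseq_def by blast
  \<comment> \<open>For \<open>t\<close> up to 1/2 the geometric factor \<open>1 / (1 - t)\<close>
    is at most 2.\<close>
  have le: "norm (b 1) \<le> 2 * K * t" if t: "0 < t" "t \<le> 1/2" for t
  proof -
    have "(\<lambda>n. t ^ Suc n *\<^sub>R b (Suc n)) sums 0"
      using b[of t] t sums_Suc_iff[of "\<lambda>n. t ^ n *\<^sub>R b n" 0] by (simp add: b0)
    then have "(\<lambda>n. inverse t *\<^sub>R (t ^ Suc n *\<^sub>R b (Suc n))) sums (inverse t *\<^sub>R 0)"
      by (rule bounded_linear.sums[OF bounded_linear_scaleR_right])
    then have s: "(\<lambda>n. t ^ n *\<^sub>R b (Suc n)) sums 0"
      using t by (simp flip: mult.assoc)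
    then have 1: "(\<lambda>n. t ^ Suc n *\<^sub>R b (Suc (Suc n))) sums (- b 1)"
      using sums_Suc_iff[of "\<lambda>n. t ^ n *\<^sub>R b (Suc n)" "- b 1"] by simp
    have 2: "(\<lambda>n. K * t * t ^ n) sums (K * t * (1 / (1 - t)))"
      by (intro sums_mult geometric_sums) (use t in auto)
    have 3: "norm (t ^ Suc n *\<^sub>R b (Suc (Suc n))) \<le> K * t * t ^ n" for n
      using mult_right_mono[OF K[of "Suc (Suc n)"], of "t ^ Suc n"] t by (simp add: mult_ac)
    have "norm (- b 1) \<le> K * t * (1 / (1 - t))"
      unfolding sums_unique[OF 1] sums_unique[OF 2]
      by (rule norm_suminf_le[OF 3 sums_summable[OF 2]])
    also have "\<dots> \<le> K * t * 2"
    proof (rule mult_left_mono)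
      show "1 / (1 - t) \<le> 2" using t by (simp add: field_simps)
      show "0 \<le> K * t" using t order_trans[OF norm_ge_zero K[of 0]] by simp
    qed
    finally show ?thesis by (simp add: mult_ac)
  qed
  have "((\<lambda>t. 2 * K * t) \<longlongrightarrow> 2 * K * 0) (at_right 0)"
    by (intro tendsto_intros)
  moreover have "\<forall>\<^sub>F t in at_right (0::real). norm (b 1) \<le> 2 * K * t"
    by (rule eventually_at_rightI[of 0 "1/2"]) (use le in auto)
  ultimately have "norm (b 1) \<le> 2 * K * 0"
    by (rule tendsto_lowerbound) simp
  then show ?thesis by (simp add: b_def)
qed

context cqg
begin

lemma clinear_on_coefficients:
  assumes M: "clinear_on H M" and u: "unitary_corep tn \<Delta> n u" "i < n"
  shows "M (\<Sum>k<n. c k *\<^sub>C u i k) = (\<Sum>k<n. c k *\<^sub>C M (u i k))"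
proof -
  have "M (\<Sum>k<n. c k *\<^sub>C u i k) = (\<Sum>k<n. M (c k *\<^sub>C u i k))"
    by (rule clinear_on_sum[OF M subspace_H]) (use coefficient_in_H[OF u] H_scaleC in auto)
  also have "\<dots> = (\<Sum>k<n. c k *\<^sub>C M (u i k))"
    using M coefficient_in_H[OF u] by (auto simp: clinear_on_def)
  finally show ?thesis .
qed

lemma clinear_on_H_eqI:
  assumes M: "clinear_on H M" and N: "clinear_on H N"
    and eq: "\<And>n u i j. unitary_corep tn \<Delta> n u \<Longrightarrow> i < n \<Longrightarrow> j < n \<Longrightarrow> M (u i j) = N (u i j)"
    and x: "x \<in> H"
  shows "M x = N x"
  using x
proof (induction rule: H_induct)
  case zero
  show ?case
    using M N H_zero unfolding clinear_on_def by (metis cplx.scale_zero_left)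
next
  case (step c n u i j y)
  then show ?case
    using M N eq[OF step(1-3)] coefficient_in_H[OF step(1-3)] H_scaleC
    by (simp add: clinear_on_def)
qed

lemma coproduct_coefficient_combination:
  assumes u: "unitary_corep tn \<Delta> n u" "i < n"
  shows "\<Delta> (\<Sum>k<n. c k *\<^sub>C u i k) = (\<Sum>l<n. tn (u i l) (\<Sum>k<n. c k *\<^sub>C u l k))"
proof -
  have "\<Delta> (\<Sum>k<n. c k *\<^sub>C u i k) = (\<Sum>k<n. \<Sum>l<n. c k *\<^sub>C tn (u i l) (u l k))"
    using u by (simp add: \<Delta>_sum \<Delta>_scaleC corep_coproduct cplx.scale_sum_right)
  also have "\<dots> = (\<Sum>l<n. \<Sum>k<n. c k *\<^sub>C tn (u i l) (u l k))"
    by (rule sum.swap)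
  finally show ?thesis by (simp add: tn_sum_right tn_scaleC_right)
qed

text \<open>In matrix form \<open>M\<close> multiplies \<open>u\<close> by \<open>c\<close> from the
  right, whereas the coproduct inserts a factor \<open>u\<close> on the left, so the two commute.
  The point is that \<open>c n u k j\<close> does not depend on the row \<open>i\<close>.\<close>

lemma translation_invariantI:
  assumes M: "clinear_on H M"
    and eq: "\<And>n u i j. unitary_corep tn \<Delta> n u \<Longrightarrow> i < n \<Longrightarrow> j < n \<Longrightarrow> M (u i j) = (\<Sum>k<n. c n u k j *\<^sub>C u i k)"
  shows "translation_invariant tn \<Delta> M"
  unfolding translation_invariant_iff[OF M]
proof (intro allI impI)
  fix n u i j assume u: "unitary_corep tn \<Delta> n u" "i < n" "j < n"
  show "\<Delta> (M (u i j)) = (\<Sum>k<n. tn (u i k) (M (u k j)))"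
    unfolding eq[OF u] coproduct_coefficient_combination[OF u(1,2)] using u by (simp add: eq)
qed

lemma translation_invariant_coefficients:
  assumes M: "clinear_on H M" "M ` H \<subseteq> H" and ti: "translation_invariant tn \<Delta> M"
    and u: "unitary_corep tn \<Delta> n u" "i < n" "j < n"
  shows "M (u i j) = (\<Sum>k<n. counit (M (u k j)) *\<^sub>C u i k)"
proof -
  have "M (u i j) = conv_op tn \<Delta> counit (M (u i j))"
    using conv_op_counit coefficient_in_H[OF u] M(2) by (metis image_subset_iff)
  also have "\<Delta> (M (u i j)) = (\<Sum>k<n. tn (u i k) (M (u k j)))"
    using ti u unfolding translation_invariant_iff[OF M(1)] by blast
  then have "conv_op tn \<Delta> counit (M (u i j)) = (\<Sum>k<n. counit (M (u k j)) *\<^sub>C u i k)"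
    unfolding conv_op_def
    using alg_lift_sum[of n "\<lambda>k. u i k" "\<lambda>k. M (u k j)", OF _ _ functional_balanced[OF functional_on_counit]]
      coefficient_in_H[OF u(1)] u M(2) by (metis (no_types, lifting) image_subset_iff)
  finally show ?thesis .
qed

lemma clinear_on_conv_op:
  assumes "functional_on H \<phi>" shows "clinear_on H (conv_op tn \<Delta> \<phi>)"
  unfolding clinear_on_def
proof (intro conjI ballI allI)
  show "conv_op tn \<Delta> \<phi> (x + y) = conv_op tn \<Delta> \<phi> x + conv_op tn \<Delta> \<phi> y" if "x \<in> H" "y \<in> H" for x y
    using conv_op_linear[OF assms that, of 1] by (simp add: scaleC_one)
  show "conv_op tn \<Delta> \<phi> (c *\<^sub>C x) = c *\<^sub>C conv_op tn \<Delta> \<phi> x" if "x \<in> H" for c x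
    using conv_op_linear[OF assms that H_zero, of c] by (simp add: conv_op_zero[OF assms])
qed

lemma convolution_iff_translation_invariant:
  assumes L: "clinear_on H L" "L ` H \<subseteq> H"
  shows "(\<exists>\<phi>. functional_on H \<phi> \<and> (\<forall>a\<in>H. L a = conv_op tn \<Delta> \<phi> a)) \<longleftrightarrow> translation_invariant tn \<Delta> L"
proof
  assume "\<exists>\<phi>. functional_on H \<phi> \<and> (\<forall>a\<in>H. L a = conv_op tn \<Delta> \<phi> a)"
  then obtain \<phi> where \<phi>: "functional_on H \<phi>" "\<forall>a\<in>H. L a = conv_op tn \<Delta> \<phi> a" by blast
  show "translation_invariant tn \<Delta> L"
    by (rule translation_invariantI[OF L(1), where c = "\<lambda>n u k j. \<phi> (u k j)"])
       (use \<phi> conv_op_corep coefficient_in_H in simp)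
next
  assume ti: "translation_invariant tn \<Delta> L"
  have fL: "functional_on H (\<lambda>a. counit (L a))"
    using functional_on_counit L unfolding functional_on_def clinear_on_def
    by (simp add: image_subset_iff)
  have "L a = conv_op tn \<Delta> (\<lambda>a. counit (L a)) a" if "a \<in> H" for a
  proof (rule clinear_on_H_eqI[OF L(1) clinear_on_conv_op[OF fL] _ that])
    fix n u i j assume u: "unitary_corep tn \<Delta> n u" "i < n" "j < n"
    show "L (u i j) = conv_op tn \<Delta> (\<lambda>a. counit (L a)) (u i j)"
      unfolding conv_op_corep[OF fL u] by (rule translation_invariant_coefficients[OF L ti u])
  qed
  with fL show "\<exists>\<phi>. functional_on H \<phi> \<and> (\<forall>a\<in>H. L a = conv_op tn \<Delta> \<phi> a)" by blast
qed

section \<open>Powers and exponentials of translation invariant operators\<close>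

lemma funpow_clinear_on:
  assumes L: "clinear_on H L" "L ` H \<subseteq> H"
  shows "clinear_on H (L ^^ m)" "(L ^^ m) ` H \<subseteq> H"
proof -
  have "clinear_on H (L ^^ m) \<and> (L ^^ m) ` H \<subseteq> H"
  proof (induction m)
    case (Suc m)
    then have sub: "x \<in> H \<Longrightarrow> (L ^^ m) x \<in> H" for x by blast
    show ?case
      using Suc L by (auto simp: clinear_on_def sub image_subset_iff)
  qed (auto simp: clinear_on_def)
  then show "clinear_on H (L ^^ m)" "(L ^^ m) ` H \<subseteq> H" by blast+
qed

lemma translation_invariant_funpow:
  assumes L: "clinear_on H L" "L ` H \<subseteq> H" and ti: "translation_invariant tn \<Delta> L"
  shows "translation_invariant tn \<Delta> (L ^^ m)"
  unfolding translation_invariant_iff[OF funpow_clinear_on(1)[OF L]]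
proof (induction m)
  case 0
  show ?case using corep_coproduct by simp
next
  case (Suc m)
  show ?case
  proof (intro allI impI)
    fix n u i j assume u: "unitary_corep tn \<Delta> n u" "i < n" "j < n"
    let ?\<phi> = "\<lambda>k. counit (L (u k j))"
    note M = funpow_clinear_on(1)[OF L, of m]
    \<comment> \<open>Peeling off the innermost \<open>L\<close> leaves the scalars
      \<open>?\<phi> k\<close>, the same for every row, and the induction hypothesis applies to each
      \<open>(L ^^ m) (u i k)\<close>.\<close>
    have eq: "(L ^^ Suc m) (u i j) = (\<Sum>k<n. ?\<phi> k *\<^sub>C (L ^^ m) (u i k))" if "i < n" for i
      using translation_invariant_coefficients[OF L ti u(1) that u(3)]
        clinear_on_coefficients[OF M u(1) that, of ?\<phi>]
      by (simp add: funpow_swap1)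
    have "\<Delta> ((L ^^ Suc m) (u i j)) = (\<Sum>k<n. \<Sum>l<n. ?\<phi> k *\<^sub>C tn (u i l) ((L ^^ m) (u l k)))"
      unfolding eq[OF u(2)] using Suc.IH u by (simp add: \<Delta>_sum \<Delta>_scaleC cplx.scale_sum_right)
    also have "\<dots> = (\<Sum>l<n. \<Sum>k<n. ?\<phi> k *\<^sub>C tn (u i l) ((L ^^ m) (u l k)))"
      by (rule sum.swap)
    also have "\<dots> = (\<Sum>l<n. tn (u i l) ((L ^^ Suc m) (u l j)))"
      by (rule sum.cong) (use eq in \<open>simp_all add: tn_sum_right tn_scaleC_right del: funpow.simps\<close>)
    finally show "\<Delta> ((L ^^ Suc m) (u i j)) = (\<Sum>k<n. tn (u i k) ((L ^^ Suc m) (u k j)))" .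
  qed
qed

text \<open>The defects \<open>a m\<close> of the identity for \<open>L ^^ m\<close> form an
  exponential series that sums to 0 for all \<open>t \<ge> 0\<close>, because
  \<open>\<Delta>'\<close> and each \<open>tn' x\<close> are continuous; the claim is the vanishing
  of its linear coefficient. The map \<open>\<iota>\<close> is general: \<open>id\<close> serves the
  Hopf algebra, the others its completions.\<close>

lemma exponential_first_coefficient:
  fixes tn' :: "'b::cstar_algebra \<Rightarrow> 'b \<Rightarrow> 'c::cstar_algebra"
  assumes \<Delta>': "star_hom_on UNIV \<Delta>'" and tn': "min_tensor tn'"
    and T: "exp_formula H \<iota> L T"
    and u: "unitary_corep tn \<Delta> n u" "i < n" "j < n"
    and inv: "\<And>t. 0 \<le> t \<Longrightarrow> \<Delta>' (T t (\<iota> (u i j))) = (\<Sum>k<n. tn' (\<iota> (u i k)) (T t (\<iota> (u k j))))"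
  shows "\<Delta>' (\<iota> (L (u i j))) = (\<Sum>k<n. tn' (\<iota> (u i k)) (\<iota> (L (u k j))))"
proof -
  define a where "a m = \<Delta>' (\<iota> ((L ^^ m) (u i j))) - (\<Sum>k<n. tn' (\<iota> (u i k)) (\<iota> ((L ^^ m) (u k j))))" for m
  have bl: "bounded_linear \<Delta>'"
    by (intro bounded_clinear_bounded_linear star_hom_bounded_clinear \<Delta>')
  have bl': "bounded_linear (tn' x)" for x
    by (rule min_tensor_bounded_right[OF tn'])
  have "a 1 = 0"
  proof (rule exponential_series_zero_coefficient)
    fix t :: real assume t: "0 \<le> t"
    have T': "(\<lambda>m. (t ^ m / fact m) *\<^sub>R \<iota> ((L ^^ m) (u k j))) sums T t (\<iota> (u k j))" if "k < n" for k
      using T t coefficient_in_H[OF u(1) that u(3)] unfolding exp_formula_def by blast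
    have "(\<lambda>m. (t ^ m / fact m) *\<^sub>R \<Delta>' (\<iota> ((L ^^ m) (u i j))) -
        (\<Sum>k<n. (t ^ m / fact m) *\<^sub>R tn' (\<iota> (u i k)) (\<iota> ((L ^^ m) (u k j)))))
      sums (\<Delta>' (T t (\<iota> (u i j))) - (\<Sum>k<n. tn' (\<iota> (u i k)) (T t (\<iota> (u k j)))))"
    proof (intro sums_diff sums_sum)
      show "(\<lambda>m. (t ^ m / fact m) *\<^sub>R \<Delta>' (\<iota> ((L ^^ m) (u i j)))) sums \<Delta>' (T t (\<iota> (u i j)))"
        using bounded_linear.sums[OF bl T'[OF u(2)]]
        by (simp add: linear_scale[OF bounded_linear.linear[OF bl]])
      show "(\<lambda>m. (t ^ m / fact m) *\<^sub>R tn' (\<iota> (u i k)) (\<iota> ((L ^^ m) (u k j)))) sums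
          tn' (\<iota> (u i k)) (T t (\<iota> (u k j)))" if "k \<in> {..<n}" for k
        using bounded_linear.sums[OF bl' T', of k] that
        by (simp add: linear_scale[OF bounded_linear.linear[OF bl']])
    qed
    then show "(\<lambda>m. (t ^ m / fact m) *\<^sub>R a m) sums 0"
      by (simp add: a_def scaleR_diff_right scaleR_sum_right inv[OF t])
  qed
  then show ?thesis by (simp add: a_def)
qed

lemma counit_coefficients:
  assumes u: "unitary_corep tn \<Delta> n u" "i < n"
    and f: "clinear_on H M" "M ` H \<subseteq> H"
  shows "counit (M (\<Sum>k<n. c k *\<^sub>C u i k)) = (\<Sum>k<n. c k * counit (M (u i k)))"
proof -
  have "counit (\<Sum>k\<in>A. c k *\<^sub>C M (u i k)) = (\<Sum>k\<in>A. c k * counit (M (u i k)))" if "finite A" "A \<subseteq> {..<n}" for A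
    using that
  proof (induction A rule: finite_induct)
    case (insert k A)
    then have "M (u i k) \<in> H" "(\<Sum>k\<in>A. c k *\<^sub>C M (u i k)) \<in> H"
      using f(2) coefficient_in_H[OF u] by (auto intro!: H_sum H_scaleC)
    then show ?case
      using insert counit_linear by simp
  qed (simp add: counit_zero)
  then show ?thesis
    by (simp add: clinear_on_coefficients[OF f(1) u])
qed

text \<open>On a row of coefficients \<open>L\<close> acts by the scalar matrix
  \<open>counit (L (u k j))\<close>, so the series converges within the finite-dimensional span of
  the row and stays in the Hopf algebra; \<open>E t (u k j)\<close> are the entries of the matrix
  exponential.\<close>

lemma exponential_semigroup:
  assumes L: "clinear_on H L" "L ` H \<subseteq> H" and ti: "translation_invariant tn \<Delta> L"
  obtains T where "semigroup_on H T" "exp_formula H id L T" "\<forall>t\<ge>0. translation_invariant tn \<Delta> (T t)"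
proof -
  note pow = funpow_clinear_on[OF L]
  have coeff: "(L ^^ m) (u i j) = (\<Sum>k<n. counit ((L ^^ m) (u k j)) *\<^sub>C u i k)"
    if "unitary_corep tn \<Delta> n u" "i < n" "j < n" for m n u i j
    by (rule translation_invariant_coefficients[OF pow translation_invariant_funpow[OF L ti] that])
  have coeff_add: "counit ((L ^^ (a + b)) (u l j)) = (\<Sum>k<n. counit ((L ^^ b) (u k j)) * counit ((L ^^ a) (u l k)))"
    if u: "unitary_corep tn \<Delta> n u" "l < n" "j < n" for a b n u l j
  proof -
    have "counit ((L ^^ (a + b)) (u l j)) = counit ((L ^^ a) (\<Sum>k<n. counit ((L ^^ b) (u k j)) *\<^sub>C u l k))"
      unfolding funpow_add comp_apply coeff[OF u, of b, symmetric] ..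
    then show ?thesis
      by (simp only: counit_coefficients[OF u(1,2) pow])
  qed
  define e where "e t m x = complex_of_real (t ^ m / fact m) * counit ((L ^^ m) x)" for t :: real and m x
  have e_summable: "summable (\<lambda>m. norm (e t m (u k j)))" if u: "unitary_corep tn \<Delta> n u" "k < n" "j < n" for t n u k j
  proof -
    \<comment> \<open>The sum of the absolute values of all entries dominates every column sum, so
      the entries of the \<open>m\<close>-th matrix power are at most \<open>K ^ m\<close>.\<close>
    define K where "K = (\<Sum>l<n. \<Sum>j<n. cmod (counit (L (u l j))))"
    have K0: "0 \<le> K" unfolding K_def by (intro sum_nonneg) auto
    have bound: "cmod (counit ((L ^^ m) (u k j))) \<le> K ^ m" if "k < n" "j < n" for k j m
      using that
    proof (induction m arbitrary: k j)
      case 0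
      then show ?case using counit_corep[OF u(1)] by simp
    next
      case (Suc m)
      have "cmod (counit ((L ^^ (m + 1)) (u k j))) \<le> (\<Sum>l<n. cmod (counit (L (u l j)) * counit ((L ^^ m) (u k l))))"
        unfolding coeff_add[OF u(1) Suc.prems] by (simp add: norm_sum)
      also have "\<dots> \<le> (\<Sum>l<n. cmod (counit (L (u l j))) * K ^ m)"
        unfolding norm_mult by (intro sum_mono mult_left_mono Suc.IH) (use Suc.prems in auto)
      also have "\<dots> = (\<Sum>l<n. cmod (counit (L (u l j)))) * K ^ m"
        by (simp add: sum_distrib_right)
      also have "\<dots> \<le> K * K ^ m"
      proof (intro mult_right_mono zero_le_power K0)
        show "(\<Sum>l<n. cmod (counit (L (u l j)))) \<le> K"
          unfolding K_def
          by (intro sum_mono member_le_sum[where f = "\<lambda>j. cmod (counit (L (u _ j)))"]) (use Suc.prems in auto)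
      qed
      finally show ?case by simp
    qed
    show ?thesis
    proof (rule summable_comparison_test'[where N = 0])
      show "summable (\<lambda>m. (\<bar>t\<bar> * K) ^ m / fact m)"
        using summable_exp[of "\<bar>t\<bar> * K"] by (simp add: field_simps)
      show "norm (norm (e t m (u k j))) \<le> (\<bar>t\<bar> * K) ^ m / fact m" for m
        using mult_left_mono[OF bound[OF u(2,3), of m], of "\<bar>t\<bar> ^ m / fact m"]
        by (simp add: e_def norm_mult norm_divide norm_power power_mult_distrib)
    qed
  qed
  define E where "E t x = (\<Sum>m. e t m x)" for t x
  have e_sums: "(\<lambda>m. e t m (u k j)) sums E t (u k j)" if "unitary_corep tn \<Delta> n u" "k < n" "j < n" for t n u k j
    unfolding E_def by (rule summable_sums, rule summable_norm_cancel, rule e_summable[OF that])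
  \<comment> \<open>\<open>T\<close> is the norm-convergent series itself: prescribing it on
    coefficients would require compatibility with their linear relations.\<close>
  define T where "T t x = (\<Sum>m. (t ^ m / fact m) *\<^sub>R (L ^^ m) x)" for t x
  have series_corep: "(\<lambda>m. (t ^ m / fact m) *\<^sub>R (L ^^ m) (u i j)) sums (\<Sum>k<n. E t (u k j) *\<^sub>C u i k)"
    if u: "unitary_corep tn \<Delta> n u" "i < n" "j < n" for t n u i j
  proof -
    have "(\<lambda>m. \<Sum>k<n. e t m (u k j) *\<^sub>C u i k) sums (\<Sum>k<n. E t (u k j) *\<^sub>C u i k)"
      by (intro sums_sum bounded_linear.sums[OF bounded_linear_scaleC_left] e_sums[OF u(1) _ u(3)]) simp
    moreover have "(t ^ m / fact m) *\<^sub>R (L ^^ m) (u i j) = (\<Sum>k<n. e t m (u k j) *\<^sub>C u i k)" for m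
      unfolding coeff[OF u, of m] e_def scaleR_sum_right scaleC_scaleC[symmetric] scaleC_of_real ..
    ultimately show ?thesis by presburger
  qed
  have series: "(\<lambda>m. (t ^ m / fact m) *\<^sub>R (L ^^ m) x) sums T t x \<and> T t x \<in> H" if "x \<in> H" for t x
  proof -
    have "\<exists>s\<in>H. (\<lambda>m. (t ^ m / fact m) *\<^sub>R (L ^^ m) x) sums s"
      using that
    proof (induction rule: H_induct)
      case zero
      have "(L ^^ m) 0 = 0" for m
        using pow(1)[of m] H_zero unfolding clinear_on_def by (metis cplx.scale_zero_left)
      then show ?case using H_zero by (auto intro!: bexI[of _ 0])
    next
      case (step c n u i j y)
      then obtain s where s: "s \<in> H" "(\<lambda>m. (t ^ m / fact m) *\<^sub>R (L ^^ m) y) sums s" by blast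
      let ?s = "\<Sum>k<n. E t (u k j) *\<^sub>C u i k"
      have "?s \<in> H"
        by (intro H_sum H_scaleC coefficient_in_H[OF step(1,2)]) simp
      have "(\<lambda>m. c *\<^sub>C ((t ^ m / fact m) *\<^sub>R (L ^^ m) (u i j)) + (t ^ m / fact m) *\<^sub>R (L ^^ m) y) sums (c *\<^sub>C ?s + s)"
        by (intro sums_add bounded_linear.sums[OF bounded_linear_scaleC] series_corep step s)
      moreover have "c *\<^sub>C ((t ^ m / fact m) *\<^sub>R (L ^^ m) (u i j)) + (t ^ m / fact m) *\<^sub>R (L ^^ m) y
          = (t ^ m / fact m) *\<^sub>R (L ^^ m) (c *\<^sub>C u i j + y)" for m
        using pow(1)[of m] coefficient_in_H[OF step(1-3)] step(4)
        by (simp add: clinear_on_def H_scaleC scaleC_scaleR scaleR_add_right)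
      ultimately show ?case
        using \<open>?s \<in> H\<close> s(1) by (auto intro!: bexI[of _ "c *\<^sub>C ?s + s"] H_add H_scaleC)
    qed
    then obtain s where s: "s \<in> H" "(\<lambda>m. (t ^ m / fact m) *\<^sub>R (L ^^ m) x) sums s" by blast
    have "T t x = s"
      unfolding T_def by (rule sums_unique[OF s(2), symmetric])
    with s show ?thesis by simp
  qed
  have T_corep: "T t (u i j) = (\<Sum>k<n. E t (u k j) *\<^sub>C u i k)"
    if "unitary_corep tn \<Delta> n u" "i < n" "j < n" for t n u i j
    unfolding T_def using series_corep[OF that] by (simp add: sums_unique[symmetric])
  have T_H: "T t ` H \<subseteq> H" for t using series by blast
  have T_lin: "clinear_on H (T t)" for t
    unfolding clinear_on_def
  proof (intro conjI ballI allI)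
    show "T t (x + y) = T t x + T t y" if "x \<in> H" "y \<in> H" for x y
    proof (rule sums_unique2)
      show "(\<lambda>m. (t ^ m / fact m) *\<^sub>R (L ^^ m) (x + y)) sums T t (x + y)"
        using series H_add that by blast
      have "(\<lambda>m. (t ^ m / fact m) *\<^sub>R (L ^^ m) x + (t ^ m / fact m) *\<^sub>R (L ^^ m) y) sums (T t x + T t y)"
        using series that by (intro sums_add) blast+
      then show "(\<lambda>m. (t ^ m / fact m) *\<^sub>R (L ^^ m) (x + y)) sums (T t x + T t y)"
        using pow(1) that by (simp add: clinear_on_def scaleR_add_right)
    qed
    show "T t (c *\<^sub>C x) = c *\<^sub>C T t x" if "x \<in> H" for c x
    proof (rule sums_unique2)
      show "(\<lambda>m. (t ^ m / fact m) *\<^sub>R (L ^^ m) (c *\<^sub>C x)) sums T t (c *\<^sub>C x)"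
        using series H_scaleC that by blast
      have "(\<lambda>m. c *\<^sub>C ((t ^ m / fact m) *\<^sub>R (L ^^ m) x)) sums (c *\<^sub>C T t x)"
        using series that by (intro bounded_linear.sums[OF bounded_linear_scaleC]) blast
      then show "(\<lambda>m. (t ^ m / fact m) *\<^sub>R (L ^^ m) (c *\<^sub>C x)) sums (c *\<^sub>C T t x)"
        using pow(1) that by (simp add: clinear_on_def scaleC_scaleR)
    qed
  qed
  have T0: "T 0 x = x" for x
  proof -
    have "(\<lambda>m. (0 ^ m / fact m) *\<^sub>R (L ^^ m) x) sums (\<Sum>m\<in>{0}. (0 ^ m / fact m) *\<^sub>R (L ^^ m) x)"
      by (rule sums_finite) auto
    then show ?thesis unfolding T_def by (simp add: sums_unique[symmetric])
  qed
  have E_add: "E (s + t) (u l j) = (\<Sum>k<n. E t (u k j) * E s (u l k))"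
    if u: "unitary_corep tn \<Delta> n u" "l < n" "j < n" for s t n u l j
  proof (rule sums_unique2[OF e_sums[OF u]])
    have "(\<lambda>m. \<Sum>k<n. \<Sum>i\<le>m. e s i (u l k) * e t (m - i) (u k j)) sums (\<Sum>k<n. E s (u l k) * E t (u k j))"
      unfolding E_def by (intro sums_sum Cauchy_product_sums e_summable[OF u(1)]) (use u in auto)
    moreover have "(\<Sum>k<n. \<Sum>i\<le>m. e s i (u l k) * e t (m - i) (u k j)) = e (s + t) m (u l j)" for m
    proof -
      have "(\<Sum>k<n. \<Sum>i\<le>m. e s i (u l k) * e t (m - i) (u k j)) =
          (\<Sum>i\<le>m. \<Sum>k<n. e s i (u l k) * e t (m - i) (u k j))"
        by (rule sum.swap)
      \<comment> \<open>The sum over \<open>k\<close> is a matrix product and collapses to the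
        \<open>m\<close>-th power whatever the split \<open>i\<close>; what remains is the binomial
        expansion of \<open>(s + t) ^ m / fact m\<close>.\<close>
      also have "\<dots> = (\<Sum>i\<le>m. complex_of_real (s ^ i / fact i * (t ^ (m - i) / fact (m - i))) * counit ((L ^^ m) (u l j)))"
      proof (rule sum.cong[OF refl])
        fix i assume "i \<in> {..m}"
        then have "counit ((L ^^ m) (u l j)) = (\<Sum>k<n. counit ((L ^^ (m - i)) (u k j)) * counit ((L ^^ i) (u l k)))"
          using coeff_add[OF u, of i "m - i"] by simp
        then show "(\<Sum>k<n. e s i (u l k) * e t (m - i) (u k j)) =
            complex_of_real (s ^ i / fact i * (t ^ (m - i) / fact (m - i))) * counit ((L ^^ m) (u l j))"
          by (simp add: e_def sum_distrib_left mult_ac)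
      qed
      also have "\<dots> = complex_of_real (\<Sum>i\<le>m. s ^ i / fact i * (t ^ (m - i) / fact (m - i))) * counit ((L ^^ m) (u l j))"
        by (simp add: sum_distrib_right)
      also have "(\<Sum>i\<le>m. s ^ i / fact i * (t ^ (m - i) / fact (m - i))) = (s + t) ^ m / fact m"
        using exp_series_add_commuting[of s t m] by (simp add: mult.commute divide_inverse)
      finally show ?thesis by (simp add: e_def)
    qed
    ultimately show "(\<lambda>m. e (s + t) m (u l j)) sums (\<Sum>k<n. E t (u k j) * E s (u l k))"
      by (simp add: mult.commute)
  qed
  have T_add: "T (s + t) x = T s (T t x)" if "x \<in> H" for s t x
  proof (rule clinear_on_H_eqI[OF T_lin _ _ that])
    show "clinear_on H (\<lambda>x. T s (T t x))"
      using T_lin T_H unfolding clinear_on_def by (simp add: image_subset_iff)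
    fix n u i j assume u: "unitary_corep tn \<Delta> n u" "i < n" "j < n"
    have "T s (T t (u i j)) = (\<Sum>k<n. \<Sum>l<n. (E t (u k j) * E s (u l k)) *\<^sub>C u i l)"
      unfolding T_corep[OF u] clinear_on_coefficients[OF T_lin u(1,2)]
      using T_corep[OF u(1,2)] by (simp add: cplx.scale_sum_right scaleC_scaleC)
    also have "\<dots> = (\<Sum>l<n. \<Sum>k<n. (E t (u k j) * E s (u l k)) *\<^sub>C u i l)"
      by (rule sum.swap)
    also have "\<dots> = T (s + t) (u i j)"
      unfolding T_corep[OF u] using E_add[OF u(1) _ u(3)] by (simp add: cplx.scale_sum_left)
    finally show "T (s + t) (u i j) = T s (T t (u i j))" ..
  qed
  show thesis
  proof
    show "semigroup_on H T"
      unfolding semigroup_on_def using T_H T_lin T0 T_add by blast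
    show "exp_formula H id L T"
      unfolding exp_formula_def using series by simp
    show "\<forall>t\<ge>0. translation_invariant tn \<Delta> (T t)"
      using translation_invariantI[OF T_lin, where c = "\<lambda>n u k j. E _ (u k j)"] T_corep by blast
  qed
qed

lemma tn_minus_left: "tn (- x) y = - tn x y"
  using tn_scaleC_left[of "-1" x y] by (simp add: scaleC_one)

subsection \<open>C*-completions\<close>

text \<open>By the bound, \<open>h\<close> is Lipschitz for the norm of the images, so it factors
  through \<open>\<iota>\<close> and extends to the closure. Each state property is a limit along
  sequences \<open>X\<close> in the Hopf algebra for which \<open>\<iota> (X n)\<close> and
  \<open>h (X n)\<close> both converge; for positivity the products
  \<open>(X n)\<^sup>\<star> * X n\<close> have to stay in that algebra.\<close>

lemma state_extension:
  fixes \<iota> :: "'a \<Rightarrow> 'b::cstar_algebra"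
  assumes \<iota>: "star_hom_on H \<iota>" and dense: "closure (\<iota> ` H) = UNIV"
    and bound: "\<And>a. a \<in> H \<Longrightarrow> cmod (h a) \<le> norm (\<iota> a)"
  obtains h' where "state h'" "\<And>x y. x \<in> H \<Longrightarrow> y \<in> H \<Longrightarrow> h' ((\<iota> x)\<^sup>\<star> * \<iota> y) = h (x\<^sup>\<star> * y)"
proof -
  have add: "\<iota> (x + y) = \<iota> x + \<iota> y" and mul: "\<iota> (x * y) = \<iota> x * \<iota> y" if "x \<in> H" "y \<in> H" for x y
    using \<iota> that by (auto simp: star_hom_on_def clinear_on_def)
  have sc: "\<iota> (c *\<^sub>C x) = c *\<^sub>C \<iota> x" and st: "\<iota> (x\<^sup>\<star>) = (\<iota> x)\<^sup>\<star>" if "x \<in> H" for x c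
    using \<iota> that by (auto simp: star_hom_on_def clinear_on_def)
  have diff: "\<iota> (x - y) = \<iota> x - \<iota> y" if "x \<in> H" "y \<in> H" for x y
    using add[of "x - y" y] that H_diff by (simp add: algebra_simps)
  have lip: "cmod (h x - h y) \<le> norm (\<iota> x - \<iota> y)" if "x \<in> H" "y \<in> H" for x y
    using bound[OF H_diff[OF that]] that by (simp add: diff h_diff)
  \<comment> \<open>An arbitrary preimage under \<open>\<iota>\<close>; by \<open>lip\<close> its
    choice does not affect the value.\<close>
  define f where "f z = h (inv_into H \<iota> z)" for z
  have f: "f (\<iota> x) = h x" if "x \<in> H" for x
  proof -
    have "inv_into H \<iota> (\<iota> x) \<in> H" "\<iota> (inv_into H \<iota> (\<iota> x)) = \<iota> x"
      using that by (simp_all add: inv_into_into f_inv_into_f)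
    then show ?thesis
      using lip[of "inv_into H \<iota> (\<iota> x)" x] that by (simp add: f_def)
  qed
  have "uniformly_continuous_on (\<iota> ` H) f"
    unfolding uniformly_continuous_on_def
  proof (intro allI impI)
    fix e :: real assume "0 < e"
    then show "\<exists>d>0. \<forall>x\<in>\<iota> ` H. \<forall>x'\<in>\<iota> ` H. dist x' x < d \<longrightarrow> dist (f x') (f x) < e"
      using lip by (intro exI[of _ e]) (force simp: f dist_norm intro: le_less_trans)
  qed
  then obtain g where g: "uniformly_continuous_on (closure (\<iota> ` H)) g" and gf: "\<And>x. x \<in> \<iota> ` H \<Longrightarrow> f x = g x"
    by (rule uniformly_continuous_on_extension_on_closure) blast
  have cont: "isCont g x" for x
    using uniformly_continuous_imp_continuous[OF g] by (simp add: dense continuous_on_eq_continuous_at)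
  have g_\<iota>: "g (\<iota> x) = h x" if "x \<in> H" for x
    using gf[of "\<iota> x"] f[OF that] that by simp
  have approx: "\<exists>X. (\<forall>n. X n \<in> H) \<and> (\<lambda>n. \<iota> (X n)) \<longlonglongrightarrow> x \<and> (\<lambda>n. h (X n)) \<longlonglongrightarrow> g x" for x
  proof -
    have "x \<in> closure (\<iota> ` H)" by (simp add: dense)
    then obtain Y where Y: "\<And>n. Y n \<in> \<iota> ` H" "Y \<longlonglongrightarrow> x"
      unfolding closure_sequential by blast
    then obtain X where X: "\<And>n. X n \<in> H" "\<And>n. Y n = \<iota> (X n)"
      unfolding image_iff by metis
    have "(\<lambda>n. g (Y n)) \<longlonglongrightarrow> g x"
      by (rule isCont_tendsto_compose[OF cont Y(2)])
    moreover have "Y = (\<lambda>n. \<iota> (X n))" using X(2) by blast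
    ultimately show ?thesis
      using X(1) Y(2) by (intro exI[of _ X]) (simp add: g_\<iota>)
  qed
  have limit: "g z = l" if "\<And>n. Z n \<in> H" "(\<lambda>n. \<iota> (Z n)) \<longlonglongrightarrow> z" "(\<lambda>n. h (Z n)) \<longlonglongrightarrow> l" for Z z l
  proof -
    have "(\<lambda>n. g (\<iota> (Z n))) \<longlonglongrightarrow> g z"
      by (rule isCont_tendsto_compose[OF cont that(2)])
    then show ?thesis
      using that by (simp add: g_\<iota> LIMSEQ_unique)
  qed
  have "state g"
    unfolding state_def functional_on_def
  proof (intro conjI ballI allI)
    fix x y
    obtain X where X: "\<And>n. X n \<in> H" "(\<lambda>n. \<iota> (X n)) \<longlonglongrightarrow> x" "(\<lambda>n. h (X n)) \<longlonglongrightarrow> g x"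
      using approx[of x] by blast
    obtain Y where Y: "\<And>n. Y n \<in> H" "(\<lambda>n. \<iota> (Y n)) \<longlonglongrightarrow> y" "(\<lambda>n. h (Y n)) \<longlonglongrightarrow> g y"
      using approx[of y] by blast
    show "g (x + y) = g x + g y"
      by (rule limit[of "\<lambda>n. X n + Y n"])
         (use X Y in \<open>auto simp: add h_add intro: H_add tendsto_add\<close>)
    show "g (c *\<^sub>C x) = c * g x" for c
      by (rule limit[of "\<lambda>n. c *\<^sub>C X n"])
         (use X in \<open>auto simp: sc h_scaleC intro: H_scaleC tendsto_mult_left bounded_linear.tendsto[OF bounded_linear_scaleC]\<close>)
    show "cmod (g x) \<le> norm x"
      by (rule LIMSEQ_le[OF tendsto_norm[OF X(3)] tendsto_norm[OF X(2)]]) (use bound X in auto)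
    have "(\<lambda>n. (\<iota> (X n))\<^sup>\<star> * \<iota> (X n)) \<longlonglongrightarrow> x\<^sup>\<star> * x"
      by (intro tendsto_mult bounded_linear.tendsto[OF bounded_linear_star] X)
    then have "(\<lambda>n. g ((\<iota> (X n))\<^sup>\<star> * \<iota> (X n))) \<longlonglongrightarrow> g (x\<^sup>\<star> * x)"
      by (rule isCont_tendsto_compose[OF cont])
    moreover have "g ((\<iota> (X n))\<^sup>\<star> * \<iota> (X n)) = h ((X n)\<^sup>\<star> * X n)" for n
      using g_\<iota>[of "(X n)\<^sup>\<star> * X n"] X(1)[of n] by (simp add: H_mult H_star mul st)
    ultimately have lim: "(\<lambda>n. h ((X n)\<^sup>\<star> * X n)) \<longlonglongrightarrow> g (x\<^sup>\<star> * x)"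
      by simp
    show "g (x\<^sup>\<star> * x) \<in> \<real>\<^sub>\<ge>\<^sub>0"
      by (rule closed_sequentially[OF closed_nonneg_Reals_complex h_pos lim])
  next
    have "\<iota> 1 = 1" using \<iota> by (simp add: star_hom_on_def)
    then show "g 1 = 1" using g_\<iota>[OF H_one] by simp
  qed
  moreover have "g ((\<iota> x)\<^sup>\<star> * \<iota> y) = h (x\<^sup>\<star> * y)" if "x \<in> H" "y \<in> H" for x y
    using g_\<iota>[of "x\<^sup>\<star> * y"] that by (simp add: H_mult H_star mul st)
  ultimately show thesis by (rule that)
qed

text \<open>The map \<open>\<iota>\<close> enters as a *-homomorphism with dense range whose norm
  dominates \<open>h\<close>, so one argument serves both completions. Forwards, invariance of all
  powers of \<open>L\<close> is summed inside \<open>\<Delta>'\<close> on coefficients and then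
  extended by density.\<close>

lemma translation_invariant_completion:
  fixes \<iota> :: "'a \<Rightarrow> 'b::cstar_algebra" and tn' :: "'b \<Rightarrow> 'b \<Rightarrow> 'c::cstar_algebra"
  assumes L: "clinear_on H L" "L ` H \<subseteq> H"
    and \<iota>: "star_hom_on H \<iota>" and dense: "closure (\<iota> ` H) = UNIV"
    and bound: "\<And>a. a \<in> H \<Longrightarrow> cmod (h a) \<le> norm (\<iota> a)"
    and tn': "min_tensor tn'" and ext: "extends_coproduct tn \<Delta> \<iota> tn' \<Delta>'"
    and T: "cstar_semigroup_of H \<iota> tn' L T"
  shows "translation_invariant tn \<Delta> L \<longleftrightarrow> (\<forall>t\<ge>0. translation_invariant_cstar tn' \<Delta>' (T t))"
proof -
  have \<Delta>': "star_hom_on UNIV \<Delta>'"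
    and \<Delta>'_\<iota>: "\<And>a. a \<in> H \<Longrightarrow> \<Delta>' (\<iota> a) = alg_lift H tn (\<lambda>x y. tn' (\<iota> x) (\<iota> y)) (\<Delta> a)"
    using ext by (auto simp: extends_coproduct_def)
  have T_exp: "exp_formula H \<iota> L T" and T_bounded: "\<And>t. 0 \<le> t \<Longrightarrow> bounded_clinear (T t)"
    and T_tensor: "\<And>t. 0 \<le> t \<Longrightarrow> \<exists>F. tensor_map tn' tn' id (T t) F"
    using T by (auto simp: cstar_semigroup_of_def)
  have \<iota>_lin: "clinear_on H \<iota>" using \<iota> by (simp add: star_hom_on_def)
  have bal: "balanced H (\<lambda>x y. tn' (\<iota> x) (\<iota> y))"
    using tn' \<iota>_lin unfolding balanced_def clinear_on_def min_tensor_def by simp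
  have \<Delta>'_corep: "\<Delta>' (\<iota> (u i j)) = (\<Sum>k<n. tn' (\<iota> (u i k)) (\<iota> (u k j)))"
    if "unitary_corep tn \<Delta> n u" "i < n" "j < n" for n u i j
    unfolding \<Delta>'_\<iota>[OF coefficient_in_H[OF that]] by (rule alg_lift_corep[OF that bal])
  have F_corep: "F' (\<Delta>' (\<iota> (u i j))) = (\<Sum>k<n. tn' (\<iota> (u i k)) (T t (\<iota> (u k j))))"
    if u: "unitary_corep tn \<Delta> n u" "i < n" "j < n" and F': "tensor_map tn' tn' id (T t) F'" for n u i j t F'
  proof -
    have "clinear_on UNIV F'" using F' by (simp add: tensor_map_def bounded_clinear_def)
    then show ?thesis
      unfolding \<Delta>'_corep[OF u] using clinear_on_sum[of UNIV F' "{..<n}"] F' by (simp add: tensor_map_def)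
  qed
  show ?thesis
  proof
    assume ti: "translation_invariant tn \<Delta> L"
    show "\<forall>t\<ge>0. translation_invariant_cstar tn' \<Delta>' (T t)"
    proof (intro allI impI)
      fix t :: real assume t: "0 \<le> t"
      obtain F' where F': "tensor_map tn' tn' id (T t) F'" using T_tensor[OF t] by blast
      have bl: "bounded_linear \<Delta>'" "bounded_linear F'" "bounded_linear (T t)"
        using F' T_bounded[OF t] star_hom_bounded_clinear[OF \<Delta>'] bounded_clinear_bounded_linear
        by (auto simp: tensor_map_def)
      have lin: "clinear_on UNIV \<Delta>'" "clinear_on UNIV F'" "clinear_on UNIV (T t)"
        using F' T_bounded[OF t] \<Delta>' by (auto simp: tensor_map_def bounded_clinear_def star_hom_on_def)
      have corep: "\<Delta>' (T t (\<iota> (u i j))) = F' (\<Delta>' (\<iota> (u i j)))"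
        if u: "unitary_corep tn \<Delta> n u" "i < n" "j < n" for n u i j
      proof -
        have T': "(\<lambda>m. (t ^ m / fact m) *\<^sub>R \<iota> ((L ^^ m) (u k j))) sums T t (\<iota> (u k j))" if "k < n" for k
          using T_exp t coefficient_in_H[OF u(1) that u(3)] unfolding exp_formula_def by blast
        have pow: "(L ^^ m) (u k j) \<in> H" if "k < n" for m k
          using funpow_clinear_on(2)[OF L] coefficient_in_H[OF u(1) that u(3)] by blast
        have "\<Delta>' (\<iota> ((L ^^ m) (u i j))) = (\<Sum>k<n. tn' (\<iota> (u i k)) (\<iota> ((L ^^ m) (u k j))))" for m
        proof -
          have "\<Delta> ((L ^^ m) (u i j)) = (\<Sum>k<n. tn (u i k) ((L ^^ m) (u k j)))"
            using translation_invariant_funpow[OF L ti] u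
            unfolding translation_invariant_iff[OF funpow_clinear_on(1)[OF L]] by blast
          then show ?thesis
            unfolding \<Delta>'_\<iota>[OF pow[OF u(2)]]
            using alg_lift_sum[of n "\<lambda>k. u i k" "\<lambda>k. (L ^^ m) (u k j)", OF coefficient_in_H[OF u(1,2)] pow bal] by simp
        qed
        moreover have "(\<lambda>m. (t ^ m / fact m) *\<^sub>R \<Delta>' (\<iota> ((L ^^ m) (u i j)))) sums \<Delta>' (T t (\<iota> (u i j)))"
          using bounded_linear.sums[OF bl(1) T'[OF u(2)]]
          by (simp add: linear_scale[OF bounded_linear.linear[OF bl(1)]])
        ultimately have "(\<lambda>m. \<Sum>k<n. (t ^ m / fact m) *\<^sub>R tn' (\<iota> (u i k)) (\<iota> ((L ^^ m) (u k j)))) sums \<Delta>' (T t (\<iota> (u i j)))"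
          by (simp add: scaleR_sum_right)
        moreover have "(\<lambda>m. \<Sum>k<n. (t ^ m / fact m) *\<^sub>R tn' (\<iota> (u i k)) (\<iota> ((L ^^ m) (u k j)))) sums
            (\<Sum>k<n. tn' (\<iota> (u i k)) (T t (\<iota> (u k j))))"
        proof (rule sums_sum)
          fix k assume "k \<in> {..<n}"
          then show "(\<lambda>m. (t ^ m / fact m) *\<^sub>R tn' (\<iota> (u i k)) (\<iota> ((L ^^ m) (u k j)))) sums
              tn' (\<iota> (u i k)) (T t (\<iota> (u k j)))"
            using bounded_linear.sums[OF min_tensor_bounded_right[OF tn'] T', of k]
            by (simp add: linear_scale[OF bounded_linear.linear[OF min_tensor_bounded_right[OF tn']]])
        qed
        ultimately have "\<Delta>' (T t (\<iota> (u i j))) = (\<Sum>k<n. tn' (\<iota> (u i k)) (T t (\<iota> (u k j))))"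
          by (rule sums_unique2)
        then show ?thesis by (simp add: F_corep[OF u F'])
      qed
      have on_H: "\<Delta>' (T t (\<iota> a)) = F' (\<Delta>' (\<iota> a))" if "a \<in> H" for a
        using that
      proof (induction rule: H_induct)
        case zero
        have "\<iota> 0 = 0" using \<iota>_lin H_zero unfolding clinear_on_def by (metis cplx.scale_zero_left)
        then show ?case
          using lin clinear_on_diff[of _ 0 0] by (metis diff_self)
      next
        case (step c n u i j y)
        then show ?case
          using corep[OF step(1-3)] coefficient_in_H[OF step(1-3)] lin \<iota>_lin
          by (simp add: clinear_on_def H_scaleC)
      qed
      have "continuous_on UNIV (\<lambda>x. \<Delta>' (T t x))" "continuous_on UNIV (\<lambda>x. F' (\<Delta>' x))"
        using bounded_linear_compose[OF bl(1,3)] bounded_linear_compose[OF bl(2,1)]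
        by (auto intro: linear_continuous_on)
      then have "closed {x. \<Delta>' (T t x) = F' (\<Delta>' x)}"
        by (rule closed_Collect_eq)
      then have "closure (\<iota> ` H) \<subseteq> {x. \<Delta>' (T t x) = F' (\<Delta>' x)}"
        by (intro closure_minimal) (auto simp: on_H)
      then have "\<Delta>' \<circ> T t = F' \<circ> \<Delta>'"
        unfolding dense by (auto simp: fun_eq_iff)
      then show "translation_invariant_cstar tn' \<Delta>' (T t)"
        unfolding translation_invariant_cstar_def using F' by blast
    qed
  next
    assume ti: "\<forall>t\<ge>0. translation_invariant_cstar tn' \<Delta>' (T t)"
    obtain h' where h': "state h'" "\<And>x y. x \<in> H \<Longrightarrow> y \<in> H \<Longrightarrow> h' ((\<iota> x)\<^sup>\<star> * \<iota> y) = h (x\<^sup>\<star> * y)"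
      using state_extension[OF \<iota> dense bound] by blast
    show "translation_invariant tn \<Delta> L"
      unfolding translation_invariant_iff[OF L(1)]
    proof (intro allI impI)
      fix n u i j assume u: "unitary_corep tn \<Delta> n u" "i < n" "j < n"
      have LH: "L (u k j) \<in> H" if "k < n" for k
        using L(2) coefficient_in_H[OF u(1) that u(3)] by blast
      have "\<Delta>' (\<iota> (L (u i j))) = (\<Sum>k<n. tn' (\<iota> (u i k)) (\<iota> (L (u k j))))"
      proof (rule exponential_first_coefficient[OF \<Delta>' tn' T_exp u])
        fix t :: real assume "0 \<le> t"
        then obtain F' where F': "tensor_map tn' tn' id (T t) F'" "\<Delta>' \<circ> T t = F' \<circ> \<Delta>'"
          using ti unfolding translation_invariant_cstar_def by blast
        then show "\<Delta>' (T t (\<iota> (u i j))) = (\<Sum>k<n. tn' (\<iota> (u i k)) (T t (\<iota> (u k j))))"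
          using F_corep[OF u F'(1)] by (metis comp_apply)
      qed
      moreover obtain zs where zs: "set zs \<subseteq> H \<times> H" "\<Delta> (L (u i j)) = (\<Sum>(x, y)\<leftarrow>zs. tn x y)"
        using coproduct_in_tensor_square[OF LH[OF u(2)]] by blast
      moreover have "\<Delta>' (\<iota> (L (u i j))) = (\<Sum>(x, y)\<leftarrow>zs. tn' (\<iota> x) (\<iota> y))"
        unfolding \<Delta>'_\<iota>[OF LH[OF u(2)]] zs(2) by (rule alg_lift_eq[OF zs(1) bal])
      ultimately have "(\<Sum>(x, y)\<leftarrow>zs. tn' (\<iota> x) (\<iota> y)) =
          (\<Sum>(x, y)\<leftarrow>map (\<lambda>k. (u i k, L (u k j))) [0..<n]. tn' (\<iota> x) (\<iota> y))"
        by (simp add: comp_def sum_list_upt_eq_sum)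
      then have "(\<Sum>(x, y)\<leftarrow>zs. tn x y) = (\<Sum>(x, y)\<leftarrow>map (\<lambda>k. (u i k, L (u k j))) [0..<n]. tn x y)"
        by (intro tensor_eq_imp_balanced_eq[OF subspace_H zs(1) _ balanced_tn tn' \<iota>_lin h'])
           (use coefficient_in_H[OF u(1,2)] LH in auto)
      then show "\<Delta> (L (u i j)) = (\<Sum>k<n. tn (u i k) (L (u k j)))"
        by (simp add: zs(2) comp_def sum_list_upt_eq_sum)
    qed
  qed
qed

subsection \<open>The sesquilinear form\<close>

text \<open>Termwise, \<open>h (y\<^sup>\<star> * L y') *\<^sub>C (x\<^sup>\<star> * x')\<close> is
  the value of \<open>G\<close> at \<open>(tn x y)\<^sup>\<star> * tn x' (L y')\<close>, so the two
  nested lifts become one slice of a product in the tensor square.\<close>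

lemma mstar_tensor_form:
  assumes L: "clinear_on H L" and a: "a \<in> H" and b: "b \<in> H"
  shows "mstar_tensor H tn (form_of h L) (\<Delta> a) (\<Delta> b) =
    - G ((\<Delta> a)\<^sup>\<star> * alg_lift H tn (\<lambda>x y. tn x (L y)) (\<Delta> b))"
proof -
  obtain zs where zs: "set zs \<subseteq> H \<times> H" "\<Delta> a = (\<Sum>(x, y)\<leftarrow>zs. tn x y)"
    using coproduct_in_tensor_square[OF a] by blast
  obtain ws where ws: "set ws \<subseteq> H \<times> H" "\<Delta> b = (\<Sum>(x, y)\<leftarrow>ws. tn x y)"
    using coproduct_in_tensor_square[OF b] by blast
  define Lb where "Lb = (\<Sum>(x, y)\<leftarrow>ws. tn x (L y))"
  have Lb: "alg_lift H tn (\<lambda>x y. tn x (L y)) (\<Delta> b) = Lb"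
    unfolding Lb_def ws(2) by (rule alg_lift_eq[OF ws(1) balanced_right[OF L]])
  have L_add: "L (x + y) = L x + L y" and L_sc: "L (c *\<^sub>C x) = c *\<^sub>C L x" if "x \<in> H" "y \<in> H" for x y c
    using L that by (auto simp: clinear_on_def)
  have G0: "G 0 = 0" using G_scaleC[of 0 0] by simp
  have inner: "alg_lift H tn (\<lambda>x' y'. form_of h L y y' *\<^sub>C (x\<^sup>\<star> * x')) (\<Delta> b) = - G ((tn x y)\<^sup>\<star> * Lb)" for x y
  proof -
    have "balanced H (\<lambda>x' y'. form_of h L y y' *\<^sub>C (x\<^sup>\<star> * x'))"
      by (auto simp: balanced_def form_of_def L_add L_sc distrib_left h_add h_scaleC scaleC_add_left
          scaleC_add_right mult_scaleC_right scaleC_scaleC mult.commute algebra_simps)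
    then have "alg_lift H tn (\<lambda>x' y'. form_of h L y y' *\<^sub>C (x\<^sup>\<star> * x')) (\<Delta> b) =
        (\<Sum>(x', y')\<leftarrow>ws. form_of h L y y' *\<^sub>C (x\<^sup>\<star> * x'))"
      unfolding ws(2) by (rule alg_lift_eq[OF ws(1)])
    also have "\<dots> = - G ((tn x y)\<^sup>\<star> * Lb)"
      unfolding Lb_def
      by (induction ws) (auto simp: G0 distrib_left G_add tn_star tn_mult G_tn form_of_def)
    finally show ?thesis .
  qed
  \<comment> \<open>The outer lift is conjugate-linear in both legs, the case that makes
    \<open>balanced\<close> wider than bilinear.\<close>
  have "balanced H (\<lambda>x y. - G ((tn x y)\<^sup>\<star> * Lb))"
    by (auto simp: balanced_def tn_star star_add star_scaleC tn_add_left tn_add_right tn_scaleC_left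
        tn_scaleC_right distrib_right G_add)
  then have "mstar_tensor H tn (form_of h L) (\<Delta> a) (\<Delta> b) = (\<Sum>(x, y)\<leftarrow>zs. - G ((tn x y)\<^sup>\<star> * Lb))"
    unfolding mstar_tensor_def inner zs(2) by (rule alg_lift_eq[OF zs(1)])
  also have "\<dots> = - G ((\<Sum>(x, y)\<leftarrow>zs. tn x y)\<^sup>\<star> * Lb)"
    by (induction zs) (auto simp: G0 distrib_right star_add G_add)
  finally show ?thesis by (simp add: zs(2) Lb)
qed

text \<open>Unitarity writes \<open>tn 1 (u i j)\<close> as the sum over \<open>k\<close> of
  \<open>tn ((u k i)\<^sup>\<star>) 1 * \<Delta> (u k j)\<close>, and \<open>G\<close> pulls out the
  left leg. So the slices against coproducts control all slices
  \<open>G (tn 1 s * w)\<close>.\<close>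

lemma slices_by_coproducts_separate:
  assumes zs: "set zs \<subseteq> H \<times> H"
    and zero: "\<And>a. a \<in> H \<Longrightarrow> G ((\<Delta> a)\<^sup>\<star> * (\<Sum>(x, y)\<leftarrow>zs. tn x y)) = 0"
  shows "(\<Sum>(x, y)\<leftarrow>zs. tn x y) = 0"
proof -
  define w where "w = (\<Sum>(x, y)\<leftarrow>zs. tn x y)"
  \<comment> \<open>Closure of the Hopf algebra under the involution removes the star from
    \<open>\<Delta> a\<close>.\<close>
  have zero': "G (\<Delta> a * w) = 0" if "a \<in> H" for a
    using zero[OF H_star[OF that]] by (simp add: \<Delta>_star star_star w_def)
  have G0: "G 0 = 0" using G_scaleC[of 0 0] by simp
  have slice: "G (tn 1 s * w) = 0" if "s \<in> H" for s
    using that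
  proof (induction rule: H_induct)
    case zero
    show ?case by (simp add: G0)
  next
    case (step c n u i j y)
    have "(\<Sum>k<n. tn ((u k i)\<^sup>\<star>) 1 * \<Delta> (u k j)) = (\<Sum>k<n. \<Sum>l<n. tn ((u k i)\<^sup>\<star> * u k l) (u l j))"
      using step by (simp add: corep_coproduct sum_distrib_left tn_mult)
    also have "\<dots> = (\<Sum>l<n. tn (\<Sum>k<n. (u k i)\<^sup>\<star> * u k l) (u l j))"
      by (subst sum.swap) (simp add: tn_sum_left)
    also have "\<dots> = (\<Sum>l<n. if l = i then tn 1 (u i j) else 0)"
      using step by (intro sum.cong) (auto simp: corep_star_mult)
    finally have "tn 1 (u i j) = (\<Sum>k<n. tn ((u k i)\<^sup>\<star>) 1 * \<Delta> (u k j))"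
      using step by simp
    then have "G (tn 1 (u i j) * w) = (\<Sum>k<n. (u k i)\<^sup>\<star> * G (\<Delta> (u k j) * w))"
      by (simp add: sum_distrib_right mult.assoc G_sum G_mult)
    also have "\<dots> = 0"
      using zero' coefficient_in_H[OF step(1) _ step(3)] by (intro sum.neutral) auto
    finally show ?case
      using step by (simp add: tn_add_right tn_scaleC_right distrib_right mult_scaleC_left G_add G_scaleC)
  qed
  have G_w: "G (tn 1 s * w) = (\<Sum>(x, y)\<leftarrow>zs. h (s * y) *\<^sub>C x)" for s
    unfolding w_def by (induction zs) (auto simp: G0 distrib_left G_add tn_mult G_tn)
  \<comment> \<open>\<open>G\<close> slices the right leg while \<open>slices_separate\<close>
    slices the left one, hence the exchange.\<close>
  let ?zs = "map (\<lambda>(x, y). (y, x)) zs"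
  have "(\<Sum>(y, x)\<leftarrow>?zs. tn x y) = 0"
  proof (rule slices_separate[OF subspace_H H_star])
    show "set ?zs \<subseteq> H \<times> H" using zs by auto
    show "balanced H (\<lambda>y x. tn x y)" by (rule balanced_flip[OF balanced_tn])
    show "(\<Sum>(x, y)\<leftarrow>?zs. h (s * x) *\<^sub>C y) = 0" if "s \<in> H" for s
      using slice[OF that] unfolding G_w by (simp add: comp_def case_prod_unfold)
  qed
  then show ?thesis by (simp add: comp_def case_prod_unfold)
qed

lemma translation_invariant_iff_form:
  assumes L: "clinear_on H L" "L ` H \<subseteq> H"
  shows "translation_invariant tn \<Delta> L \<longleftrightarrow>
    (\<forall>a\<in>H. \<forall>b\<in>H. form_of h L a b *\<^sub>C 1 = mstar_tensor H tn (form_of h L) (\<Delta> a) (\<Delta> b))"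
proof -
  have form: "form_of h L a b *\<^sub>C 1 = - G ((\<Delta> a)\<^sup>\<star> * \<Delta> (L b))" for a b
    using G_\<Delta>[of "a\<^sup>\<star> * L b"] by (simp add: form_of_def \<Delta>_mult \<Delta>_star)
  show ?thesis
  proof
    assume "translation_invariant tn \<Delta> L"
    then show "\<forall>a\<in>H. \<forall>b\<in>H. form_of h L a b *\<^sub>C 1 = mstar_tensor H tn (form_of h L) (\<Delta> a) (\<Delta> b)"
      by (simp add: form mstar_tensor_form[OF L(1)] translation_invariant_def)
  next
    assume eq: "\<forall>a\<in>H. \<forall>b\<in>H. form_of h L a b *\<^sub>C 1 = mstar_tensor H tn (form_of h L) (\<Delta> a) (\<Delta> b)"
    show "translation_invariant tn \<Delta> L"
      unfolding translation_invariant_def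
    proof
      fix b assume b: "b \<in> H"
      define R where "R = alg_lift H tn (\<lambda>x y. tn x (L y)) (\<Delta> b)"
      obtain ws where ws: "set ws \<subseteq> H \<times> H" "\<Delta> b = (\<Sum>(x, y)\<leftarrow>ws. tn x y)"
        using coproduct_in_tensor_square[OF b] by blast
      obtain zs where zs: "set zs \<subseteq> H \<times> H" "\<Delta> (L b) = (\<Sum>(x, y)\<leftarrow>zs. tn x y)"
        using coproduct_in_tensor_square L(2) b by blast
      have R: "R = (\<Sum>(x, y)\<leftarrow>ws. tn x (L y))"
        unfolding R_def ws(2) by (rule alg_lift_eq[OF ws(1) balanced_right[OF L(1)]])
      \<comment> \<open>The difference has to be given by one list over the Hopf algebra; the sign
        goes into the left legs.\<close>
      let ?zs = "zs @ map (\<lambda>(x, y). (- x, L y)) ws"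
      have neg: "(\<Sum>(x, y)\<leftarrow>map (\<lambda>(x, y). (- x, L y)) ws. tn x y) = - R"
        unfolding R by (induction ws) (auto simp: tn_minus_left)
      have sum: "(\<Sum>(x, y)\<leftarrow>?zs. tn x y) = \<Delta> (L b) - R"
        unfolding map_append sum_list_append neg zs(2) by simp
      have "\<Delta> (L b) - R = 0"
        unfolding sum[symmetric]
      proof (rule slices_by_coproducts_separate)
        show "set ?zs \<subseteq> H \<times> H"
          using zs(1) ws(1) L(2) subspace_H by (fastforce intro: cplx.subspace_neg)
        fix a assume a: "a \<in> H"
        have "G ((\<Delta> a)\<^sup>\<star> * \<Delta> (L b)) = G ((\<Delta> a)\<^sup>\<star> * R)"
          using eq a b by (simp add: form mstar_tensor_form[OF L(1)] R_def)
        then show "G ((\<Delta> a)\<^sup>\<star> * (\<Sum>(x, y)\<leftarrow>?zs. tn x y)) = 0"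
          unfolding sum using clinear_on_diff[of G] G by (simp add: right_diff_distrib bounded_clinear_def)
      qed
      then show "\<Delta> (L b) = alg_lift H tn (\<lambda>x y. tn x (L y)) (\<Delta> b)"
        by (simp add: R_def)
    qed
  qed
qed

section \<open>Semigroups on the Hopf *-algebra and norm bounds for the completions\<close>

lemma semigroup_translation_invariant_iff:
  assumes L: "clinear_on H L" "L ` H \<subseteq> H"
  shows "translation_invariant tn \<Delta> L \<longleftrightarrow>
    (\<exists>T. semigroup_on H T \<and> exp_formula H id L T \<and> (\<forall>t\<ge>0. translation_invariant tn \<Delta> (T t)))"
proof
  assume "translation_invariant tn \<Delta> L"
  from exponential_semigroup[OF L this]
  show "\<exists>T. semigroup_on H T \<and> exp_formula H id L T \<and> (\<forall>t\<ge>0. translation_invariant tn \<Delta> (T t))"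
    by blast
next
  assume "\<exists>T. semigroup_on H T \<and> exp_formula H id L T \<and> (\<forall>t\<ge>0. translation_invariant tn \<Delta> (T t))"
  then obtain T where T: "semigroup_on H T" "exp_formula H id L T"
    and ti: "\<And>t. 0 \<le> t \<Longrightarrow> translation_invariant tn \<Delta> (T t)" by blast
  show "translation_invariant tn \<Delta> L"
    unfolding translation_invariant_iff[OF L(1)]
  proof (intro allI impI)
    fix n u i j assume u: "unitary_corep tn \<Delta> n u" "i < n" "j < n"
    \<comment> \<open>The copies of \<open>id\<close> match the general lemma at
      \<open>\<iota> = id\<close>.\<close>
    have "\<Delta> (id (L (u i j))) = (\<Sum>k<n. tn (id (u i k)) (id (L (u k j))))"
    proof (rule exponential_first_coefficient[OF \<Delta> tn T(2) u])
      fix t :: real assume t: "0 \<le> t"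
      then have lin: "clinear_on H (T t)" using T(1) by (simp add: semigroup_on_def)
      show "\<Delta> (T t (id (u i j))) = (\<Sum>k<n. tn (id (u i k)) (T t (id (u k j))))"
        using ti[OF t] u unfolding translation_invariant_iff[OF lin] by simp
    qed
    then show "\<Delta> (L (u i j)) = (\<Sum>k<n. tn (u i k) (L (u k j)))" by simp
  qed
qed

text \<open>The operator norm is tested at the vector of \<open>1\<close>; Cauchy-Schwarz against
  \<open>1\<close> then bounds \<open>h a\<close>.\<close>

lemma reduced_completion_bound:
  assumes "reduced_completion H h \<iota>" "a \<in> H"
  shows "cmod (h a) \<le> norm (\<iota> a)"
proof -
  have "\<forall>b\<in>H. Re (h ((a * b)\<^sup>\<star> * (a * b))) \<le> (norm (\<iota> a))\<^sup>2 * Re (h (b\<^sup>\<star> * b))"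
    using assms unfolding reduced_completion_def by blast
  then have "Re (h (a\<^sup>\<star> * a)) \<le> (norm (\<iota> a))\<^sup>2"
    using H_one by force
  then have "(cmod (h a))\<^sup>2 \<le> (norm (\<iota> a))\<^sup>2"
    using h_Cauchy_Schwarz_one order_trans by blast
  then show ?thesis by (rule power2_le_imp_le) simp
qed

text \<open>The norm of the ambient algebra is a C*-seminorm on the Hopf algebra, hence dominated by
  the universal norm, and states are contractive.\<close>

lemma universal_completion_bound:
  assumes "universal_completion H \<iota>" "a \<in> H"
  shows "cmod (h a) \<le> norm (\<iota> a)"
proof -
  have "cstar_seminorm_on H norm"
    by (simp add: cstar_seminorm_on_def cstar_identity norm_scaleC norm_triangle_ineq norm_mult_ineq)
  then have "norm a \<le> norm (\<iota> a)"
    using assms unfolding universal_completion_def by blast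
  then show ?thesis using h_bound order_trans by blast
qed

end

theorem theorem7p3:
  fixes tn :: "'a::cstar_algebra \<Rightarrow> 'a \<Rightarrow> 't::cstar_algebra"
    and tnL :: "'t \<Rightarrow> 'a \<Rightarrow> 's::cstar_algebra"
    and tnR :: "'a \<Rightarrow> 't \<Rightarrow> 's"
    and \<Delta> :: "'a \<Rightarrow> 't"
    and h :: "'a \<Rightarrow> complex"
    and L :: "'a \<Rightarrow> 'a"
  assumes "compact_quantum_group tn tnL tnR \<Delta>"
    and "haar_state tn \<Delta> h"
    and "faithful h"
    and "gns_symmetric (hopf_alg tn \<Delta>) h L"
  shows
    "((\<exists>\<phi>. functional_on (hopf_alg tn \<Delta>) \<phi> \<and> (\<forall>a\<in>hopf_alg tn \<Delta>. L a = conv_op tn \<Delta> \<phi> a))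
        \<longleftrightarrow> translation_invariant tn \<Delta> L) \<and>
     (translation_invariant tn \<Delta> L \<longleftrightarrow>
        (\<exists>T. semigroup_on (hopf_alg tn \<Delta>) T \<and> exp_formula (hopf_alg tn \<Delta>) id L T \<and>
             (\<forall>t\<ge>0. translation_invariant tn \<Delta> (T t)))) \<and>
     (\<forall>(\<iota> :: 'a \<Rightarrow> 'r::cstar_algebra) (tnr :: 'r \<Rightarrow> 'r \<Rightarrow> 'rr::cstar_algebra) \<Delta>r T.
        reduced_completion (hopf_alg tn \<Delta>) h \<iota> \<longrightarrow> min_tensor tnr \<longrightarrow>
        extends_coproduct tn \<Delta> \<iota> tnr \<Delta>r \<longrightarrow>
        cstar_semigroup_of (hopf_alg tn \<Delta>) \<iota> tnr L T \<longrightarrow>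
        (translation_invariant tn \<Delta> L \<longleftrightarrow>
          (\<forall>t\<ge>0. translation_invariant_cstar tnr \<Delta>r (T t)))) \<and>
     (\<forall>(\<iota> :: 'a \<Rightarrow> 'u::cstar_algebra) (tnu :: 'u \<Rightarrow> 'u \<Rightarrow> 'uu::cstar_algebra) \<Delta>u T.
        universal_completion (hopf_alg tn \<Delta>) \<iota> \<longrightarrow> min_tensor tnu \<longrightarrow>
        extends_coproduct tn \<Delta> \<iota> tnu \<Delta>u \<longrightarrow>
        cstar_semigroup_of (hopf_alg tn \<Delta>) \<iota> tnu L T \<longrightarrow>
        (translation_invariant tn \<Delta> L \<longleftrightarrow>
          (\<forall>t\<ge>0. translation_invariant_cstar tnu \<Delta>u (T t)))) \<and>
     (translation_invariant tn \<Delta> L \<longleftrightarrow>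
        (\<forall>a\<in>hopf_alg tn \<Delta>. \<forall>b\<in>hopf_alg tn \<Delta>.
           form_of h L a b *\<^sub>C 1 =
             mstar_tensor (hopf_alg tn \<Delta>) tn (form_of h L) (\<Delta> a) (\<Delta> b)))"
proof -
  obtain F G where FG: "bounded_clinear F" "\<And>a b. F (tn a b) = h a *\<^sub>C b"
    "bounded_clinear G" "\<And>a b. G (tn a b) = h b *\<^sub>C a"
    "\<And>a. F (\<Delta> a) = h a *\<^sub>C 1" "\<And>a. G (\<Delta> a) = h a *\<^sub>C 1"
    using assms(2) unfolding haar_state_def by blast
  interpret cqg h tn \<Delta> F G
    by unfold_locales
       (use assms FG in \<open>auto simp: compact_quantum_group_def haar_state_def\<close>)
  have L: "clinear_on H L" "L ` H \<subseteq> H"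
    using assms(4) by (auto simp: gns_symmetric_def)
  show ?thesis
  proof (intro conjI allI impI)
    fix \<iota> :: "'a \<Rightarrow> 'r" and tnr :: "'r \<Rightarrow> 'r \<Rightarrow> 'rr" and \<Delta>r T
    assume red: "reduced_completion H h \<iota>"
      and "min_tensor tnr" "extends_coproduct tn \<Delta> \<iota> tnr \<Delta>r" "cstar_semigroup_of H \<iota> tnr L T"
    then show "translation_invariant tn \<Delta> L \<longleftrightarrow> (\<forall>t\<ge>0. translation_invariant_cstar tnr \<Delta>r (T t))"
      using red unfolding reduced_completion_def
      by (intro translation_invariant_completion[OF L _ _ reduced_completion_bound[OF red]]) auto
  next
    fix \<iota> :: "'a \<Rightarrow> 'u" and tnu :: "'u \<Rightarrow> 'u \<Rightarrow> 'uu" and \<Delta>u T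
    assume univ: "universal_completion H \<iota>"
      and "min_tensor tnu" "extends_coproduct tn \<Delta> \<iota> tnu \<Delta>u" "cstar_semigroup_of H \<iota> tnu L T"
    then show "translation_invariant tn \<Delta> L \<longleftrightarrow> (\<forall>t\<ge>0. translation_invariant_cstar tnu \<Delta>u (T t))"
      using univ unfolding universal_completion_def
      by (intro translation_invariant_completion[OF L _ _ universal_completion_bound[OF univ]]) auto
  qed (fact convolution_iff_translation_invariant[OF L] semigroup_translation_invariant_iff[OF L]
      translation_invariant_iff_form[OF L])+
qed

end
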